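(* For any $(p_{XY},p_{Z|XY})$, \[R_{NS}=\min_{p_{U|XYZ}} I(X,Z;U|Y),\] where the minimum is over all conditional p.m.f.'s $p_{U|XYZ}$ (with $(U,X,Y,Z)\sim p_{XY}p_{Z|XY}p_{U|XYZ}$) such that $U-X-Y$ and $Z-(U,Y)-X$ are Markov chains, and where the alphabet $\mathcal{U}$ of $U$ may be taken to satisfy $|\mathcal{U}|\le|\mathcal{X}|\cdot|\mathcal{Y}|\cdot|\mathcal{Z}|+2$.
   Context: Setup: $\mathcal{X},\mathcal{Y},\mathcal{Z}$ finite; Alice observes $X^n$, Bob observes $Y^n$, where $(X_i,Y_i)$ are i.i.d. according to $p_{XY}$; Bob wants an output distributed according to $p_{Z^n|X^nY^n}(z^n|x^n,y^n)=\prod_{i=1}^n p_{Z|XY}(z_i|x_i,y_i)$, and $p_{X^nY^nZ^n}$ denotes the resulting joint p.m.f. An $(n,2^{nR})$-code is a pair of stochastic maps $(p_{M|X^n},p_{\hat Z^n|MY^n})$ with $M\in\{1,\dots,2^{nR}\}$ (Alice sends $M$, Bob outputs $\hat Z^n$); it induces $p_{X^nY^nM\hat Z^n}=p_{X^nY^n}p_{M|X^n}p_{\hat Z^n|MY^n}$. Total variation distance: $\|p-q\|_1=\frac12\sum_u|p(u)-q(u)|$. A rate $R$ is achievable (without privacy) if there is a sequence of codes of rate $R$ such that for every $\epsilon>0$ there is a large enough $n$ with $\|p_{X^nY^n\hat Z^n}-p_{X^nY^nZ^n}\|_1\le\epsilon$. $R_{NS}$ is the infimum of achievable rates. *)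

theory Defs
  imports "HOL-Probability.Probability"
begin

definition entropy2 :: "'a pmf \<Rightarrow> real" where
  "entropy2 p = - (\<Sum>a\<in>set_pmf p. pmf p a * log 2 (pmf p a))"

definition cond_mutual_info :: "('a \<times> 'b \<times> 'c) pmf \<Rightarrow> real" where
  "cond_mutual_info j =
     entropy2 (map_pmf (\<lambda>(a,b,c). (a,c)) j) + entropy2 (map_pmf (\<lambda>(a,b,c). (b,c)) j)
     - entropy2 (map_pmf (\<lambda>(a,b,c). c) j) - entropy2 j"

text \<open>A - C - B is a Markov chain (A and B conditionally independent given C)
  for a joint p.m.f. of (A,B,C).\<close>
definition markov_chain :: "('a \<times> 'b \<times> 'c) pmf \<Rightarrow> bool" where
  "markov_chain j \<longleftrightarrow> (\<forall>a b c.
     pmf j (a,b,c) * pmf (map_pmf (\<lambda>(a,b,c). c) j) c =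
     pmf (map_pmf (\<lambda>(a,b,c). (a,c)) j) (a,c) * pmf (map_pmf (\<lambda>(a,b,c). (b,c)) j) (b,c))"

fun iid_pmf :: "nat \<Rightarrow> 'a pmf \<Rightarrow> 'a list pmf" where
  "iid_pmf 0 p = return_pmf []"
| "iid_pmf (Suc n) p = do { a \<leftarrow> p; as \<leftarrow> iid_pmf n p; return_pmf (a # as) }"

fun prod_list_pmf :: "'a pmf list \<Rightarrow> 'a list pmf" where
  "prod_list_pmf [] = return_pmf []"
| "prod_list_pmf (p # ps) = do { a \<leftarrow> p; as \<leftarrow> prod_list_pmf ps; return_pmf (a # as) }"

definition tv_dist :: "'a pmf \<Rightarrow> 'a pmf \<Rightarrow> real" where
  "tv_dist p q = (1/2) * (\<Sum>\<^sub>\<infinity>u. \<bar>pmf p u - pmf q u\<bar>)"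

definition source_n :: "('x \<times> 'y) pmf \<Rightarrow> nat \<Rightarrow> ('x list \<times> 'y list) pmf" where
  "source_n pXY n = map_pmf (\<lambda>ps. (map fst ps, map snd ps)) (iid_pmf n pXY)"

definition target_n :: "('x \<times> 'y) pmf \<Rightarrow> ('x \<Rightarrow> 'y \<Rightarrow> 'z pmf) \<Rightarrow> nat
    \<Rightarrow> ('x list \<times> 'y list \<times> 'z list) pmf" where
  "target_n pXY pZ n = do {
     (xs, ys) \<leftarrow> source_n pXY n;
     zs \<leftarrow> prod_list_pmf (map2 pZ xs ys);
     return_pmf (xs, ys, zs) }"

definition code_n :: "('x \<times> 'y) pmf \<Rightarrow> ('x list \<Rightarrow> nat pmf) \<Rightarrow> (nat \<Rightarrow> 'y list \<Rightarrow> 'z list pmf)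
    \<Rightarrow> nat \<Rightarrow> ('x list \<times> 'y list \<times> 'z list) pmf" where
  "code_n pXY enc dec n = do {
     (xs, ys) \<leftarrow> source_n pXY n;
     m \<leftarrow> enc xs;
     zs \<leftarrow> dec m ys;
     return_pmf (xs, ys, zs) }"

definition num_msgs :: "nat \<Rightarrow> real \<Rightarrow> nat" where
  "num_msgs n R = nat \<lfloor>2 powr (real n * R)\<rfloor>"

definition achievable :: "('x \<times> 'y) pmf \<Rightarrow> ('x \<Rightarrow> 'y \<Rightarrow> 'z pmf) \<Rightarrow> real \<Rightarrow> bool" where
  "achievable pXY pZ R \<longleftrightarrow> 0 \<le> R \<and>
     (\<exists>(enc :: nat \<Rightarrow> 'x list \<Rightarrow> nat pmf) (dec :: nat \<Rightarrow> nat \<Rightarrow> 'y list \<Rightarrow> 'z list pmf).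
        (\<forall>n xs. set_pmf (enc n xs) \<subseteq> {1..num_msgs n R}) \<and>
        (\<forall>\<epsilon>>0. \<exists>N. \<forall>n\<ge>N.
            tv_dist (code_n pXY (enc n) (dec n) n) (target_n pXY pZ n) \<le> \<epsilon>))"

definition R_NS :: "('x \<times> 'y) pmf \<Rightarrow> ('x \<Rightarrow> 'y \<Rightarrow> 'z pmf) \<Rightarrow> real" where
  "R_NS pXY pZ = Inf {R. achievable pXY pZ R}"

text \<open>Joint p.m.f. of (U,X,Y,Z) ~ p_XY p_{Z|XY} p_{U|XYZ}; U takes values in nat
  (any finite alphabet, up to relabelling).\<close>
definition joint_UXYZ :: "('x \<times> 'y) pmf \<Rightarrow> ('x \<Rightarrow> 'y \<Rightarrow> 'z pmf) \<Rightarrow> ('x \<Rightarrow> 'y \<Rightarrow> 'z \<Rightarrow> nat pmf)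
    \<Rightarrow> (nat \<times> 'x \<times> 'y \<times> 'z) pmf" where
  "joint_UXYZ pXY pZ pU = do {
     (x, y) \<leftarrow> pXY; z \<leftarrow> pZ x y; u \<leftarrow> pU x y z; return_pmf (u, x, y, z) }"

definition feasible_U :: "('x \<times> 'y) pmf \<Rightarrow> ('x \<Rightarrow> 'y \<Rightarrow> 'z pmf) \<Rightarrow> ('x \<Rightarrow> 'y \<Rightarrow> 'z \<Rightarrow> nat pmf) \<Rightarrow> bool" where
  "feasible_U pXY pZ pU \<longleftrightarrow>
     finite (\<Union>x y z. set_pmf (pU x y z)) \<and>
     markov_chain (map_pmf (\<lambda>(u,x,y,z). (u, y, x)) (joint_UXYZ pXY pZ pU)) \<and>
     markov_chain (map_pmf (\<lambda>(u,x,y,z). (z, x, (u, y))) (joint_UXYZ pXY pZ pU))"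

definition info_XZ_U_given_Y :: "('x \<times> 'y) pmf \<Rightarrow> ('x \<Rightarrow> 'y \<Rightarrow> 'z pmf) \<Rightarrow> ('x \<Rightarrow> 'y \<Rightarrow> 'z \<Rightarrow> nat pmf) \<Rightarrow> real" where
  "info_XZ_U_given_Y pXY pZ pU =
     cond_mutual_info (map_pmf (\<lambda>(u,x,y,z). ((x, z), u, y)) (joint_UXYZ pXY pZ pU))"

end

theory Submission
  imports Defs "HOL-Real_Asymp.Real_Asymp"
begin

text \<open>
  Achievability. The Markov conditions mean that the joint law factors as
  q(u) V(x|u) W(y|x) B(z|u,y). Draw a codebook u(m,l) of K L independent words; with (m,l) uniform
  and X, Y, Z produced by the channels, soft covering makes the law of (X,Y,Z) close to the target as
  soon as the total rate exceeds I(U;XYZ). Alice samples m from the posterior given X, which is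
  possible because (m,l) and Y are independent given X, and Bob recovers l from Y by thresholding the
  likelihood, which succeeds if the rate of l is below I(U;Y). What remains for m is
  I(U;XYZ) - I(U;Y) = I(XZ;U|Y).

  Converse. For a block code take as auxiliary variable a uniform index q together with the message and all
  of Y^n except Y_q. Given its value, the law of (X_q,Y_q,Z_q) has the form a(x) W(y|x) B(z|y).
  One application of Gibbs' inequality bounds the average of H(X_q Z_q|Y_q) over these laws from
  below. The pairs (law, H(XZ|Y)) of this form make up a compact set, so its
  convex hull is compact too; this allows passing to the limit, and Caratheodory's theorem in dimension
  |X||Y||Z| + 1 yields the bound on the alphabet of U.
\<close>

section \<open>Sums over lists and entropy estimates\<close>

text \<open>Three obstacles shape the proof. (1) There is no common randomness, so the codebook must
  be fixed in advance: the expected covering error and the expected decoding error are added before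
  a codebook is chosen, and one codebook is good for both. (2) Closeness of block laws does not make
  a single-letter law equal to the target, and it controls the entropy of a block only up to about
  \<delta> n log(|X||Y||Z|). This disappears after division by n only if \<delta> tends to 0, so the
  converse yields near misses and needs a compact set that contains their limit. (3) The alphabet of
  U grows with n, so the auxiliary variables themselves have no limit. Recording each conditional
  law together with its entropy H(XZ|Y) turns I(XZ;U|Y) into H(XZ|Y) minus a linear functional on a
  convex hull of fixed dimension. The minimum in the theorem is then a maximum of the last
  coordinate over the fibre above the target, which is nonempty because U = X is a legal
  choice.\<close>

definition nlists :: "nat \<Rightarrow> 'a set \<Rightarrow> 'a list set" where
  "nlists n A = {xs. length xs = n \<and> set xs \<subseteq> A}"

lemma nlists_0 [simp]: "nlists 0 A = {[]}"
  by (auto simp: nlists_def)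

lemma finite_nlists:
  assumes "finite A" shows "finite (nlists n A)"
proof -
  have "nlists n A = {xs. set xs \<subseteq> A \<and> length xs = n}" unfolding nlists_def by blast
  then show ?thesis using finite_lists_length_eq[OF assms] by simp
qed

lemma nlists_iff_nth: "xs \<in> nlists n A \<longleftrightarrow> length xs = n \<and> (\<forall>i<n. xs ! i \<in> A)"
  unfolding nlists_def using all_set_conv_all_nth[of xs "\<lambda>x. x \<in> A"] by auto

lemma sum_nlists_Suc:
  assumes "finite A"
  shows "sum F (nlists (Suc n) A) = (\<Sum>a\<in>A. \<Sum>xs\<in>nlists n A. F (a # xs))"
proof -
  have *: "nlists (Suc n) A = (\<lambda>(a,xs). a # xs) ` (A \<times> nlists n A)"
    by (auto simp: nlists_def length_Suc_conv image_iff)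
  have "inj_on (\<lambda>(a,xs). a # xs) (A \<times> nlists n A)"
    by (auto simp: inj_on_def)
  then show ?thesis
    unfolding * by (simp add: sum.reindex sum.cartesian_product case_prod_unfold)
qed

lemma sum_prod_nlists:
  fixes f :: "nat \<Rightarrow> 'a \<Rightarrow> 'b::comm_semiring_1"
  assumes "finite A"
  shows "(\<Sum>xs\<in>nlists n A. \<Prod>i<n. f i (xs ! i)) = (\<Prod>i<n. \<Sum>a\<in>A. f i a)"
proof (induction n arbitrary: f)
  case (Suc n)
  show ?case
    by (simp add: sum_nlists_Suc[OF assms] prod.lessThan_Suc_shift Suc[of "\<lambda>i. f (Suc i)"]
        del: prod.lessThan_Suc flip: sum_distrib_left sum_distrib_right)
qed auto

text \<open>Tuples of words become words of tuples, so that the single-letter lemmas for i.i.d.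
  words also serve joint laws.\<close>

lemma sum_nlists_zip:
  "(\<Sum>ts\<in>nlists n (A \<times> B). F (map fst ts) (map snd ts)) = (\<Sum>xs\<in>nlists n A. \<Sum>ys\<in>nlists n B. F xs ys)"
proof -
  have "(\<Sum>xs\<in>nlists n A. \<Sum>ys\<in>nlists n B. F xs ys) = (\<Sum>(xs,ys)\<in>nlists n A \<times> nlists n B. F xs ys)"
    by (simp add: sum.cartesian_product)
  also have "\<dots> = (\<Sum>ts\<in>nlists n (A \<times> B). F (map fst ts) (map snd ts))"
  proof (rule sum.reindex_bij_witness[of _ "\<lambda>ts. (map fst ts, map snd ts)" "\<lambda>xy. zip (fst xy) (snd xy)"])
    fix xy assume "xy \<in> nlists n A \<times> nlists n B"
    then show "(map fst (zip (fst xy) (snd xy)), map snd (zip (fst xy) (snd xy))) = xy"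
      "zip (fst xy) (snd xy) \<in> nlists n (A \<times> B)"
      "F (map fst (zip (fst xy) (snd xy))) (map snd (zip (fst xy) (snd xy))) = (case xy of (xs, ys) \<Rightarrow> F xs ys)"
      by (simp_all add: nlists_iff_nth mem_Times_iff case_prod_unfold)
  next
    fix ts assume "ts \<in> nlists n (A \<times> B)"
    then show "zip (fst (map fst ts, map snd ts)) (snd (map fst ts, map snd ts)) = ts"
      "(map fst ts, map snd ts) \<in> nlists n A \<times> nlists n B"
      by (simp_all add: nlists_iff_nth mem_Times_iff zip_map_fst_snd)
  qed
  finally show ?thesis by simp
qed

lemma sum_nlists_additive:
  fixes p f :: "'a \<Rightarrow> real"
  assumes A: "finite A" and p: "sum p A = 1"
  shows "(\<Sum>xs\<in>nlists n A. (\<Prod>i<n. p (xs ! i)) * (\<Sum>i<n. f (xs ! i))) = n * (\<Sum>a\<in>A. p a * f a)"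
proof (induction n)
  case (Suc n)
  have *: "(\<Sum>xs\<in>nlists n A. \<Prod>i<n. p (xs ! i)) = 1"
    using sum_prod_nlists[OF A, of "\<lambda>_. p" n] p by simp
  have alg: "b * c * (d + e) = b * d * c + b * (c * e)" for b c d e :: real
    by (simp add: algebra_simps)
  have "(\<Sum>xs\<in>nlists (Suc n) A. (\<Prod>i<Suc n. p (xs ! i)) * (\<Sum>i<Suc n. f (xs ! i)))
    = (\<Sum>a\<in>A. \<Sum>xs\<in>nlists n A. p a * f a * (\<Prod>i<n. p (xs ! i)) + p a * ((\<Prod>i<n. p (xs ! i)) * (\<Sum>i<n. f (xs ! i))))"
    unfolding sum_nlists_Suc[OF A] prod.lessThan_Suc_shift sum.lessThan_Suc_shift
    by (simp only: nth_Cons_0 nth_Cons_Suc alg)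
  also have "\<dots> = (\<Sum>a\<in>A. p a * f a) * (\<Sum>xs\<in>nlists n A. \<Prod>i<n. p (xs ! i))
      + sum p A * (\<Sum>xs\<in>nlists n A. (\<Prod>i<n. p (xs ! i)) * (\<Sum>i<n. f (xs ! i)))"
    unfolding sum.distrib by (simp only: sum_product)
  also have "\<dots> = real (Suc n) * (\<Sum>a\<in>A. p a * f a)"
    unfolding * p Suc by (simp add: distrib_right)
  finally show ?case .
qed auto

text \<open>Since \<open>f\<close> is centred, the cross term of the expanded square vanishes and
  each letter contributes its own second moment. This is additivity of the variance for i.i.d.
  letters.\<close>

lemma sum_nlists_additive_sq:
  fixes p f :: "'a \<Rightarrow> real"
  assumes A: "finite A" and p: "sum p A = 1" and f: "(\<Sum>a\<in>A. p a * f a) = 0"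
  shows "(\<Sum>xs\<in>nlists n A. (\<Prod>i<n. p (xs ! i)) * (\<Sum>i<n. f (xs ! i))\<^sup>2) = n * (\<Sum>a\<in>A. p a * (f a)\<^sup>2)"
proof (induction n)
  case (Suc n)
  have *: "(\<Sum>xs\<in>nlists n A. \<Prod>i<n. p (xs ! i)) = 1"
    using sum_prod_nlists[OF A, of "\<lambda>_. p" n] p by simp
  have **: "(\<Sum>xs\<in>nlists n A. (\<Prod>i<n. p (xs ! i)) * (\<Sum>i<n. f (xs ! i))) = 0"
    using sum_nlists_additive[OF A p, of n f] f by simp
  have alg: "b * c * (d + e)\<^sup>2 = b * d\<^sup>2 * c + 2 * (b * d) * (c * e) + b * (c * e\<^sup>2)" for b c d e :: real
    by (simp add: power2_eq_square algebra_simps)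
  have "(\<Sum>xs\<in>nlists (Suc n) A. (\<Prod>i<Suc n. p (xs ! i)) * (\<Sum>i<Suc n. f (xs ! i))\<^sup>2)
    = (\<Sum>a\<in>A. \<Sum>xs\<in>nlists n A. p a * (f a)\<^sup>2 * (\<Prod>i<n. p (xs ! i))
         + 2 * (p a * f a) * ((\<Prod>i<n. p (xs ! i)) * (\<Sum>i<n. f (xs ! i)))
         + p a * ((\<Prod>i<n. p (xs ! i)) * (\<Sum>i<n. f (xs ! i))\<^sup>2))"
    unfolding sum_nlists_Suc[OF A] prod.lessThan_Suc_shift sum.lessThan_Suc_shift
    by (simp only: nth_Cons_0 nth_Cons_Suc alg)
  also have "\<dots> = (\<Sum>a\<in>A. p a * (f a)\<^sup>2) * (\<Sum>xs\<in>nlists n A. \<Prod>i<n. p (xs ! i))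
      + (\<Sum>a\<in>A. 2 * (p a * f a)) * (\<Sum>xs\<in>nlists n A. (\<Prod>i<n. p (xs ! i)) * (\<Sum>i<n. f (xs ! i)))
      + sum p A * (\<Sum>xs\<in>nlists n A. (\<Prod>i<n. p (xs ! i)) * (\<Sum>i<n. f (xs ! i))\<^sup>2)"
    unfolding sum.distrib by (simp only: sum_product)
  also have "\<dots> = real (Suc n) * (\<Sum>a\<in>A. p a * (f a)\<^sup>2)"
    unfolding * ** p Suc by (simp add: distrib_right)
  finally show ?case .
qed auto

text \<open>Chebyshev's inequality: where the indicator is 1, the squared deviation is at least
  \<open>(n * \<delta>)\<^sup>2\<close>. The bound is of order 1/n, which is enough for
  achievability.\<close>

lemma weak_law_nlists:
  fixes p f :: "'a \<Rightarrow> real"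
  assumes A: "finite A" and p: "sum p A = 1" and nonneg: "\<And>a. a \<in> A \<Longrightarrow> 0 \<le> p a"
    and mu: "\<mu> = (\<Sum>a\<in>A. p a * f a)" and d: "\<delta> > 0" and n: "n > 0"
  shows "(\<Sum>xs\<in>nlists n A. (\<Prod>i<n. p (xs ! i)) * of_bool (n * \<delta> \<le> \<bar>(\<Sum>i<n. f (xs ! i)) - n * \<mu>\<bar>))
     \<le> (\<Sum>a\<in>A. p a * (f a - \<mu>)\<^sup>2) / (n * \<delta>\<^sup>2)"
proof -
  let ?g = "\<lambda>a. f a - \<mu>"
  have zero: "(\<Sum>a\<in>A. p a * ?g a) = 0"
  proof -
    have "(\<Sum>a\<in>A. p a * ?g a) = (\<Sum>a\<in>A. p a * f a) - sum p A * \<mu>"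
      by (simp only: right_diff_distrib sum_subtractf sum_distrib_right)
    then show ?thesis unfolding p mu[symmetric] by simp
  qed
  have "(n * \<delta>)\<^sup>2 * (\<Sum>xs\<in>nlists n A. (\<Prod>i<n. p (xs ! i)) * of_bool (n * \<delta> \<le> \<bar>(\<Sum>i<n. f (xs ! i)) - n * \<mu>\<bar>))
     \<le> (\<Sum>xs\<in>nlists n A. (\<Prod>i<n. p (xs ! i)) * (\<Sum>i<n. ?g (xs ! i))\<^sup>2)"
    unfolding sum_distrib_left
  proof (rule sum_mono)
    fix xs assume xs: "xs \<in> nlists n A"
    have "0 \<le> (\<Prod>i<n. p (xs ! i))"
      using xs by (auto intro!: prod_nonneg nonneg simp: nlists_iff_nth)
    moreover have "(n * \<delta>)\<^sup>2 * of_bool (n * \<delta> \<le> \<bar>(\<Sum>i<n. f (xs ! i)) - n * \<mu>\<bar>) \<le> (\<Sum>i<n. ?g (xs ! i))\<^sup>2"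
    proof (cases "n * \<delta> \<le> \<bar>(\<Sum>i<n. f (xs ! i)) - n * \<mu>\<bar>")
      case True
      have "(n * \<delta>)\<^sup>2 \<le> \<bar>(\<Sum>i<n. f (xs ! i)) - n * \<mu>\<bar>\<^sup>2"
        by (rule power_mono[OF True]) (use d in auto)
      then show ?thesis using True by (simp add: sum_subtractf)
    qed auto
    ultimately show "(n * \<delta>)\<^sup>2 * ((\<Prod>i<n. p (xs ! i)) * of_bool (n * \<delta> \<le> \<bar>(\<Sum>i<n. f (xs ! i)) - n * \<mu>\<bar>))
      \<le> (\<Prod>i<n. p (xs ! i)) * (\<Sum>i<n. ?g (xs ! i))\<^sup>2"
      by (metis mult.left_commute mult_left_mono)
  qed
  also have "\<dots> = n * (\<Sum>a\<in>A. p a * (?g a)\<^sup>2)"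
    by (rule sum_nlists_additive_sq[OF A p zero])
  finally have *: "(n * \<delta>)\<^sup>2 * (\<Sum>xs\<in>nlists n A. (\<Prod>i<n. p (xs ! i)) * of_bool (n * \<delta> \<le> \<bar>(\<Sum>i<n. f (xs ! i)) - n * \<mu>\<bar>))
    \<le> n * (\<Sum>a\<in>A. p a * (?g a)\<^sup>2)" .
  have "s \<le> v / (n * \<delta>\<^sup>2)" if "(n * \<delta>)\<^sup>2 * s \<le> n * v" for s v :: real
    using that n d by (simp add: field_simps power2_eq_square)
  from this[OF *] show ?thesis .
qed

section \<open>The entropy summand and its continuity estimates\<close>

definition eta :: "real \<Rightarrow> real" where "eta t = - (t * log 2 t)"

lemma eta_0 [simp]: "eta 0 = 0" by (simp add: eta_def)

lemma eta_mult: "a \<ge> 0 \<Longrightarrow> b \<ge> 0 \<Longrightarrow> eta (a * b) = a * eta b + b * eta a"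
  by (cases "a = 0"; cases "b = 0") (auto simp: eta_def log_mult algebra_simps)

lemma continuous_on_eta: "continuous_on {0..} eta"
  unfolding continuous_on_eq_continuous_within
proof
  fix x :: real assume x: "x \<in> {0..}"
  show "continuous (at x within {0..}) eta"
  proof (cases "x = 0")
    case True
    \<comment> \<open>The point 0 is the only delicate one: t log t tends to 0 from the
      right.\<close>
    have "((\<lambda>t::real. t * log 2 t) \<longlongrightarrow> 0) (at_right 0)"
      by real_asymp
    then have "(eta \<longlongrightarrow> 0) (at_right 0)"
      unfolding eta_def using tendsto_minus by fastforce
    then show ?thesis
      using True by (simp add: continuous_within at_within_Ici_at_right)
  next
    case False
    with x have "isCont eta x"
      unfolding eta_def[abs_def] by (auto intro!: continuous_intros)
    then show ?thesis by (rule continuous_at_imp_continuous_at_within)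
  qed
qed

text \<open>The logarithm is increasing, so replacing \<open>log 2 c\<close> by
  \<open>log 2 (c + d)\<close> can only increase the product with \<open>c\<close>.\<close>

lemma eta_add_le:
  assumes "a \<ge> 0" "b \<ge> 0" shows "eta (a + b) \<le> eta a + eta b"
proof -
  have *: "c * log 2 c \<le> c * log 2 (c + d)" if "c \<ge> 0" "d \<ge> 0" for c d :: real
    using that by (cases "c = 0") (auto intro!: mult_left_mono)
  show ?thesis
    using *[of a b] *[of b a] assms by (simp add: eta_def algebra_simps)
qed

lemma log2_le: "x > 0 \<Longrightarrow> log 2 x \<le> (x - 1) / ln 2"
  using ln_le_minus_one[of x] by (simp add: log_def divide_right_mono)

text \<open>
  Together with subadditivity this gives a Fannes-type continuity bound: two distributions are
  compared with their pointwise minimum.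
\<close>
lemma eta_add_ge:
  assumes "a \<ge> 0" "b \<ge> 0" "a + b \<le> 1" shows "eta a - b / ln 2 \<le> eta (a + b)"
proof (cases "a = 0")
  case True
  have "eta b \<ge> 0" using assms True
    by (cases "b = 0") (auto simp: eta_def mult_nonneg_nonpos)
  moreover have "b / ln 2 \<ge> 0" using assms by simp
  ultimately show ?thesis using True by simp
next
  case False
  with assms have a: "a > 0" by simp
  have "log 2 (a + b) - log 2 a = log 2 (1 + b / a)"
    using a assms log_divide[of 2 "a + b" a] by (simp add: add_divide_distrib)
  also have "\<dots> \<le> (b / a) / ln 2"
    using log2_le[of "1 + b/a"] a assms by (simp add: add_pos_nonneg)
  finally have "a * (log 2 (a + b) - log 2 a) \<le> b / ln 2"
    using a by (simp add: field_simps)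
  moreover have "b * log 2 (a + b) \<le> 0"
    using a assms by (intro mult_nonneg_nonpos) auto
  ultimately show ?thesis by (simp add: eta_def algebra_simps)
qed

text \<open>Sum of log t \<le> (t - 1)/ln 2 for t = q/p, weighted with p. The total masses are
  compared by an inequality because both reference measures used later contain quotients x/x, which
  are 0 rather than 1 at x = 0 and may lose mass.\<close>

lemma Gibbs_inequality:
  fixes p q :: "'a \<Rightarrow> real"
  assumes "finite A" and p: "\<And>a. a \<in> A \<Longrightarrow> 0 \<le> p a" and q: "\<And>a. a \<in> A \<Longrightarrow> 0 \<le> q a"
    and pos: "\<And>a. a \<in> A \<Longrightarrow> 0 < p a \<Longrightarrow> 0 < q a" and le: "sum q A \<le> sum p A"
  shows "(\<Sum>a\<in>A. eta (p a)) \<le> - (\<Sum>a\<in>A. p a * log 2 (q a))"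
proof -
  have "(\<Sum>a\<in>A. eta (p a) + p a * log 2 (q a)) \<le> (\<Sum>a\<in>A. (q a - p a) / ln 2)"
  proof (rule sum_mono)
    fix a assume a: "a \<in> A"
    show "eta (p a) + p a * log 2 (q a) \<le> (q a - p a) / ln 2"
    proof (cases "p a = 0")
      case False
      with p[OF a] have pa: "p a > 0" by simp
      with pos[OF a] have qa: "q a > 0" by simp
      have "p a * log 2 (q a / p a) \<le> p a * ((q a / p a - 1) / ln 2)"
        using pa qa by (intro mult_left_mono log2_le) auto
      also have "\<dots> = (q a - p a) / ln 2" using pa by (simp add: field_simps)
      finally show ?thesis using pa qa by (simp add: eta_def log_divide algebra_simps)
    qed (use q[OF a] in simp)
  qed
  also have "\<dots> = (sum q A - sum p A) / ln 2"
    by (simp add: sum_subtractf sum_divide_distrib diff_divide_distrib)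
  also have "\<dots> \<le> 0" using le by (simp add: divide_nonpos_pos)
  finally show ?thesis by (simp add: sum.distrib)
qed

text \<open>Comparison with the uniform weights 1/card A. The additive \<open>1 / ln 2\<close> is
  independent of the size of \<open>A\<close>, hence harmless after division by the block
  length.\<close>

lemma sum_eta_le:
  fixes e :: "'a \<Rightarrow> real"
  assumes A: "finite A" "A \<noteq> {}" and e: "\<And>a. a \<in> A \<Longrightarrow> 0 \<le> e a" and c: "sum e A \<le> \<epsilon>"
  shows "(\<Sum>a\<in>A. eta (e a)) \<le> \<epsilon> * log 2 (card A) + 1 / ln 2"
proof -
  let ?N = "real (card A)"
  have N: "?N \<ge> 1" using A by (simp add: Suc_leI card_gt_0_iff)
  have pt: "eta (e a) \<le> e a * log 2 ?N + (1 / ?N) / ln 2" if a: "a \<in> A" for a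
  proof (cases "e a = 0")
    case False
    with e[OF a] have ea: "e a > 0" by simp
    have "e a * log 2 (1 / (?N * e a)) \<le> e a * ((1 / (?N * e a) - 1) / ln 2)"
      using ea N by (intro mult_left_mono log2_le) auto
    also have "\<dots> = (1 / ?N - e a) / ln 2" using ea N by (simp add: field_simps)
    also have "\<dots> \<le> (1 / ?N) / ln 2" using ea by (intro divide_right_mono) auto
    finally show ?thesis using ea N by (simp add: eta_def log_divide log_mult algebra_simps)
  qed (use N in simp)
  have "(\<Sum>a\<in>A. eta (e a)) \<le> (\<Sum>a\<in>A. e a * log 2 ?N + (1 / ?N) / ln 2)"
    by (rule sum_mono[OF pt])
  also have "\<dots> = sum e A * log 2 ?N + 1 / ln 2"
    using N by (simp add: sum.distrib sum_distrib_right)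
  also have "\<dots> \<le> \<epsilon> * log 2 ?N + 1 / ln 2"
    using c N by (intro add_right_mono mult_right_mono) auto
  finally show ?thesis .
qed

text \<open>With \<open>?c\<close> the pointwise minimum, \<open>q\<close> exceeds \<open>?c\<close>
  by a mass of at most \<epsilon>, handled by subadditivity, and so does \<open>p\<close>, handled
  by \<open>eta_add_ge\<close>. The loss is linear in the logarithm of \<open>card A\<close>, so on
  words of length n it is of order n \<epsilon>. In the converse \<open>p\<close> is the law of the
  code and \<open>q\<close> the target.\<close>

lemma sum_eta_continuity:
  fixes p q :: "'a \<Rightarrow> real"
  assumes A: "finite A" "A \<noteq> {}" and p: "\<And>a. a \<in> A \<Longrightarrow> 0 \<le> p a \<and> p a \<le> 1" and q: "\<And>a. a \<in> A \<Longrightarrow> 0 \<le> q a"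
    and d: "(\<Sum>a\<in>A. \<bar>p a - q a\<bar>) \<le> \<epsilon>"
  shows "(\<Sum>a\<in>A. eta (q a)) - \<epsilon> * log 2 (card A) - (1 + \<epsilon>) / ln 2 \<le> (\<Sum>a\<in>A. eta (p a))"
proof -
  let ?c = "\<lambda>a. min (p a) (q a)"
  let ?e = "\<lambda>a. q a - ?c a"
  have "(\<Sum>a\<in>A. eta (q a)) \<le> (\<Sum>a\<in>A. eta (?c a) + eta (?e a))"
  proof (rule sum_mono)
    fix a assume "a \<in> A"
    then show "eta (q a) \<le> eta (?c a) + eta (?e a)"
      using eta_add_le[of "?c a" "?e a"] p[of a] q[of a] by simp
  qed
  moreover have "(\<Sum>a\<in>A. eta (?e a)) \<le> \<epsilon> * log 2 (card A) + 1 / ln 2"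
    by (rule sum_eta_le[OF A]) (auto intro!: order.trans[OF sum_mono d])
  moreover have "(\<Sum>a\<in>A. eta (?c a) - (p a - ?c a) / ln 2) \<le> (\<Sum>a\<in>A. eta (p a))"
  proof (rule sum_mono)
    fix a assume "a \<in> A"
    then show "eta (?c a) - (p a - ?c a) / ln 2 \<le> eta (p a)"
      using eta_add_ge[of "?c a" "p a - ?c a"] p[of a] q[of a] by simp
  qed
  moreover have "(\<Sum>a\<in>A. p a - ?c a) \<le> \<epsilon>"
    by (rule order.trans[OF sum_mono d]) auto
  then have "(\<Sum>a\<in>A. (p a - ?c a) / ln 2) \<le> \<epsilon> / ln 2"
    by (simp add: divide_right_mono flip: sum_divide_distrib)
  ultimately show ?thesis
    by (simp add: sum.distrib sum_subtractf add_divide_distrib)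
qed

section \<open>Finite pmfs as weight functions, and product laws of words\<close>

lemma entropy2_eq:
  assumes "finite A" "set_pmf p \<subseteq> A"
  shows "entropy2 p = (\<Sum>a\<in>A. eta (pmf p a))"
proof -
  have "(\<Sum>a\<in>A. eta (pmf p a)) = (\<Sum>a\<in>set_pmf p. eta (pmf p a))"
    using assms by (intro sum.mono_neutral_right) (auto simp: set_pmf_iff)
  then show ?thesis by (simp add: entropy2_def eta_def sum_negf)
qed

lemma pmf_bind_sum:
  assumes "finite A" "set_pmf p \<subseteq> A"
  shows "pmf (bind_pmf p f) b = (\<Sum>a\<in>A. pmf p a * pmf (f a) b)"
  unfolding pmf_bind using assms by (subst integral_measure_pmf[of A]) auto

lemma pmf_map_sum:
  assumes "finite A" "set_pmf p \<subseteq> A"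
  shows "pmf (map_pmf f p) b = (\<Sum>a\<in>A. pmf p a * of_bool (f a = b))"
  by (simp add: map_pmf_def pmf_bind_sum[OF assms] indicator_def of_bool_def)

lemma sum_pmf_UNIV: "(\<Sum>a\<in>UNIV. pmf q a) = 1" for q :: "'a::finite pmf"
  by (rule sum_pmf_eq_1) auto

lemma ex_pmf_of_fun:
  fixes f :: "'a \<Rightarrow> real"
  assumes "finite A" "\<And>a. a \<in> A \<Longrightarrow> 0 \<le> f a" "sum f A = 1"
  shows "\<exists>p. set_pmf p \<subseteq> A \<and> (\<forall>a\<in>A. pmf p a = f a)"
proof -
  let ?g = "\<lambda>a. if a \<in> A then f a else 0"
  have *: "(\<integral>\<^sup>+ a. ennreal (?g a) \<partial>count_space UNIV) = 1"
  proof -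
    have "(\<integral>\<^sup>+ a. ennreal (?g a) \<partial>count_space UNIV) = (\<integral>\<^sup>+ a. ennreal (f a) \<partial>count_space A)"
      by (subst nn_integral_count_space_indicator) (auto intro!: nn_integral_cong simp: indicator_def)
    also have "\<dots> = 1"
      using assms by (simp add: nn_integral_count_space_finite sum_ennreal)
    finally show ?thesis .
  qed
  have "pmf (embed_pmf ?g) a = ?g a" for a
    using assms by (intro pmf_embed_pmf *) auto
  then show ?thesis
    by (intro exI[of _ "embed_pmf ?g"]) (auto simp: set_pmf_iff split: if_splits)
qed

lemma pmf_prod_list_pmf:
  "pmf (prod_list_pmf ps) xs = (if length xs = length ps then \<Prod>i<length ps. pmf (ps ! i) (xs ! i) else 0)"
proof (induction ps arbitrary: xs)
  case Nil
  then show ?case by (simp add: indicator_def)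
next
  case (Cons p ps)
  have *: "prod_list_pmf (p # ps) = map_pmf (\<lambda>(a,as). a # as) (pair_pmf p (prod_list_pmf ps))"
    by (simp add: pair_pmf_def map_bind_pmf map_pmf_def bind_assoc_pmf bind_return_pmf)
  have inj: "inj (\<lambda>(a,as). a # as)" by (auto simp: inj_on_def)
  show ?case
  proof (cases xs)
    case Nil
    have "pmf (prod_list_pmf (p # ps)) [] = 0"
      unfolding * pmf_eq_0_set_pmf by auto
    then show ?thesis using Nil by simp
  next
    case (Cons a as)
    have "pmf (prod_list_pmf (p # ps)) (a # as) = pmf p a * pmf (prod_list_pmf ps) as"
      unfolding * using pmf_map_inj'[OF inj, of _ "(a, as)"] by (simp add: pmf_pair)
    then show ?thesis
      using Cons Cons.IH[of as] by (simp add: prod.lessThan_Suc_shift del: prod.lessThan_Suc)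
  qed
qed

lemma iid_pmf_eq: "iid_pmf n p = prod_list_pmf (replicate n p)"
  by (induction n) auto

lemma pmf_iid_pmf: "pmf (iid_pmf n p) xs = (if length xs = n then \<Prod>i<n. pmf p (xs ! i) else 0)"
  by (simp add: iid_pmf_eq pmf_prod_list_pmf)

lemma set_prod_list_pmf: "set_pmf (prod_list_pmf ps) \<subseteq> {xs. length xs = length ps \<and> (\<forall>i<length ps. xs ! i \<in> set_pmf (ps ! i))}"
  by (auto simp: set_pmf_iff pmf_prod_list_pmf split: if_splits)

section \<open>Soft covering by random codebooks\<close>

text \<open>A random codebook is a function from indices to words, drawn with weight the product of
  the \<open>q (c k)\<close>. Expectations over codebooks are weighted sums over \<open>PiE\<close>,
  where sum and product can be exchanged.\<close>

lemma codebook_weight_sum: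
  fixes q :: "'a \<Rightarrow> real"
  assumes "finite I" "finite A" "sum q A = 1"
  shows "(\<Sum>c\<in>PiE I (\<lambda>_. A). \<Prod>k\<in>I. q (c k)) = 1"
  using prod_sum_PiE[of I "\<lambda>_. A" "\<lambda>_. q"] assms by simp

lemma codebook_expectation:
  fixes q f :: "'a \<Rightarrow> real"
  assumes I: "finite I" and A: "finite A" and q: "sum q A = 1" and i: "i \<in> I"
  shows "(\<Sum>c\<in>PiE I (\<lambda>_. A). (\<Prod>k\<in>I. q (c k)) * f (c i)) = (\<Sum>a\<in>A. q a * f a)"
proof -
  have "(\<Sum>c\<in>PiE I (\<lambda>_. A). (\<Prod>k\<in>I. q (c k)) * f (c i))
    = (\<Sum>c\<in>PiE I (\<lambda>_. A). \<Prod>k\<in>I. q (c k) * (if k = i then f (c k) else 1))"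
    using I i by (simp add: prod.distrib)
  also have "\<dots> = (\<Prod>k\<in>I. \<Sum>a\<in>A. q a * (if k = i then f a else 1))"
    using I A by (simp add: prod_sum_PiE)
  also have "\<dots> = (\<Prod>k\<in>I. if k = i then \<Sum>a\<in>A. q a * f a else 1)"
    using q by (intro prod.cong) auto
  finally show ?thesis using I i by simp
qed

text \<open>Independence of two different codewords. It enters twice: the covariances in the soft
  covering bound vanish, and a wrong codeword is independent of the received word.\<close>

lemma codebook_expectation2:
  fixes q f g :: "'a \<Rightarrow> real"
  assumes I: "finite I" and A: "finite A" and q: "sum q A = 1" and i: "i \<in> I" "j \<in> I" "i \<noteq> j"
  shows "(\<Sum>c\<in>PiE I (\<lambda>_. A). (\<Prod>k\<in>I. q (c k)) * (f (c i) * g (c j))) = (\<Sum>a\<in>A. q a * f a) * (\<Sum>a\<in>A. q a * g a)"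
proof -
  have "(\<Sum>c\<in>PiE I (\<lambda>_. A). (\<Prod>k\<in>I. q (c k)) * (f (c i) * g (c j)))
    = (\<Sum>c\<in>PiE I (\<lambda>_. A). \<Prod>k\<in>I. q (c k) * ((if k = i then f (c k) else 1) * (if k = j then g (c k) else 1)))"
    using I i by (simp add: prod.distrib)
  also have "\<dots> = (\<Prod>k\<in>I. \<Sum>a\<in>A. q a * ((if k = i then f a else 1) * (if k = j then g a else 1)))"
    using I A by (simp add: prod_sum_PiE)
  also have "\<dots> = (\<Prod>k\<in>I. (if k = i then \<Sum>a\<in>A. q a * f a else 1) * (if k = j then \<Sum>a\<in>A. q a * g a else 1))"
    using q i by (intro prod.cong) auto
  finally show ?thesis using I i by (simp add: prod.distrib)
qed

text \<open>Nonnegativity of the variance of \<open>\<bar>z\<bar>\<close> under the weights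
  \<open>w\<close>.\<close>

lemma weighted_abs_le_sqrt:
  fixes w z :: "'a \<Rightarrow> real"
  assumes w: "\<And>a. a \<in> A \<Longrightarrow> 0 \<le> w a" "sum w A = 1"
  shows "(\<Sum>a\<in>A. w a * \<bar>z a\<bar>) \<le> sqrt (\<Sum>a\<in>A. w a * (z a)\<^sup>2)"
proof -
  define m where "m = (\<Sum>a\<in>A. w a * \<bar>z a\<bar>)"
  have alg: "w a * (\<bar>z a\<bar> - m)\<^sup>2 = w a * (z a)\<^sup>2 - 2 * m * (w a * \<bar>z a\<bar>) + m\<^sup>2 * w a" for a
    by (simp add: power2_diff algebra_simps)
  have "0 \<le> (\<Sum>a\<in>A. w a * (\<bar>z a\<bar> - m)\<^sup>2)"
    by (intro sum_nonneg mult_nonneg_nonneg w) auto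
  also have "\<dots> = (\<Sum>a\<in>A. w a * (z a)\<^sup>2) - 2 * m * m + m\<^sup>2 * 1"
    unfolding alg sum.distrib sum_subtractf w(2)[symmetric] m_def[symmetric]
    by (simp only: m_def sum_distrib_left)
  finally have "m\<^sup>2 \<le> (\<Sum>a\<in>A. w a * (z a)\<^sup>2)"
    by (simp add: power2_eq_square)
  then show ?thesis
    unfolding m_def[symmetric] by (rule real_le_rsqrt)
qed

text \<open>One output symbol at a time: \<open>p\<close> bounds the mean of \<open>t\<close>, and
  the truncation \<open>t u \<le> \<tau> * p\<close> then bounds the second moment by \<tau> p^2.
  Averaging over independent codewords divides the variance by \<open>card I\<close>, and the mean
  absolute deviation is at most the root of the variance.\<close>

lemma soft_covering_truncated:
  fixes q :: "'u \<Rightarrow> real" and t :: "'u \<Rightarrow> real"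
  assumes I: "finite I" "I \<noteq> {}" and A: "finite A"
    and q: "sum q A = 1" "\<And>u. u \<in> A \<Longrightarrow> 0 \<le> q u"
    and t: "\<And>u. u \<in> A \<Longrightarrow> 0 \<le> t u" "\<And>u. u \<in> A \<Longrightarrow> t u \<le> \<tau> * p"
    and p: "(\<Sum>u\<in>A. q u * t u) \<le> p" and tau: "\<tau> \<ge> 0"
  shows "(\<Sum>c\<in>PiE I (\<lambda>_. A). (\<Prod>k\<in>I. q (c k)) * \<bar>(\<Sum>i\<in>I. t (c i)) / card I - (\<Sum>u\<in>A. q u * t u)\<bar>)
      \<le> sqrt (\<tau> / card I) * p"
proof -
  let ?C = "PiE I (\<lambda>_. A)" and ?w = "\<lambda>c. \<Prod>k\<in>I. q (c k)"
  define m where "m = (\<Sum>u\<in>A. q u * t u)"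
  define h where "h u = t u - m" for u
  define N where "N = real (card I)"
  have N: "N > 0" using I by (simp add: N_def card_gt_0_iff)
  have p0: "0 \<le> p"
    using order.trans[OF sum_nonneg p] q t by simp
  have w: "\<And>c. c \<in> ?C \<Longrightarrow> 0 \<le> ?w c" "sum ?w ?C = 1"
    using q by (auto intro!: prod_nonneg codebook_weight_sum I A)
  have h0: "(\<Sum>u\<in>A. q u * h u) = 0"
  proof -
    have "(\<Sum>u\<in>A. q u * h u) = m - sum q A * m"
      unfolding h_def right_diff_distrib sum_subtractf by (simp only: m_def sum_distrib_right)
    then show ?thesis using q by simp
  qed
  have avg: "(\<Sum>i\<in>I. t (c i)) / N - m = (\<Sum>i\<in>I. h (c i)) / N" for c
    using N by (simp add: h_def sum_subtractf N_def field_simps)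
  have "(\<Sum>c\<in>?C. ?w c * (\<Sum>i\<in>I. h (c i))\<^sup>2) = (\<Sum>c\<in>?C. \<Sum>i\<in>I. \<Sum>j\<in>I. ?w c * (h (c i) * h (c j)))"
    by (simp only: power2_eq_square sum_product) (simp only: sum_distrib_left)
  also have "\<dots> = (\<Sum>i\<in>I. \<Sum>j\<in>I. \<Sum>c\<in>?C. ?w c * (h (c i) * h (c j)))"
    by (simp only: sum.swap[of _ I ?C])
  also have "\<dots> = (\<Sum>i\<in>I. \<Sum>j\<in>I. if j = i then \<Sum>u\<in>A. q u * (h u)\<^sup>2 else 0)"
  proof (intro sum.cong refl)
    fix i j assume "i \<in> I" "j \<in> I"
    then show "(\<Sum>c\<in>?C. ?w c * (h (c i) * h (c j))) = (if j = i then \<Sum>u\<in>A. q u * (h u)\<^sup>2 else 0)"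
      using codebook_expectation[OF I(1) A q(1), of i "\<lambda>u. h u * h u"]
        codebook_expectation2[OF I(1) A q(1), of i j h h] h0
      by (auto simp: power2_eq_square)
  qed
  also have "\<dots> = N * (\<Sum>u\<in>A. q u * (h u)\<^sup>2)"
    using I by (simp add: N_def)
  finally have var: "(\<Sum>c\<in>?C. ?w c * (\<Sum>i\<in>I. h (c i))\<^sup>2) = N * (\<Sum>u\<in>A. q u * (h u)\<^sup>2)" .
  have alg: "q u * (h u)\<^sup>2 = q u * (t u)\<^sup>2 - 2 * m * (q u * t u) + m\<^sup>2 * q u" for u
    by (simp add: h_def power2_diff algebra_simps)
  have "(\<Sum>u\<in>A. q u * (h u)\<^sup>2) = (\<Sum>u\<in>A. q u * (t u)\<^sup>2) - 2 * m * m + m\<^sup>2 * 1"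
    unfolding alg sum.distrib sum_subtractf q(1)[symmetric] by (simp only: m_def sum_distrib_left)
  also have "\<dots> \<le> (\<Sum>u\<in>A. q u * (t u)\<^sup>2)" by (simp add: power2_eq_square)
  also have "\<dots> \<le> (\<Sum>u\<in>A. (\<tau> * p) * (q u * t u))"
  proof (rule sum_mono)
    fix u assume u: "u \<in> A"
    have "(q u * t u) * t u \<le> (q u * t u) * (\<tau> * p)"
      using q(2)[OF u] t[OF u] by (intro mult_left_mono mult_nonneg_nonneg)
    then show "q u * (t u)\<^sup>2 \<le> \<tau> * p * (q u * t u)"
      by (simp add: power2_eq_square ac_simps)
  qed
  also have "\<dots> = (\<tau> * p) * m" by (simp only: m_def sum_distrib_left)
  also have "\<dots> \<le> (\<tau> * p) * p"
    using p p0 tau unfolding m_def by (intro mult_left_mono) auto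
  finally have h2: "(\<Sum>u\<in>A. q u * (h u)\<^sup>2) \<le> \<tau> * p\<^sup>2"
    by (simp add: power2_eq_square ac_simps)
  have "(\<Sum>c\<in>?C. ?w c * \<bar>(\<Sum>i\<in>I. h (c i)) / N\<bar>) \<le> sqrt (\<Sum>c\<in>?C. ?w c * ((\<Sum>i\<in>I. h (c i)) / N)\<^sup>2)"
    by (rule weighted_abs_le_sqrt[OF w])
  also have "(\<Sum>c\<in>?C. ?w c * ((\<Sum>i\<in>I. h (c i)) / N)\<^sup>2) = (\<Sum>c\<in>?C. ?w c * (\<Sum>i\<in>I. h (c i))\<^sup>2) / N\<^sup>2"
    by (simp only: power_divide times_divide_eq_right sum_divide_distrib[symmetric])
  also have "\<dots> = (\<Sum>u\<in>A. q u * (h u)\<^sup>2) / N"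
    unfolding var using N by (simp add: power2_eq_square)
  also have "sqrt \<dots> \<le> sqrt (\<tau> * p\<^sup>2 / N)"
    using h2 N by (intro real_sqrt_le_mono divide_right_mono) auto
  also have "\<dots> = sqrt (\<tau> / N) * p"
    using p0 by (simp add: real_sqrt_mult real_sqrt_divide)
  finally show ?thesis
    unfolding m_def[symmetric] N_def[symmetric] avg .
qed

text \<open>\<open>t u\<close> is the output law of a channel for input \<open>u\<close>, and
  \<open>p\<close> the output law for a random input. Summed over the outputs, the truncated parts
  give \<open>sqrt (\<tau> / card I)\<close>, as \<open>p\<close> has mass 1. The tail is counted
  twice, once in the codebook average and once in the mean; both have the same expectation.\<close>

lemma soft_covering:
  fixes q :: "'u \<Rightarrow> real" and t :: "'u \<Rightarrow> 'w \<Rightarrow> real"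
  assumes I: "finite I" "I \<noteq> {}" and A: "finite A"
    and q: "sum q A = 1" "\<And>u. u \<in> A \<Longrightarrow> 0 \<le> q u"
    and t: "\<And>u w. 0 \<le> t u w" and tau: "\<tau> \<ge> 0"
  defines "p \<equiv> \<lambda>w. \<Sum>u\<in>A. q u * t u w"
  assumes p1: "sum p W = 1"
  shows "(\<Sum>c\<in>PiE I (\<lambda>_. A). (\<Prod>k\<in>I. q (c k)) * (\<Sum>w\<in>W. \<bar>(\<Sum>i\<in>I. t (c i) w) / card I - p w\<bar>))
      \<le> sqrt (\<tau> / card I) + 2 * (\<Sum>u\<in>A. q u * (\<Sum>w\<in>W. t u w * of_bool (\<tau> * p w < t u w)))"
proof -
  let ?C = "PiE I (\<lambda>_. A)" and ?w = "\<lambda>c. \<Prod>k\<in>I. q (c k)"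
  define N where "N = real (card I)"
  have N: "N > 0" using I by (simp add: N_def card_gt_0_iff)
  \<comment> \<open>Only the truncated part t1 has a small variance; the rest is bounded by its mean.\<close>
  define t1 where "t1 u w = t u w * of_bool (t u w \<le> \<tau> * p w)" for u w
  define t2 where "t2 u w = t u w * of_bool (\<tau> * p w < t u w)" for u w
  define p1 where "p1 w = (\<Sum>u\<in>A. q u * t1 u w)" for w
  define p2 where "p2 w = (\<Sum>u\<in>A. q u * t2 u w)" for w
  have t12: "t u w = t1 u w + t2 u w" for u w
    by (auto simp: t1_def t2_def)
  have p12: "p w = p1 w + p2 w" for w
    by (simp add: p_def p1_def p2_def t12 distrib_left sum.distrib)
  have nn: "0 \<le> t1 u w" "0 \<le> t2 u w" for u w
    using t by (auto simp: t1_def t2_def)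
  have pn: "0 \<le> p1 w" "0 \<le> p2 w" for w
    using q nn by (auto simp: p1_def p2_def intro!: sum_nonneg)
  have w: "\<And>c. c \<in> ?C \<Longrightarrow> 0 \<le> ?w c"
    using q by (auto intro!: prod_nonneg)
  have w1: "sum ?w ?C = 1" by (rule codebook_weight_sum[OF I(1) A q(1)])
  have pt: "(\<Sum>c\<in>?C. ?w c * \<bar>(\<Sum>i\<in>I. t (c i) x) / N - p x\<bar>) \<le> sqrt (\<tau> / N) * p x + 2 * p2 x" for x
  proof -
    have "(\<Sum>c\<in>?C. ?w c * \<bar>(\<Sum>i\<in>I. t (c i) x) / N - p x\<bar>)
      \<le> (\<Sum>c\<in>?C. ?w c * \<bar>(\<Sum>i\<in>I. t1 (c i) x) / N - p1 x\<bar> + (?w c * ((\<Sum>i\<in>I. t2 (c i) x) / N) + ?w c * p2 x))"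
    proof (rule sum_mono)
      fix c assume c: "c \<in> ?C"
      have "0 \<le> (\<Sum>i\<in>I. t2 (c i) x) / N"
        using N nn by (simp add: sum_nonneg)
      moreover have "(\<Sum>i\<in>I. t (c i) x) / N = (\<Sum>i\<in>I. t1 (c i) x) / N + (\<Sum>i\<in>I. t2 (c i) x) / N"
        by (simp add: t12 sum.distrib add_divide_distrib)
      ultimately have "\<bar>(\<Sum>i\<in>I. t (c i) x) / N - p x\<bar>
         \<le> \<bar>(\<Sum>i\<in>I. t1 (c i) x) / N - p1 x\<bar> + ((\<Sum>i\<in>I. t2 (c i) x) / N + p2 x)"
        using pn[of x] p12[of x] by linarith
      from mult_left_mono[OF this w[OF c]]
      show "?w c * \<bar>(\<Sum>i\<in>I. t (c i) x) / N - p x\<bar>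
         \<le> ?w c * \<bar>(\<Sum>i\<in>I. t1 (c i) x) / N - p1 x\<bar> + (?w c * ((\<Sum>i\<in>I. t2 (c i) x) / N) + ?w c * p2 x)"
        by (simp only: distrib_left)
    qed
    also have "\<dots> = (\<Sum>c\<in>?C. ?w c * \<bar>(\<Sum>i\<in>I. t1 (c i) x) / N - p1 x\<bar>)
        + ((\<Sum>c\<in>?C. ?w c * ((\<Sum>i\<in>I. t2 (c i) x) / N)) + (\<Sum>c\<in>?C. ?w c * p2 x))"
      by (simp only: sum.distrib)
    finally have le: "(\<Sum>c\<in>?C. ?w c * \<bar>(\<Sum>i\<in>I. t (c i) x) / N - p x\<bar>)
      \<le> (\<Sum>c\<in>?C. ?w c * \<bar>(\<Sum>i\<in>I. t1 (c i) x) / N - p1 x\<bar>)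
        + ((\<Sum>c\<in>?C. ?w c * ((\<Sum>i\<in>I. t2 (c i) x) / N)) + (\<Sum>c\<in>?C. ?w c * p2 x))" .
    have "(\<Sum>c\<in>?C. ?w c * p2 x) = p2 x"
      unfolding sum_distrib_right[symmetric] w1 by simp
    moreover have "(\<Sum>c\<in>?C. ?w c * ((\<Sum>i\<in>I. t2 (c i) x) / N)) = p2 x"
    proof -
      have "(\<Sum>c\<in>?C. ?w c * ((\<Sum>i\<in>I. t2 (c i) x) / N)) = (\<Sum>i\<in>I. \<Sum>c\<in>?C. ?w c * t2 (c i) x) / N"
        by (simp only: times_divide_eq_right sum_divide_distrib[symmetric] sum_distrib_left) (subst sum.swap, rule refl)
      also have "(\<Sum>i\<in>I. \<Sum>c\<in>?C. ?w c * t2 (c i) x) = (\<Sum>i\<in>I. p2 x)"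
        unfolding p2_def by (intro sum.cong refl codebook_expectation[OF I(1) A q(1)])
      finally show ?thesis using N by (simp add: N_def)
    qed
    moreover have "(\<Sum>c\<in>?C. ?w c * \<bar>(\<Sum>i\<in>I. t1 (c i) x) / N - p1 x\<bar>) \<le> sqrt (\<tau> / N) * p x"
      unfolding p1_def N_def
    proof (rule soft_covering_truncated[OF I A q _ _ _ tau])
      show "(\<Sum>u\<in>A. q u * t1 u x) \<le> p x" using p12[of x] pn[of x] by (simp add: p1_def)
      show "t1 u x \<le> \<tau> * p x" for u
        using tau pn[of x] p12[of x] by (auto simp: t1_def)
    qed (auto simp: nn)
    ultimately show ?thesis using le by simp
  qed
  have "(\<Sum>c\<in>?C. ?w c * (\<Sum>x\<in>W. \<bar>(\<Sum>i\<in>I. t (c i) x) / card I - p x\<bar>))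
    = (\<Sum>x\<in>W. \<Sum>c\<in>?C. ?w c * \<bar>(\<Sum>i\<in>I. t (c i) x) / N - p x\<bar>)"
    by (simp only: sum_distrib_left sum.swap[of _ W ?C] N_def)
  also have "\<dots> \<le> (\<Sum>x\<in>W. sqrt (\<tau> / N) * p x + 2 * p2 x)"
    by (intro sum_mono pt)
  also have "\<dots> = sqrt (\<tau> / N) * sum p W + 2 * sum p2 W"
    by (simp only: sum.distrib sum_distrib_left)
  also have "sum p2 W = (\<Sum>u\<in>A. q u * (\<Sum>w\<in>W. t2 u w))"
    unfolding p2_def by (simp only: sum_distrib_left sum.swap[of _ W A])
  finally show ?thesis unfolding p1 N_def t2_def by simp
qed

section \<open>One-shot coding\<close>

text \<open>The probabilistic method: it turns a bound on the average over random codebooks into one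
  good codebook.\<close>

lemma ex_le_weighted_average:
  fixes w f :: "'a \<Rightarrow> real"
  assumes "\<And>c. c \<in> C \<Longrightarrow> 0 \<le> w c" "sum w C = 1" "finite C" "(\<Sum>c\<in>C. w c * f c) \<le> M"
  shows "\<exists>c\<in>C. f c \<le> M"
proof (rule ccontr)
  assume "\<not> ?thesis"
  then have gt: "M < f c" if "c \<in> C" for c using that by force
  have "\<exists>c\<in>C. w c > 0"
    using assms(1,2) by (metis less_eq_real_def sum.neutral zero_neq_one)
  then obtain c0 where c0: "c0 \<in> C" "w c0 > 0" by blast
  have "(\<Sum>c\<in>C. w c * M) < (\<Sum>c\<in>C. w c * f c)"
  proof (rule sum_strict_mono_ex1)
    show "\<forall>c\<in>C. w c * M \<le> w c * f c" by (intro ballI mult_left_mono less_imp_le gt assms(1))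
    show "\<exists>c\<in>C. w c * M < w c * f c" using c0 gt[OF c0(1)] by (intro bexI[of _ c0] mult_strict_left_mono)
  qed (rule assms)
  then show False
    using assms by (simp flip: sum_distrib_right)
qed

text \<open>Any candidate that passes the test may be returned, because every wrong candidate is
  charged in the error bound. The default 0 is a legal index as soon as
  \<open>L > 0\<close>.\<close>

definition threshold_decoder :: "('u \<Rightarrow> 'y \<Rightarrow> bool) \<Rightarrow> nat \<Rightarrow> (nat \<times> nat \<Rightarrow> 'u) \<Rightarrow> nat \<Rightarrow> 'y \<Rightarrow> nat" where
  "threshold_decoder good L c m y =
     (if \<exists>l<L. good (c (m, l)) y then SOME l. l < L \<and> good (c (m, l)) y else 0)"

lemma threshold_decoder_good:
  assumes "l < L" "good (c (m, l)) y"
  shows "threshold_decoder good L c m y < L \<and> good (c (m, threshold_decoder good L c m y)) y"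
  unfolding threshold_decoder_def using someI[of "\<lambda>l. l < L \<and> good (c (m, l)) y" l] assms by auto

lemma threshold_decoder_less: "L > 0 \<Longrightarrow> threshold_decoder good L c m y < L"
  using threshold_decoder_good[of _ L good c m y]
  by (cases "\<exists>l<L. good (c (m, l)) y") (auto simp: threshold_decoder_def[of good L c m y] split: if_splits)

text \<open>There are two causes of error: the true codeword fails the test, which is the first
  term, or one of the \<open>L - 1\<close> others passes it. For a codeword independent of
  \<open>y\<close> the likelihood has mean \<open>p y\<close>, so by Markov's inequality it reaches
  \<open>\<gamma> * p y\<close> with probability at most 1/\<gamma>; the union bound gives the
  second term.\<close>

lemma threshold_decoding_error:
  fixes q :: "'u \<Rightarrow> real" and v :: "'u \<Rightarrow> 'y \<Rightarrow> real"
  assumes A: "finite A" and q: "sum q A = 1" "\<And>u. u \<in> A \<Longrightarrow> 0 \<le> q u"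
    and v: "\<And>u y. 0 \<le> v u y" and lam: "\<gamma> > 0" and KL: "K > 0" "L > 0"
  defines "p \<equiv> \<lambda>y. \<Sum>u\<in>A. q u * v u y"
  defines "good \<equiv> \<lambda>u y. \<gamma> * p y \<le> v u y"
  defines "I \<equiv> {1..K} \<times> {..<L}"
  assumes p1: "sum p Y = 1"
  shows "(\<Sum>c\<in>PiE I (\<lambda>_. A). (\<Prod>k\<in>I. q (c k)) *
           ((\<Sum>(m,l)\<in>I. \<Sum>y\<in>Y. v (c (m,l)) y * of_bool (threshold_decoder good L c m y \<noteq> l)) / card I))
      \<le> (\<Sum>u\<in>A. q u * (\<Sum>y\<in>Y. v u y * of_bool (v u y < \<gamma> * p y))) + (real L - 1) / \<gamma>"
proof -
  let ?C = "PiE I (\<lambda>_. A)" and ?w = "\<lambda>c. \<Prod>k\<in>I. q (c k)"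
  let ?bad = "\<Sum>u\<in>A. q u * (\<Sum>y\<in>Y. v u y * of_bool (v u y < \<gamma> * p y))"
  let ?e = "\<lambda>c m l y. v (c (m,l)) y * of_bool (threshold_decoder good L c m y \<noteq> l)"
  have I: "finite I" "card I > 0" using KL by (auto simp: I_def card_gt_0_iff)
  have w: "\<And>c. c \<in> ?C \<Longrightarrow> 0 \<le> ?w c"
    using q by (auto intro!: prod_nonneg)
  have p0: "0 \<le> p y" for y unfolding p_def using q v by (auto intro!: sum_nonneg)
  \<comment> \<open>Markov's inequality, kept multiplied by \<open>p y\<close> so that outputs of
    probability 0 need no case distinction.\<close>
  have wrong: "p y * (\<Sum>u\<in>A. q u * of_bool (good u y)) \<le> p y / \<gamma>" for y
  proof -
    have "\<gamma> * (p y * (\<Sum>u\<in>A. q u * of_bool (good u y))) = (\<Sum>u\<in>A. q u * (\<gamma> * p y * of_bool (good u y)))"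
      unfolding sum_distrib_left by (intro sum.cong refl) simp
    also have "\<dots> \<le> (\<Sum>u\<in>A. q u * v u y)"
      using q v by (intro sum_mono mult_left_mono) (auto simp: good_def)
    also have "\<dots> = p y" by (simp add: p_def)
    finally show ?thesis using lam by (simp add: field_simps)
  qed
  have each: "(\<Sum>c\<in>?C. ?w c * (\<Sum>y\<in>Y. ?e c m l y)) \<le> ?bad + (real L - 1) / \<gamma>" if ml: "(m,l) \<in> I" for m l
  proof -
    have l: "l < L" and inI: "\<And>l'. l' \<in> {..<L} - {l} \<Longrightarrow> (m,l') \<in> I" using ml by (auto simp: I_def)
    have pt: "?e c m l y \<le> v (c (m,l)) y * of_bool (v (c (m,l)) y < \<gamma> * p y)
        + (\<Sum>l'\<in>{..<L} - {l}. v (c (m,l)) y * of_bool (good (c (m,l')) y))" for c y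
    proof (cases "threshold_decoder good L c m y \<noteq> l \<and> good (c (m,l)) y")
      case True
      let ?l = "threshold_decoder good L c m y"
      from True threshold_decoder_good[OF l, of good c m y] have g: "?l \<in> {..<L} - {l}" "good (c (m, ?l)) y" by auto
      have "v (c (m,l)) y = v (c (m,l)) y * of_bool (good (c (m,?l)) y)" using g by simp
      also have "\<dots> \<le> (\<Sum>l'\<in>{..<L} - {l}. v (c (m,l)) y * of_bool (good (c (m,l')) y))"
        using g(1) v by (intro member_le_sum) auto
      finally show ?thesis using v[of "c (m,l)" y] by (simp add: add_increasing)
    next
      case False
      have "0 \<le> (\<Sum>l'\<in>{..<L} - {l}. v (c (m,l)) y * of_bool (good (c (m,l')) y))"
        using v by (auto intro!: sum_nonneg)
      moreover have "?e c m l y \<le> v (c (m,l)) y * of_bool (v (c (m,l)) y < \<gamma> * p y)"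
        using False v[of "c (m,l)" y] by (auto simp: good_def)
      ultimately show ?thesis by linarith
    qed
    have "(\<Sum>c\<in>?C. ?w c * (\<Sum>y\<in>Y. ?e c m l y)) = (\<Sum>y\<in>Y. \<Sum>c\<in>?C. ?w c * ?e c m l y)"
      unfolding sum_distrib_left by (rule sum.swap)
    also have "\<dots> \<le> (\<Sum>y\<in>Y. (\<Sum>u\<in>A. q u * (v u y * of_bool (v u y < \<gamma> * p y))) + (real L - 1) * (p y / \<gamma>))"
    proof (rule sum_mono)
      fix y
      have "(\<Sum>c\<in>?C. ?w c * ?e c m l y) \<le> (\<Sum>c\<in>?C. ?w c * (v (c (m,l)) y * of_bool (v (c (m,l)) y < \<gamma> * p y)
        + (\<Sum>l'\<in>{..<L} - {l}. v (c (m,l)) y * of_bool (good (c (m,l')) y))))"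
        by (intro sum_mono mult_left_mono pt w)
      also have "\<dots> = (\<Sum>c\<in>?C. ?w c * (v (c (m,l)) y * of_bool (v (c (m,l)) y < \<gamma> * p y)))
        + (\<Sum>c\<in>?C. \<Sum>l'\<in>{..<L} - {l}. ?w c * (v (c (m,l)) y * of_bool (good (c (m,l')) y)))"
        by (simp only: distrib_left sum.distrib sum_distrib_left)
      also have "(\<Sum>c\<in>?C. \<Sum>l'\<in>{..<L} - {l}. ?w c * (v (c (m,l)) y * of_bool (good (c (m,l')) y)))
        = (\<Sum>l'\<in>{..<L} - {l}. \<Sum>c\<in>?C. ?w c * (v (c (m,l)) y * of_bool (good (c (m,l')) y)))"
        by (rule sum.swap)
      also have "\<dots> = (\<Sum>l'\<in>{..<L} - {l}. p y * (\<Sum>u\<in>A. q u * of_bool (good u y)))"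
        unfolding p_def using inI ml
        by (intro sum.cong refl codebook_expectation2[OF I(1) A q(1), of "(m,l)" _ "\<lambda>u. v u y" "\<lambda>u. of_bool (good u y)"]) auto
      also have "\<dots> = (real L - 1) * (p y * (\<Sum>u\<in>A. q u * of_bool (good u y)))"
        using l by (simp add: of_nat_diff)
      also have "(\<Sum>c\<in>?C. ?w c * (v (c (m,l)) y * of_bool (v (c (m,l)) y < \<gamma> * p y)))
         = (\<Sum>u\<in>A. q u * (v u y * of_bool (v u y < \<gamma> * p y)))"
        by (rule codebook_expectation[OF I(1) A q(1) ml, of "\<lambda>u. v u y * of_bool (v u y < \<gamma> * p y)"])
      finally show "(\<Sum>c\<in>?C. ?w c * ?e c m l y)
         \<le> (\<Sum>u\<in>A. q u * (v u y * of_bool (v u y < \<gamma> * p y))) + (real L - 1) * (p y / \<gamma>)"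
        using mult_left_mono[OF wrong[of y], of "real L - 1"] l by linarith
    qed
    also have "\<dots> = (\<Sum>y\<in>Y. \<Sum>u\<in>A. q u * (v u y * of_bool (v u y < \<gamma> * p y))) + (real L - 1) * (sum p Y / \<gamma>)"
      by (simp only: sum.distrib sum_distrib_left sum_divide_distrib)
    also have "(\<Sum>y\<in>Y. \<Sum>u\<in>A. q u * (v u y * of_bool (v u y < \<gamma> * p y))) = ?bad"
      unfolding sum_distrib_left by (rule sum.swap)
    finally show ?thesis using p1 by simp
  qed
  have "(\<Sum>c\<in>?C. ?w c * ((\<Sum>(m,l)\<in>I. \<Sum>y\<in>Y. ?e c m l y) / card I))
    = (\<Sum>i\<in>I. \<Sum>c\<in>?C. ?w c * (\<Sum>y\<in>Y. ?e c (fst i) (snd i) y)) / card I"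
    by (simp only: times_divide_eq_right sum_divide_distrib[symmetric] sum_distrib_left case_prod_unfold)
      (subst sum.swap, rule refl)
  also have "\<dots> \<le> (\<Sum>i\<in>I. ?bad + (real L - 1) / \<gamma>) / card I"
    by (intro divide_right_mono sum_mono each) auto
  also have "\<dots> = ?bad + (real L - 1) / \<gamma>"
    using I(2) by simp
  finally show ?thesis .
qed

lemma sum_abs_pmf_diff_le:
  assumes "finite Z" shows "(\<Sum>z\<in>Z. \<bar>pmf p z - pmf q z\<bar>) \<le> 2 * of_bool (p \<noteq> q)"
proof (cases "p = q")
  case False
  have "(\<Sum>z\<in>Z. \<bar>pmf p z - pmf q z\<bar>) \<le> (\<Sum>z\<in>Z. pmf p z + pmf q z)"
    using pmf_nonneg[of p] pmf_nonneg[of q] by (intro sum_mono) (auto simp: abs_le_iff intro: add_increasing)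
  also have "\<dots> \<le> 1 + 1"
    unfolding sum.distrib using assms by (intro add_mono) (simp_all add: measure_measure_pmf_finite[symmetric])
  finally show ?thesis using False by simp
qed simp

text \<open>
  S compares the law induced by the codebook c with the target p; E is the probability that the
  index l is decoded wrongly.
\<close>
lemma code_from_codebook:
  fixes V :: "'u \<Rightarrow> 'x pmf" and W :: "'x \<Rightarrow> 'y pmf" and B :: "'u \<Rightarrow> 'y \<Rightarrow> 'z pmf"
  assumes fin: "finite X" "finite Y" "finite Z"
    and V: "\<And>u. u \<in> A \<Longrightarrow> set_pmf (V u) \<subseteq> X" and W: "\<And>x. x \<in> X \<Longrightarrow> set_pmf (W x) \<subseteq> Y"
    and B: "\<And>u y. u \<in> A \<Longrightarrow> y \<in> Y \<Longrightarrow> set_pmf (B u y) \<subseteq> Z"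
    and KL: "(K::nat) > 0" "(L::nat) > 0"
  defines "I \<equiv> {1..K} \<times> {..<L}"
  assumes c: "\<And>i. i \<in> I \<Longrightarrow> c i \<in> A" and g: "\<And>m y. m \<in> {1..K} \<Longrightarrow> g m y < L"
    and pX: "\<And>x. x \<in> X \<Longrightarrow> pX x = (\<Sum>y\<in>Y. \<Sum>z\<in>Z. p x y z)"
  defines "S \<equiv> \<Sum>x\<in>X. \<Sum>y\<in>Y. \<Sum>z\<in>Z.
      \<bar>(\<Sum>i\<in>I. pmf (V (c i)) x * pmf (W x) y * pmf (B (c i) y) z) / card I - p x y z\<bar>"
  defines "E \<equiv> (\<Sum>(m,l)\<in>I. \<Sum>y\<in>Y. (\<Sum>x\<in>X. pmf (V (c (m,l))) x * pmf (W x) y) * of_bool (g m y \<noteq> l)) / card I"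
  shows "\<exists>enc dec. (\<forall>x. set_pmf (enc x) \<subseteq> {1..K}) \<and> (\<forall>m\<in>{1..K}. \<forall>y\<in>Y. set_pmf (dec m y) \<subseteq> Z) \<and>
     (\<Sum>x\<in>X. \<Sum>y\<in>Y. \<Sum>z\<in>Z. \<bar>pX x * pmf (W x) y * (\<Sum>m\<in>{1..K}. pmf (enc x) m * pmf (dec m y) z) - p x y z\<bar>)
     \<le> 2 * S + 2 * E"
proof -
  define N where "N = real (card I)"
  have I: "finite I" "card I > 0" using KL by (auto simp: I_def card_gt_0_iff)
  then have N: "N > 0" by (simp add: N_def)
  have sumI: "(\<Sum>m\<in>{1..K}. \<Sum>l<L. F m l) = (\<Sum>(m,l)\<in>I. F m l)" for F :: "nat \<Rightarrow> nat \<Rightarrow> real"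
    by (simp add: I_def sum.cartesian_product)
  define cx where "cx x = (\<Sum>i\<in>I. pmf (V (c i)) x) / N" for x
  \<comment> \<open>The encoder is the posterior of m given x when (m,l) is uniform. If
    \<open>x\<close> has probability 0 under the codebook, both sides vanish and message 1 serves as
    a default.\<close>
  have ex_enc: "\<exists>e. set_pmf e \<subseteq> {1..K} \<and> (\<forall>m\<in>{1..K}. cx x * pmf e m = (\<Sum>l<L. pmf (V (c (m,l))) x) / N)" for x
  proof (cases "cx x = 0")
    case True
    then have "(\<Sum>i\<in>I. pmf (V (c i)) x) = 0" using N by (simp add: cx_def)
    then have "pmf (V (c (m,l))) x = 0" if "(m,l) \<in> I" for m l
      using that I(1) by (subst (asm) sum_nonneg_eq_0_iff) auto
    then have "\<forall>m\<in>{1..K}. cx x * pmf (return_pmf 1) m = (\<Sum>l<L. pmf (V (c (m,l))) x) / N"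
      using True by (auto simp: I_def)
    then show ?thesis using KL by (intro exI[of _ "return_pmf 1"]) auto
  next
    case False
    have c0: "0 \<le> cx x" using N by (auto simp: cx_def intro!: divide_nonneg_pos sum_nonneg)
    with False have c1: "cx x > 0" by simp
    have "\<exists>e. set_pmf e \<subseteq> {1..K} \<and> (\<forall>m\<in>{1..K}. pmf e m = (\<Sum>l<L. pmf (V (c (m,l))) x) / N / cx x)"
    proof (rule ex_pmf_of_fun)
      show "(\<Sum>m\<in>{1..K}. (\<Sum>l<L. pmf (V (c (m,l))) x) / N / cx x) = 1"
        using c1 N unfolding sum_divide_distrib[symmetric] sumI by (simp add: cx_def case_prod_unfold zero_less_divide_iff)
    qed (use N c0 in \<open>auto intro!: divide_nonneg_pos sum_nonneg simp: c1\<close>)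
    then show ?thesis using c1 by fastforce
  qed
  then obtain enc where enc: "\<And>x. set_pmf (enc x) \<subseteq> {1..K}"
    and encV: "\<And>x m. m \<in> {1..K} \<Longrightarrow> cx x * pmf (enc x) m = (\<Sum>l<L. pmf (V (c (m,l))) x) / N"
    by metis
  \<comment> \<open>Bob applies the channel \<open>B\<close> to the decoded codeword as if its index
    were right.\<close>
  define dec where "dec m y = B (c (m, g m y)) y" for m y
  define b where "b x y z = (\<Sum>m\<in>{1..K}. pmf (enc x) m * pmf (dec m y) z)" for x y z
  define tc where "tc x y z = (\<Sum>i\<in>I. pmf (V (c i)) x * pmf (W x) y * pmf (B (c i) y) z) / N" for x y z
  have W1: "(\<Sum>y\<in>Y. pmf (W x) y) = 1" if "x \<in> X" for x
    using W[OF that] fin by (intro sum_pmf_eq_1)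
  have B1: "(\<Sum>z\<in>Z. pmf (B (c i) y) z) = 1" if "i \<in> I" "y \<in> Y" for i y
    using B[OF c[OF that(1)] that(2)] fin by (intro sum_pmf_eq_1)
  have enc1: "(\<Sum>m\<in>{1..K}. pmf (enc x) m) = 1" for x
    using enc[of x] by (intro sum_pmf_eq_1) auto
  have b0: "0 \<le> b x y z" for x y z unfolding b_def by (intro sum_nonneg) auto
  have b1: "(\<Sum>z\<in>Z. b x y z) = 1" if "y \<in> Y" for x y
  proof -
    have "(\<Sum>z\<in>Z. b x y z) = (\<Sum>m\<in>{1..K}. pmf (enc x) m * (\<Sum>z\<in>Z. pmf (dec m y) z))"
      unfolding b_def sum_distrib_left by (rule sum.swap)
    also have "\<dots> = (\<Sum>m\<in>{1..K}. pmf (enc x) m * 1)"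
      using that g unfolding dec_def by (intro sum.cong refl arg_cong2[where f = "(*)"] B1) (auto simp: I_def)
    finally show ?thesis using enc1 by simp
  qed
  \<comment> \<open>Alice sees \<open>pX\<close>, not the law \<open>cx\<close> of X under the
    codebook. What follows X is a channel, so the exchange costs the distance of the two marginals,
    which is at most the distance \<open>S\<close> of the joint laws.\<close>
  have one: "(\<Sum>x\<in>X. \<Sum>y\<in>Y. \<Sum>z\<in>Z. \<bar>pX x - cx x\<bar> * pmf (W x) y * b x y z) \<le> S"
    unfolding S_def N_def[symmetric]
  proof (rule sum_mono)
    fix x assume x: "x \<in> X"
    have "(\<Sum>y\<in>Y. \<Sum>z\<in>Z. \<bar>pX x - cx x\<bar> * pmf (W x) y * b x y z) = (\<Sum>y\<in>Y. \<bar>pX x - cx x\<bar> * pmf (W x) y)"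
      by (intro sum.cong refl) (simp add: b1 flip: sum_distrib_left)
    also have "\<dots> = \<bar>pX x - cx x\<bar>"
      unfolding sum_distrib_left[symmetric] W1[OF x] by simp
    finally have eq: "(\<Sum>y\<in>Y. \<Sum>z\<in>Z. \<bar>pX x - cx x\<bar> * pmf (W x) y * b x y z) = \<bar>pX x - cx x\<bar>" .
    have cx: "cx x = (\<Sum>y\<in>Y. \<Sum>z\<in>Z. tc x y z)"
    proof -
      have "(\<Sum>y\<in>Y. \<Sum>z\<in>Z. tc x y z) = (\<Sum>y\<in>Y. (\<Sum>i\<in>I. \<Sum>z\<in>Z. pmf (V (c i)) x * pmf (W x) y * pmf (B (c i) y) z) / N)"
        unfolding tc_def sum_divide_distrib[symmetric] by (subst sum.swap, rule refl)
      also have "\<dots> = (\<Sum>y\<in>Y. (\<Sum>i\<in>I. pmf (V (c i)) x * pmf (W x) y) / N)"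
        unfolding sum_distrib_left[symmetric] using B1 by (intro sum.cong refl arg_cong2[where f = "(/)"]) simp
      also have "\<dots> = cx x"
        unfolding sum_divide_distrib[symmetric] cx_def
        by (subst sum.swap) (simp only: sum_distrib_left[symmetric] W1[OF x] mult_1_right)
      finally show ?thesis by simp
    qed
    have "\<bar>pX x - cx x\<bar> = \<bar>\<Sum>y\<in>Y. \<Sum>z\<in>Z. tc x y z - p x y z\<bar>"
      unfolding cx pX[OF x] by (simp add: sum_subtractf abs_minus_commute)
    also have "\<dots> \<le> (\<Sum>y\<in>Y. \<Sum>z\<in>Z. \<bar>tc x y z - p x y z\<bar>)"
      by (intro order.trans[OF sum_abs] sum_mono sum_abs)
    finally show "(\<Sum>y\<in>Y. \<Sum>z\<in>Z. \<bar>pX x - cx x\<bar> * pmf (W x) y * b x y z)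
       \<le> (\<Sum>y\<in>Y. \<Sum>z\<in>Z. \<bar>(\<Sum>i\<in>I. pmf (V (c i)) x * pmf (W x) y * pmf (B (c i) y) z) / N - p x y z\<bar>)"
      unfolding eq by (simp add: tc_def)
  qed
  \<comment> \<open>By the choice of the encoder, running the code on X with law \<open>cx\<close>
    amounts to drawing (m,l) uniformly. The only remaining difference from the codebook law is that
    Bob uses the decoded index.\<close>
  have cxb: "cx x * pmf (W x) y * b x y z = (\<Sum>(m,l)\<in>I. pmf (V (c (m,l))) x * pmf (W x) y * pmf (dec m y) z) / N" for x y z
  proof -
    have "cx x * pmf (W x) y * b x y z = (\<Sum>m\<in>{1..K}. (cx x * pmf (enc x) m) * (pmf (W x) y * pmf (dec m y) z))"
      unfolding b_def sum_distrib_left by (intro sum.cong refl) simp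
    also have "\<dots> = (\<Sum>m\<in>{1..K}. \<Sum>l<L. pmf (V (c (m,l))) x * pmf (W x) y * pmf (dec m y) z / N)"
      by (intro sum.cong refl) (simp add: encV sum_divide_distrib sum_distrib_right mult.assoc)
    finally show ?thesis
      unfolding sumI by (simp add: sum_divide_distrib case_prod_unfold)
  qed
  \<comment> \<open>The laws differ only at indices that are decoded wrongly, and there by at most 2
    in the unhalved distance.\<close>
  have two: "(\<Sum>x\<in>X. \<Sum>y\<in>Y. \<Sum>z\<in>Z. \<bar>cx x * pmf (W x) y * b x y z - tc x y z\<bar>) \<le> 2 * E"
  proof -
    let ?D = "\<lambda>i y z. \<bar>pmf (dec (fst i) y) z - pmf (B (c i) y) z\<bar>"
    have "(\<Sum>x\<in>X. \<Sum>y\<in>Y. \<Sum>z\<in>Z. \<bar>cx x * pmf (W x) y * b x y z - tc x y z\<bar>)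
       \<le> (\<Sum>x\<in>X. \<Sum>y\<in>Y. \<Sum>z\<in>Z. \<Sum>i\<in>I. pmf (V (c i)) x * pmf (W x) y * ?D i y z / N)"
    proof (intro sum_mono)
      fix x y z
      have "cx x * pmf (W x) y * b x y z - tc x y z
        = (\<Sum>i\<in>I. pmf (V (c i)) x * pmf (W x) y * (pmf (dec (fst i) y) z - pmf (B (c i) y) z) / N)"
        unfolding cxb tc_def case_prod_unfold
        by (simp only: diff_divide_distrib[symmetric] sum_subtractf[symmetric] sum_divide_distrib[symmetric]
            right_diff_distrib prod.collapse)
      also have "\<bar>\<dots>\<bar> \<le> (\<Sum>i\<in>I. \<bar>pmf (V (c i)) x * pmf (W x) y * (pmf (dec (fst i) y) z - pmf (B (c i) y) z) / N\<bar>)"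
        by (rule sum_abs)
      also have "\<dots> = (\<Sum>i\<in>I. pmf (V (c i)) x * pmf (W x) y * ?D i y z / N)"
        using N by (simp add: abs_mult)
      finally show "\<bar>cx x * pmf (W x) y * b x y z - tc x y z\<bar>
         \<le> (\<Sum>i\<in>I. pmf (V (c i)) x * pmf (W x) y * ?D i y z / N)" .
    qed
    also have "\<dots> = (\<Sum>i\<in>I. \<Sum>y\<in>Y. \<Sum>x\<in>X. \<Sum>z\<in>Z. pmf (V (c i)) x * pmf (W x) y * ?D i y z / N)"
      by (subst sum.swap[of _ Y X], subst sum.swap[of _ I Z], subst sum.swap[of _ I X], subst sum.swap[of _ I Y]) (rule refl)
    also have "\<dots> = (\<Sum>i\<in>I. \<Sum>y\<in>Y. (\<Sum>x\<in>X. pmf (V (c i)) x * pmf (W x) y) * (\<Sum>z\<in>Z. ?D i y z)) / N"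
      by (simp only: sum_divide_distrib[symmetric] sum_product)
    also have "\<dots> \<le> (\<Sum>i\<in>I. \<Sum>y\<in>Y. (\<Sum>x\<in>X. pmf (V (c i)) x * pmf (W x) y) * (2 * of_bool (g (fst i) y \<noteq> snd i))) / N"
    proof (intro divide_right_mono sum_mono mult_left_mono)
      fix i y
      show "(\<Sum>z\<in>Z. ?D i y z) \<le> 2 * of_bool (g (fst i) y \<noteq> snd i)"
        by (rule order.trans[OF sum_abs_pmf_diff_le[OF fin(3)]]) (auto simp: dec_def)
    qed (use N in \<open>auto intro!: sum_nonneg\<close>)
    also have "\<dots> = 2 * E"
      unfolding E_def N_def[symmetric] case_prod_unfold
      by (simp add: sum_distrib_left ac_simps)
    finally show ?thesis .
  qed
  \<comment> \<open>Triangle inequality over the two replacements and the covering error: S + 2E +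
    S.\<close>
  have "(\<Sum>x\<in>X. \<Sum>y\<in>Y. \<Sum>z\<in>Z. \<bar>pX x * pmf (W x) y * b x y z - p x y z\<bar>)
    \<le> (\<Sum>x\<in>X. \<Sum>y\<in>Y. \<Sum>z\<in>Z. \<bar>pX x - cx x\<bar> * pmf (W x) y * b x y z
        + \<bar>cx x * pmf (W x) y * b x y z - tc x y z\<bar> + \<bar>tc x y z - p x y z\<bar>)"
  proof (intro sum_mono)
    fix x y z
    have "\<bar>(pX x - cx x) * (pmf (W x) y * b x y z)\<bar> = \<bar>pX x - cx x\<bar> * pmf (W x) y * b x y z"
      using b0[of x y z] by (simp add: abs_mult)
    moreover have "(pX x - cx x) * (pmf (W x) y * b x y z) = pX x * pmf (W x) y * b x y z - cx x * pmf (W x) y * b x y z"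
      by (simp add: algebra_simps)
    ultimately show "\<bar>pX x * pmf (W x) y * b x y z - p x y z\<bar> \<le> \<bar>pX x - cx x\<bar> * pmf (W x) y * b x y z
        + \<bar>cx x * pmf (W x) y * b x y z - tc x y z\<bar> + \<bar>tc x y z - p x y z\<bar>"
      by linarith
  qed
  also have "\<dots> = (\<Sum>x\<in>X. \<Sum>y\<in>Y. \<Sum>z\<in>Z. \<bar>pX x - cx x\<bar> * pmf (W x) y * b x y z)
     + (\<Sum>x\<in>X. \<Sum>y\<in>Y. \<Sum>z\<in>Z. \<bar>cx x * pmf (W x) y * b x y z - tc x y z\<bar>) + S"
    by (simp only: sum.distrib S_def tc_def N_def)
  also have "\<dots> \<le> 2 * S + 2 * E"
    using one two by simp
  finally have "(\<Sum>x\<in>X. \<Sum>y\<in>Y. \<Sum>z\<in>Z. \<bar>pX x * pmf (W x) y * b x y z - p x y z\<bar>) \<le> 2 * S + 2 * E" .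
  moreover have "\<forall>m\<in>{1..K}. \<forall>y\<in>Y. set_pmf (dec m y) \<subseteq> Z"
    unfolding dec_def using g by (intro ballI B c) (auto simp: I_def)
  ultimately show ?thesis
    using enc unfolding b_def by blast
qed

text \<open>Covering and decoding are averaged over the same random codebook, and the codebook is
  selected for the sum of the two errors. The error terms come from \<open>soft_covering\<close>
  with outputs (x,y,z) and from \<open>threshold_decoding_error\<close> with output y.\<close>

lemma one_shot_code:
  fixes Q :: "'u pmf" and V :: "'u \<Rightarrow> 'x pmf" and W :: "'x \<Rightarrow> 'y pmf" and B :: "'u \<Rightarrow> 'y \<Rightarrow> 'z pmf"
  assumes fin: "finite A" "finite X" "finite Y" "finite Z"
    and Q: "set_pmf Q \<subseteq> A"
    and V: "\<And>u. u \<in> A \<Longrightarrow> set_pmf (V u) \<subseteq> X" and W: "\<And>x. x \<in> X \<Longrightarrow> set_pmf (W x) \<subseteq> Y"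
    and B: "\<And>u y. u \<in> A \<Longrightarrow> y \<in> Y \<Longrightarrow> set_pmf (B u y) \<subseteq> Z"
    and KL: "K > 0" "L > 0" and tau: "\<tau> \<ge> 0" and lam: "\<gamma> > 0"
  defines "T \<equiv> \<lambda>u x y z. pmf (V u) x * pmf (W x) y * pmf (B u y) z"
  defines "p \<equiv> \<lambda>x y z. \<Sum>u\<in>A. pmf Q u * T u x y z"
  defines "v \<equiv> \<lambda>u y. \<Sum>x\<in>X. pmf (V u) x * pmf (W x) y"
  defines "pY \<equiv> \<lambda>y. \<Sum>u\<in>A. pmf Q u * v u y"
  shows "\<exists>enc dec. (\<forall>x. set_pmf (enc x) \<subseteq> {1..K}) \<and> (\<forall>m\<in>{1..K}. \<forall>y\<in>Y. set_pmf (dec m y) \<subseteq> Z) \<and>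
     (\<Sum>x\<in>X. \<Sum>y\<in>Y. \<Sum>z\<in>Z. \<bar>(\<Sum>u\<in>A. pmf Q u * pmf (V u) x) * pmf (W x) y *
         (\<Sum>m\<in>{1..K}. pmf (enc x) m * pmf (dec m y) z) - p x y z\<bar>)
     \<le> 2 * (sqrt (\<tau> / (real K * real L))
          + 2 * (\<Sum>u\<in>A. pmf Q u * (\<Sum>x\<in>X. \<Sum>y\<in>Y. \<Sum>z\<in>Z. T u x y z * of_bool (\<tau> * p x y z < T u x y z))))
     + 2 * ((\<Sum>u\<in>A. pmf Q u * (\<Sum>y\<in>Y. v u y * of_bool (v u y < \<gamma> * pY y))) + (real L - 1) / \<gamma>)"
proof -
  define I where "I = {1..K} \<times> {..<L}"
  have I: "finite I" "I \<noteq> {}" using KL by (auto simp: I_def)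
  have cardI: "real (card I) = real K * real L" by (simp add: I_def)
  let ?C = "PiE I (\<lambda>_. A)" and ?w = "\<lambda>c. \<Prod>k\<in>I. pmf Q (c k)"
  let ?W = "X \<times> Y \<times> Z"
  have Q1: "sum (pmf Q) A = 1" using Q fin by (intro sum_pmf_eq_1)
  have sum3: "(\<Sum>w\<in>?W. F (fst w) (fst (snd w)) (snd (snd w))) = (\<Sum>x\<in>X. \<Sum>y\<in>Y. \<Sum>z\<in>Z. F x y z)" for F :: "'x \<Rightarrow> 'y \<Rightarrow> 'z \<Rightarrow> real"
    by (simp add: sum.cartesian_product case_prod_unfold)
  have p_fold: "(\<Sum>u\<in>A. pmf Q u * T u x y z) = p x y z" for x y z by (simp add: p_def)
  have pY_fold: "(\<Sum>u\<in>A. pmf Q u * v u y) = pY y" for y by (simp add: pY_def)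
  have Tnn: "0 \<le> T u x y z" for u x y z by (simp add: T_def)
  have vnn: "0 \<le> v u y" for u y by (simp add: v_def sum_nonneg)
  have Bsum: "(\<Sum>z\<in>Z. T u x y z) = pmf (V u) x * pmf (W x) y" if "u \<in> A" "y \<in> Y" for u x y
    using sum_pmf_eq_1[OF fin(4) B[OF that]] by (simp add: T_def flip: sum_distrib_left)
  have pX: "(\<Sum>u\<in>A. pmf Q u * pmf (V u) x) = (\<Sum>y\<in>Y. \<Sum>z\<in>Z. p x y z)" if x: "x \<in> X" for x
  proof -
    have "(\<Sum>y\<in>Y. \<Sum>z\<in>Z. p x y z) = (\<Sum>u\<in>A. \<Sum>y\<in>Y. \<Sum>z\<in>Z. pmf Q u * T u x y z)"
      unfolding p_def by (subst sum.swap[of _ A Z], subst sum.swap[of _ A Y]) (rule refl)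
    also have "\<dots> = (\<Sum>u\<in>A. pmf Q u * (\<Sum>y\<in>Y. pmf (V u) x * pmf (W x) y))"
      by (simp add: Bsum flip: sum_distrib_left)
    also have "\<dots> = (\<Sum>u\<in>A. pmf Q u * pmf (V u) x)"
      using sum_pmf_eq_1[OF fin(3) W[OF x]] by (simp flip: sum_distrib_left)
    finally show ?thesis by simp
  qed
  have p1: "(\<Sum>x\<in>X. \<Sum>y\<in>Y. \<Sum>z\<in>Z. p x y z) = 1"
  proof -
    have "(\<Sum>x\<in>X. \<Sum>y\<in>Y. \<Sum>z\<in>Z. p x y z) = (\<Sum>u\<in>A. pmf Q u * (\<Sum>x\<in>X. pmf (V u) x))"
      unfolding sum_distrib_left by (subst sum.swap) (simp add: pX)
    also have "\<dots> = 1"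
      using sum_pmf_eq_1[OF fin(2) V] Q1 by simp
    finally show ?thesis .
  qed
  have pY: "pY y = (\<Sum>x\<in>X. \<Sum>z\<in>Z. p x y z)" if y: "y \<in> Y" for y
  proof -
    have "(\<Sum>x\<in>X. \<Sum>z\<in>Z. p x y z) = (\<Sum>u\<in>A. \<Sum>x\<in>X. \<Sum>z\<in>Z. pmf Q u * T u x y z)"
      unfolding p_def by (subst sum.swap[of _ A Z], subst sum.swap[of _ A X]) (rule refl)
    also have "\<dots> = pY y"
      unfolding pY_def v_def using y by (simp add: Bsum flip: sum_distrib_left)
    finally show ?thesis by simp
  qed
  have pY1: "sum pY Y = 1"
    unfolding p1[symmetric] by (subst sum.swap) (simp add: pY)
  define S where "S c = (\<Sum>x\<in>X. \<Sum>y\<in>Y. \<Sum>z\<in>Z. \<bar>(\<Sum>i\<in>I. T (c i) x y z) / card I - p x y z\<bar>)" for c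
  define good where "good u y \<longleftrightarrow> \<gamma> * pY y \<le> v u y" for u y
  define E where "E c = (\<Sum>(m,l)\<in>I. \<Sum>y\<in>Y. v (c (m,l)) y * of_bool (threshold_decoder good L c m y \<noteq> l)) / card I" for c
  let ?S = "sqrt (\<tau> / (real K * real L))
          + 2 * (\<Sum>u\<in>A. pmf Q u * (\<Sum>x\<in>X. \<Sum>y\<in>Y. \<Sum>z\<in>Z. T u x y z * of_bool (\<tau> * p x y z < T u x y z)))"
  let ?E = "(\<Sum>u\<in>A. pmf Q u * (\<Sum>y\<in>Y. v u y * of_bool (v u y < \<gamma> * pY y))) + (real L - 1) / \<gamma>"
  have "(\<Sum>c\<in>?C. ?w c * S c) \<le> ?S"
  proof -
    have "(\<Sum>w\<in>?W. \<Sum>u\<in>A. pmf Q u * T u (fst w) (fst (snd w)) (snd (snd w))) = 1"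
      unfolding p_fold using p1 sum3[of p] by simp
    from soft_covering[where t = "\<lambda>u w. T u (fst w) (fst (snd w)) (snd (snd w))", OF I fin(1) Q1 pmf_nonneg Tnn tau this]
    show ?thesis unfolding S_def cardI sum3[symmetric] p_fold .
  qed
  moreover have "(\<Sum>c\<in>?C. ?w c * E c) \<le> ?E"
  proof -
    have "(\<Sum>y\<in>Y. \<Sum>u\<in>A. pmf Q u * v u y) = 1"
      unfolding pY_fold by (rule pY1)
    from threshold_decoding_error[OF fin(1) Q1 pmf_nonneg vnn lam KL this]
    show ?thesis unfolding pY_fold I_def[symmetric] E_def good_def[abs_def] .
  qed
  ultimately have "(\<Sum>c\<in>?C. ?w c * (S c + E c)) \<le> ?S + ?E"
    by (simp only: distrib_left sum.distrib)
  moreover have "\<And>c. c \<in> ?C \<Longrightarrow> 0 \<le> ?w c"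
    by (intro prod_nonneg) auto
  moreover have "sum ?w ?C = 1" by (rule codebook_weight_sum[OF I(1) fin(1) Q1])
  moreover have "finite ?C" using I fin by (intro finite_PiE) auto
  ultimately obtain c where c: "c \<in> ?C" "S c + E c \<le> ?S + ?E"
    using ex_le_weighted_average[of ?C ?w "\<lambda>c. S c + E c"] by blast
  have "\<exists>enc dec. (\<forall>x. set_pmf (enc x) \<subseteq> {1..K}) \<and> (\<forall>m\<in>{1..K}. \<forall>y\<in>Y. set_pmf (dec m y) \<subseteq> Z) \<and>
     (\<Sum>x\<in>X. \<Sum>y\<in>Y. \<Sum>z\<in>Z. \<bar>(\<Sum>u\<in>A. pmf Q u * pmf (V u) x) * pmf (W x) y *
         (\<Sum>m\<in>{1..K}. pmf (enc x) m * pmf (dec m y) z) - p x y z\<bar>) \<le> 2 * S c + 2 * E c"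
    unfolding S_def E_def v_def T_def I_def
  proof (rule code_from_codebook[OF fin(2-4) V W B KL])
    show "\<And>i. i \<in> {1..K} \<times> {..<L} \<Longrightarrow> c i \<in> A" using c(1) by (auto simp: I_def PiE_iff)
    show "\<And>x. x \<in> X \<Longrightarrow> (\<Sum>u\<in>A. pmf Q u * pmf (V u) x) = (\<Sum>y\<in>Y. \<Sum>z\<in>Z. p x y z)" by (rule pX)
    show "\<And>m y. m \<in> {1..K} \<Longrightarrow> threshold_decoder good L c m y < L"
      using KL by (intro threshold_decoder_less)
  qed auto
  then obtain enc dec where "\<forall>x. set_pmf (enc x) \<subseteq> {1..K}" "\<forall>m\<in>{1..K}. \<forall>y\<in>Y. set_pmf (dec m y) \<subseteq> Z"
     and le: "(\<Sum>x\<in>X. \<Sum>y\<in>Y. \<Sum>z\<in>Z. \<bar>(\<Sum>u\<in>A. pmf Q u * pmf (V u) x) * pmf (W x) y *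
         (\<Sum>m\<in>{1..K}. pmf (enc x) m * pmf (dec m y) z) - p x y z\<bar>) \<le> 2 * S c + 2 * E c"
    by auto
  moreover have "2 * a + 2 * b \<le> 2 * d + 2 * e" if "a + b \<le> d + e" for a b d e :: real using that by simp
  note this[OF c(2)]
  ultimately show ?thesis by (intro exI[of _ enc] exI[of _ dec] conjI) (auto intro: order.trans)
qed

section \<open>Block distributions and typicality\<close>

lemma pmf_bind_pair:
  "pmf (bind_pmf p (\<lambda>(x, y). bind_pmf (k x y) (\<lambda>z. return_pmf (x, y, z)))) (x, y, z) = pmf p (x, y) * pmf (k x y) z"
proof -
  have *: "pmf (case s of (x, y) \<Rightarrow> bind_pmf (k x y) (\<lambda>z. return_pmf (x, y, z))) (x, y, z)
     = (if s = (x, y) then pmf (k x y) z else 0)" for s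
  proof (cases "s = (x, y)")
    case True
    have "pmf (map_pmf (\<lambda>z. (x, y, z)) (k x y)) (x, y, z) = pmf (k x y) z"
      by (rule pmf_map_inj') (auto simp: inj_on_def)
    then show ?thesis using True by (simp add: map_pmf_def)
  next
    case False
    then show ?thesis by (cases s) (auto simp: pmf_eq_0_set_pmf)
  qed
  have "pmf (bind_pmf p (\<lambda>(x, y). bind_pmf (k x y) (\<lambda>z. return_pmf (x, y, z)))) (x, y, z)
    = measure_pmf.expectation p (\<lambda>s. if s = (x, y) then pmf (k x y) z else 0)"
    unfolding pmf_bind * ..
  also have "\<dots> = pmf p (x, y) * pmf (k x y) z"
    by (subst integral_measure_pmf[of "{(x, y)}"]) (auto split: if_splits)
  finally show ?thesis .
qed

lemma pmf_source_n:
  "pmf (source_n p n) (xs, ys) = (if length xs = n \<and> length ys = n then \<Prod>i<n. pmf p (xs ! i, ys ! i) else 0)"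
proof (cases "length xs = n \<and> length ys = n")
  case True
  let ?f = "\<lambda>ps. (map fst ps, map snd ps)"
  have "inj ?f"
    by (rule injI) (metis Pair_inject zip_map_fst_snd)
  then have "pmf (map_pmf ?f (iid_pmf n p)) (?f (zip xs ys)) = pmf (iid_pmf n p) (zip xs ys)"
    by (rule pmf_map_inj')
  then show ?thesis using True by (simp add: pmf_iid_pmf source_n_def)
next
  case False
  have "length ps = n" if "ps \<in> set_pmf (iid_pmf n p)" for ps
    using that set_prod_list_pmf[of "replicate n p"] by (auto simp: iid_pmf_eq)
  then have "(xs, ys) \<notin> set_pmf (source_n p n)"
    using False by (auto simp: source_n_def)
  then show ?thesis unfolding if_not_P[OF False] by (simp add: set_pmf_iff)
qed

lemma pmf_target_n:
  "pmf (target_n p pZ n) (xs, ys, zs) =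
     (if length xs = n \<and> length ys = n \<and> length zs = n then \<Prod>i<n. pmf p (xs ! i, ys ! i) * pmf (pZ (xs ! i) (ys ! i)) (zs ! i) else 0)"
  unfolding target_n_def pmf_bind_pair by (simp add: pmf_source_n pmf_prod_list_pmf prod.distrib)

lemma pmf_code_n:
  "pmf (code_n p enc dec n) (xs, ys, zs) = pmf (source_n p n) (xs, ys) * pmf (bind_pmf (enc xs) (\<lambda>m. dec m ys)) zs"
  using pmf_bind_pair[of "source_n p n" "\<lambda>xs ys. bind_pmf (enc xs) (\<lambda>m. dec m ys)" xs ys zs]
  by (simp add: code_n_def bind_assoc_pmf)

lemma tv_dist_eq:
  assumes "finite S" "set_pmf p \<subseteq> S" "set_pmf q \<subseteq> S"
  shows "tv_dist p q = 1/2 * (\<Sum>u\<in>S. \<bar>pmf p u - pmf q u\<bar>)"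
proof -
  have "(\<Sum>\<^sub>\<infinity>u. \<bar>pmf p u - pmf q u\<bar>) = (\<Sum>\<^sub>\<infinity>u\<in>S. \<bar>pmf p u - pmf q u\<bar>)"
  proof (rule infsum_cong_neutral)
    fix x assume "x \<in> UNIV - S"
    then have "x \<notin> set_pmf p" "x \<notin> set_pmf q" using assms by auto
    then show "\<bar>pmf p x - pmf q x\<bar> = 0" by (simp add: set_pmf_iff)
  qed auto
  then show ?thesis using assms by (simp add: tv_dist_def)
qed

lemma in_nlists_UNIV: "xs \<in> nlists n UNIV \<longleftrightarrow> length xs = n"
  by (simp add: nlists_def)

lemma sum_nlists_zip4:
  "(\<Sum>us\<in>nlists n A. \<Sum>xs\<in>nlists n B. \<Sum>ys\<in>nlists n C. \<Sum>zs\<in>nlists n D. F us xs ys zs)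
   = (\<Sum>ts\<in>nlists n (A \<times> B \<times> C \<times> D). F (map fst ts) (map (\<lambda>t. fst (snd t)) ts)
        (map (\<lambda>t. fst (snd (snd t))) ts) (map (\<lambda>t. snd (snd (snd t))) ts))"
proof -
  have 1: "(\<Sum>ys\<in>nlists n C. \<Sum>zs\<in>nlists n D. F us xs ys zs)
      = (\<Sum>ws\<in>nlists n (C \<times> D). F us xs (map fst ws) (map snd ws))" for us xs
    by (rule sum_nlists_zip[where F = "F us xs", symmetric])
  have 2: "(\<Sum>xs\<in>nlists n B. \<Sum>ws\<in>nlists n (C \<times> D). F us xs (map fst ws) (map snd ws))
      = (\<Sum>ws\<in>nlists n (B \<times> C \<times> D). F us (map fst ws) (map fst (map snd ws)) (map snd (map snd ws)))" for us
    by (rule sum_nlists_zip[where F = "\<lambda>xs ws. F us xs (map fst ws) (map snd ws)", symmetric])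
  show ?thesis
    unfolding 1 2
    using sum_nlists_zip[where F = "\<lambda>us ws. F us (map fst ws) (map fst (map snd ws)) (map snd (map snd ws))", of n A "B \<times> C \<times> D", symmetric]
    by (simp add: comp_def)
qed

text \<open>The product inequality says that the sum of the log likelihood ratios exceeds its mean
  by more than n \<delta>, so the weak law applies. Words with a letter of probability 0, where the
  logarithms carry no meaning, have weight 0. Covering uses the ratio T/p, decoding the inverted
  ratio pY/v.\<close>

lemma atypical_probability:
  fixes j a b :: "'a \<Rightarrow> real"
  assumes A: "finite A" and j: "sum j A = 1" "\<And>t. t \<in> A \<Longrightarrow> 0 \<le> j t"
    and pos: "\<And>t. t \<in> A \<Longrightarrow> 0 < j t \<Longrightarrow> 0 < a t" "\<And>t. t \<in> A \<Longrightarrow> 0 < j t \<Longrightarrow> 0 < b t"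
    and mu: "\<mu> = (\<Sum>t\<in>A. j t * log 2 (a t / b t))" and d: "\<delta> > 0" and n: "n > 0"
  shows "(\<Sum>ts\<in>nlists n A. (\<Prod>i<n. j (ts ! i)) *
       of_bool (2 powr (n * (\<mu> + \<delta>)) * (\<Prod>i<n. b (ts ! i)) < (\<Prod>i<n. a (ts ! i))))
    \<le> (\<Sum>t\<in>A. j t * (log 2 (a t / b t) - \<mu>)\<^sup>2) / (n * \<delta>\<^sup>2)"
proof -
  let ?f = "\<lambda>t. log 2 (a t / b t)"
  have "(\<Sum>ts\<in>nlists n A. (\<Prod>i<n. j (ts ! i)) *
       of_bool (2 powr (n * (\<mu> + \<delta>)) * (\<Prod>i<n. b (ts ! i)) < (\<Prod>i<n. a (ts ! i))))
     \<le> (\<Sum>ts\<in>nlists n A. (\<Prod>i<n. j (ts ! i)) * of_bool (n * \<delta> \<le> \<bar>(\<Sum>i<n. ?f (ts ! i)) - n * \<mu>\<bar>))"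
  proof (rule sum_mono)
    fix ts assume ts: "ts \<in> nlists n A"
    have ji: "0 \<le> j (ts ! i)" if "i < n" for i using ts j(2) that by (auto simp: nlists_iff_nth)
    show "(\<Prod>i<n. j (ts ! i)) * of_bool (2 powr (n * (\<mu> + \<delta>)) * (\<Prod>i<n. b (ts ! i)) < (\<Prod>i<n. a (ts ! i)))
       \<le> (\<Prod>i<n. j (ts ! i)) * of_bool (n * \<delta> \<le> \<bar>(\<Sum>i<n. ?f (ts ! i)) - n * \<mu>\<bar>)"
    proof (cases "\<exists>i<n. j (ts ! i) = 0")
      case True
      then have "(\<Prod>i<n. j (ts ! i)) = 0" by (intro prod_zero) auto
      then show ?thesis by (simp only: mult_zero_left order_refl)
    next
      case False
      then have jp: "0 < j (ts ! i)" if "i < n" for i using ji[OF that] that by (metis less_eq_real_def)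
      have ap: "0 < a (ts ! i)" "0 < b (ts ! i)" if "i < n" for i
        using pos[OF _ jp[OF that]] ts that unfolding nlists_iff_nth by blast+
      have "n * \<delta> \<le> \<bar>(\<Sum>i<n. ?f (ts ! i)) - n * \<mu>\<bar>"
        if gt: "2 powr (n * (\<mu> + \<delta>)) * (\<Prod>i<n. b (ts ! i)) < (\<Prod>i<n. a (ts ! i))"
      proof -
        have "2 powr (n * (\<mu> + \<delta>)) < (\<Prod>i<n. a (ts ! i)) / (\<Prod>i<n. b (ts ! i))"
          using gt ap by (subst pos_less_divide_eq) (auto intro!: prod_pos)
        also have "\<dots> = (\<Prod>i<n. a (ts ! i) / b (ts ! i))"
          by (simp add: prod_dividef)
        also have "\<dots> = (\<Prod>i<n. 2 powr ?f (ts ! i))"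
          using ap by (intro prod.cong refl) simp
        also have "\<dots> = 2 powr (\<Sum>i<n. ?f (ts ! i))"
          by (simp add: powr_sum)
        finally have "n * (\<mu> + \<delta>) < (\<Sum>i<n. ?f (ts ! i))" by simp
        then show ?thesis by (simp add: distrib_left)
      qed
      then have "of_bool (2 powr (n * (\<mu> + \<delta>)) * (\<Prod>i<n. b (ts ! i)) < (\<Prod>i<n. a (ts ! i)))
          \<le> (of_bool (n * \<delta> \<le> \<bar>(\<Sum>i<n. ?f (ts ! i)) - n * \<mu>\<bar>) :: real)"
        unfolding of_bool_less_eq_iff by (rule impI)
      then show ?thesis
        by (rule mult_left_mono) (use ji in \<open>auto intro!: prod_nonneg\<close>)
    qed
  qed
  also have "\<dots> \<le> (\<Sum>t\<in>A. j t * (?f t - \<mu>)\<^sup>2) / (n * \<delta>\<^sup>2)"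
    by (rule weak_law_nlists[OF A j mu d n])
  finally show ?thesis .
qed

text \<open>Rounding down to an integer costs at most a factor 2, since
  \<open>2 powr (n * R)\<close> is at least 1.\<close>

lemma code_rate_bounds:
  assumes R: "R \<ge> 0"
  shows "2 powr (n * R) / 2 \<le> real (num_msgs n R)" "num_msgs n R > 0" "real (num_msgs n R) \<le> 2 powr (n * R)"
proof -
  have ge: "1 \<le> 2 powr (n * R)" using R by (intro ge_one_powr_ge_zero) auto
  have f: "real (num_msgs n R) = of_int \<lfloor>2 powr (n * R)\<rfloor>"
    unfolding num_msgs_def by (rule of_nat_nat) (simp only: zero_le_floor powr_ge_zero)
  have fl: "1 \<le> \<lfloor>2 powr (n * R)\<rfloor>" using ge by (simp only: le_floor_iff of_int_1)
  have "2 powr (n * R) < of_int \<lfloor>2 powr (n * R)\<rfloor> + 1" by (rule real_of_int_floor_add_one_gt)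
  then show "2 powr (n * R) / 2 \<le> real (num_msgs n R)"
    unfolding f using fl by linarith
  show "real (num_msgs n R) \<le> 2 powr (n * R)" unfolding f by (rule of_int_floor_le)
  show "num_msgs n R > 0" using fl unfolding num_msgs_def by (simp only: zero_less_nat_eq)
qed

section \<open>Achievability\<close>

lemma source_n_length: "(xs, ys) \<in> set_pmf (source_n p n) \<Longrightarrow> length xs = n \<and> length ys = n"
  unfolding set_pmf_iff pmf_source_n by (simp split: if_splits)

text \<open>\<open>Q\<close> is the law of U, \<open>V\<close> the channel from U to X,
  \<open>W\<close> the channel from X to Y, and \<open>B\<close> the channel from (U,Y) to Z. In
  this form the code construction makes use of the two Markov conditions.\<close>

locale factored_channel =
  fixes pXY :: "('x::finite \<times> 'y::finite) pmf" and pZ :: "'x \<Rightarrow> 'y \<Rightarrow> 'z::finite pmf"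
    and Q :: "'u pmf" and V :: "'u \<Rightarrow> 'x pmf" and W :: "'x \<Rightarrow> 'y pmf" and B :: "'u \<Rightarrow> 'y \<Rightarrow> 'z pmf"
  assumes finQ: "finite (set_pmf Q)"
    and factor: "\<And>x y z. pmf pXY (x, y) * pmf (pZ x y) z =
      (\<Sum>u\<in>set_pmf Q. pmf Q u * (pmf (V u) x * pmf (W x) y * pmf (B u y) z))"
begin

definition "A = set_pmf Q"

definition "T u x y z = pmf (V u) x * pmf (W x) y * pmf (B u y) z"
definition "p x y z = (\<Sum>u\<in>A. pmf Q u * T u x y z)"
definition "v u y = (\<Sum>x\<in>UNIV. pmf (V u) x * pmf (W x) y)"
definition "pY y = (\<Sum>u\<in>A. pmf Q u * v u y)"

definition "info_UXYZ = (\<Sum>t\<in>A \<times> UNIV \<times> UNIV \<times> UNIV. case t of (u, x, y, z) \<Rightarrow>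
   pmf Q u * T u x y z * log 2 (T u x y z / p x y z))"
definition "info_UY = (\<Sum>t\<in>A \<times> UNIV. case t of (u, y) \<Rightarrow> pmf Q u * v u y * log 2 (v u y / pY y))"

text \<open>Probabilities under the n-letter laws of (U,X,Y,Z) and (U,Y): in
  \<open>bad_covering\<close> the likelihood ratio lies above the truncation level of soft covering,
  in \<open>bad_decoding\<close> the true word fails the threshold test.\<close>

definition "bad_covering n \<tau> = (\<Sum>us\<in>nlists n A. \<Sum>xs\<in>nlists n UNIV. \<Sum>ys\<in>nlists n UNIV. \<Sum>zs\<in>nlists n UNIV.
      (\<Prod>i<n. pmf Q (us ! i) * T (us ! i) (xs ! i) (ys ! i) (zs ! i)) *
      of_bool (\<tau> * (\<Prod>i<n. p (xs ! i) (ys ! i) (zs ! i)) < (\<Prod>i<n. T (us ! i) (xs ! i) (ys ! i) (zs ! i))))"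
definition "bad_decoding n \<gamma> = (\<Sum>us\<in>nlists n A. \<Sum>ys\<in>nlists n UNIV.
      (\<Prod>i<n. pmf Q (us ! i) * v (us ! i) (ys ! i)) *
      of_bool ((\<Prod>i<n. v (us ! i) (ys ! i)) < \<gamma> * (\<Prod>i<n. pY (ys ! i))))"

lemma p_eq: "p x y z = pmf pXY (x, y) * pmf (pZ x y) z"
  by (simp add: p_def T_def A_def factor)

lemma T_nonneg: "0 \<le> T u x y z" by (simp add: T_def)
lemma v_nonneg: "0 \<le> v u y" by (simp add: v_def sum_nonneg)

lemma sum_QV: "(\<Sum>u\<in>A. pmf Q u * pmf (V u) x * pmf (W x) y) = pmf pXY (x, y)"
proof -
  have "pmf pXY (x, y) = (\<Sum>z\<in>UNIV. p x y z)"
    by (simp add: p_eq sum_pmf_UNIV flip: sum_distrib_left)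
  also have "\<dots> = (\<Sum>u\<in>A. \<Sum>z\<in>UNIV. pmf Q u * pmf (V u) x * pmf (W x) y * pmf (B u y) z)"
    unfolding p_def T_def by (subst sum.swap) (simp only: mult.assoc)
  also have "\<dots> = (\<Sum>u\<in>A. pmf Q u * pmf (V u) x * pmf (W x) y)"
    by (simp add: sum_pmf_UNIV flip: sum_distrib_left)
  finally show ?thesis by simp
qed

lemma sum_Q: "(\<Sum>u\<in>A. pmf Q u) = 1"
  using finQ unfolding A_def by (intro sum_pmf_eq_1) auto

lemma sum_v: "(\<Sum>y\<in>UNIV. v u y) = 1"
  unfolding v_def by (subst sum.swap) (simp add: sum_pmf_UNIV flip: sum_distrib_left)

lemma sum_T: "(\<Sum>x\<in>UNIV. \<Sum>y\<in>UNIV. \<Sum>z\<in>UNIV. T u x y z) = 1"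
  unfolding T_def by (simp add: sum_pmf_UNIV flip: sum_distrib_left)

lemma finA: "finite A" using finQ by (simp add: A_def)

lemma Q_pos: "u \<in> A \<Longrightarrow> 0 < pmf Q u"
  by (simp add: A_def pmf_positive)

lemma p_pos: "u \<in> A \<Longrightarrow> 0 < T u x y z \<Longrightarrow> 0 < p x y z"
  unfolding p_def by (rule sum_pos2[OF finA, of u]) (auto simp: Q_pos T_nonneg)

lemma pY_pos: "u \<in> A \<Longrightarrow> 0 < v u y \<Longrightarrow> 0 < pY y"
  unfolding pY_def by (rule sum_pos2[OF finA, of u]) (auto simp: Q_pos v_nonneg)

lemma n_letter_bad_covering:
  assumes d: "\<delta> > 0"
  shows "\<exists>C. \<forall>n>0. bad_covering n (2 powr (n * (info_UXYZ + \<delta>)))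
    \<le> C / n"
proof -
  let ?A = "A \<times> (UNIV :: 'x set) \<times> (UNIV :: 'y set) \<times> (UNIV :: 'z set)"
  let ?a = "\<lambda>t. T (fst t) (fst (snd t)) (fst (snd (snd t))) (snd (snd (snd t)))"
  let ?b = "\<lambda>t. p (fst (snd t)) (fst (snd (snd t))) (snd (snd (snd t)))"
  let ?j = "\<lambda>t. pmf Q (fst t) * ?a t"
  let ?C = "\<Sum>t\<in>?A. ?j t * (log 2 (?a t / ?b t) - info_UXYZ)\<^sup>2"
  have j1: "(\<Sum>t\<in>?A. ?j t) = 1"
  proof -
    have "(\<Sum>t\<in>?A. ?j t) = (\<Sum>u\<in>A. \<Sum>x\<in>UNIV. \<Sum>y\<in>UNIV. \<Sum>z\<in>UNIV. pmf Q u * T u x y z)"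
      by (simp add: sum.cartesian_product case_prod_unfold)
    also have "\<dots> = 1" by (simp add: sum_T sum_Q flip: sum_distrib_left)
    finally show ?thesis .
  qed
  have info: "info_UXYZ = (\<Sum>t\<in>?A. ?j t * log 2 (?a t / ?b t))"
    by (simp add: info_UXYZ_def case_prod_unfold)
  have "(\<Sum>ts\<in>nlists n ?A. (\<Prod>i<n. ?j (ts ! i)) *
       of_bool (2 powr (n * (info_UXYZ + \<delta>)) * (\<Prod>i<n. ?b (ts ! i)) < (\<Prod>i<n. ?a (ts ! i)))) \<le> ?C / (n * \<delta>\<^sup>2)" if "n > 0" for n
  proof (rule atypical_probability[OF _ j1 _ _ _ info d that])
    show "finite ?A" using finA by simp
    show "0 < ?a t" if "t \<in> ?A" "0 < ?j t" for t
      using that by (simp add: zero_less_mult_iff)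
    then show "0 < ?b t" if "t \<in> ?A" "0 < ?j t" for t
      using that p_pos by (metis mem_Times_iff)
  qed (simp add: T_nonneg)
  note bound = this
  show ?thesis
  proof (intro exI allI impI)
    fix n :: nat assume n: "n > 0"
    have "bad_covering n (2 powr (n * (info_UXYZ + \<delta>)))
     = (\<Sum>ts\<in>nlists n ?A. (\<Prod>i<n. ?j (ts ! i)) *
       of_bool (2 powr (n * (info_UXYZ + \<delta>)) * (\<Prod>i<n. ?b (ts ! i)) < (\<Prod>i<n. ?a (ts ! i))))"
      unfolding bad_covering_def sum_nlists_zip4
    proof (rule sum.cong[OF refl])
      fix ts assume "ts \<in> nlists n ?A"
      then have "length ts = n" by (simp add: nlists_def)
      then show "(\<Prod>i<n. pmf Q (map fst ts ! i) * T (map fst ts ! i) (map (\<lambda>t. fst (snd t)) ts ! i) (map (\<lambda>t. fst (snd (snd t))) ts ! i) (map (\<lambda>t. snd (snd (snd t))) ts ! i)) *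
         of_bool (2 powr (n * (info_UXYZ + \<delta>)) * (\<Prod>i<n. p (map (\<lambda>t. fst (snd t)) ts ! i) (map (\<lambda>t. fst (snd (snd t))) ts ! i) (map (\<lambda>t. snd (snd (snd t))) ts ! i))
           < (\<Prod>i<n. T (map fst ts ! i) (map (\<lambda>t. fst (snd t)) ts ! i) (map (\<lambda>t. fst (snd (snd t))) ts ! i) (map (\<lambda>t. snd (snd (snd t))) ts ! i)))
        = (\<Prod>i<n. ?j (ts ! i)) *
       of_bool (2 powr (n * (info_UXYZ + \<delta>)) * (\<Prod>i<n. ?b (ts ! i)) < (\<Prod>i<n. ?a (ts ! i)))"
        by (simp cong: prod.cong_simp)
    qed
    also have "\<dots> \<le> ?C / (n * \<delta>\<^sup>2)" by (rule bound[OF n])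
    also have "\<dots> = ?C / \<delta>\<^sup>2 / n" by simp
    finally show "bad_covering n (2 powr (n * (info_UXYZ + \<delta>)))
      \<le> ?C / \<delta>\<^sup>2 / n" .
  qed
qed

text \<open>Here the lower tail of the likelihood ratio v/pY matters. Inverting the ratio makes it
  an upper tail with mean \<open>- info_UY\<close>, so that \<open>atypical_probability\<close>
  applies.\<close>

lemma n_letter_bad_decoding:
  assumes d: "\<delta> > 0"
  shows "\<exists>C. \<forall>n>0. bad_decoding n (2 powr (n * (info_UY - \<delta>)))
    \<le> C / n"
proof -
  let ?A = "A \<times> (UNIV :: 'y set)"
  let ?b = "\<lambda>t. v (fst t) (snd t)"
  let ?a = "\<lambda>t. pY (snd t)"
  let ?j = "\<lambda>t. pmf Q (fst t) * ?b t"
  let ?C = "\<Sum>t\<in>?A. ?j t * (log 2 (?a t / ?b t) - (- info_UY))\<^sup>2"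
  have j1: "(\<Sum>t\<in>?A. ?j t) = 1"
  proof -
    have "(\<Sum>t\<in>?A. ?j t) = (\<Sum>u\<in>A. \<Sum>y\<in>UNIV. pmf Q u * v u y)"
      by (simp add: sum.cartesian_product case_prod_unfold)
    also have "\<dots> = 1" by (simp add: sum_v sum_Q flip: sum_distrib_left)
    finally show ?thesis .
  qed
  have bpos: "0 < ?b t" if "t \<in> ?A" "0 < ?j t" for t
    using that by (simp add: zero_less_mult_iff)
  have apos: "0 < ?a t" if "t \<in> ?A" "0 < ?j t" for t
    using bpos[OF that] that pY_pos by (metis mem_Times_iff)
  have jnn: "0 \<le> ?j t" for t by (simp add: v_nonneg)
  have info: "- info_UY = (\<Sum>t\<in>?A. ?j t * log 2 (?a t / ?b t))"
    unfolding info_UY_def sum_negf[symmetric]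
  proof (rule sum.cong[OF refl])
    fix t assume t: "t \<in> ?A"
    show "- (case t of (u, y) \<Rightarrow> pmf Q u * v u y * log 2 (v u y / pY y)) = ?j t * log 2 (?a t / ?b t)"
    proof (cases "?j t = 0")
      case True
      then show ?thesis by (cases t) auto
    next
      case False
      then have "0 < ?j t" using jnn[of t] by linarith
      with apos[OF t] bpos[OF t] show ?thesis
        by (cases t) (simp add: log_divide algebra_simps)
    qed
  qed
  have bound: "(\<Sum>ts\<in>nlists n ?A. (\<Prod>i<n. ?j (ts ! i)) *
       of_bool (2 powr (n * (- info_UY + \<delta>)) * (\<Prod>i<n. ?b (ts ! i)) < (\<Prod>i<n. ?a (ts ! i)))) \<le> ?C / (n * \<delta>\<^sup>2)" if "n > 0" for n
    by (rule atypical_probability[OF _ j1 jnn apos bpos info d that]) (use finA in simp)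
  show ?thesis
  proof (intro exI allI impI)
    fix n :: nat assume n: "n > 0"
    have "bad_decoding n (2 powr (n * (info_UY - \<delta>)))
     = (\<Sum>ts\<in>nlists n ?A. (\<Prod>i<n. ?j (ts ! i)) *
       of_bool (2 powr (n * (- info_UY + \<delta>)) * (\<Prod>i<n. ?b (ts ! i)) < (\<Prod>i<n. ?a (ts ! i))))"
      unfolding bad_decoding_def sum_nlists_zip[symmetric]
    proof (rule sum.cong[OF refl])
      fix ts assume "ts \<in> nlists n ?A"
      then have l: "length ts = n" by (simp add: nlists_def)
      have "2 powr (n * (- info_UY + \<delta>)) = inverse (2 powr (n * (info_UY - \<delta>)))"
        by (simp add: powr_minus[symmetric] algebra_simps)
      then have eq: "b < 2 powr (n * (info_UY - \<delta>)) * a \<longleftrightarrow> 2 powr (n * (- info_UY + \<delta>)) * b < a" for a b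
        by (simp add: divide_inverse[symmetric] pos_divide_less_eq mult.commute[of _ b] mult.commute[of _ a])
      show "(\<Prod>i<n. pmf Q (map fst ts ! i) * v (map fst ts ! i) (map snd ts ! i)) *
         of_bool ((\<Prod>i<n. v (map fst ts ! i) (map snd ts ! i)) < 2 powr (n * (info_UY - \<delta>)) * (\<Prod>i<n. pY (map snd ts ! i)))
        = (\<Prod>i<n. ?j (ts ! i)) *
       of_bool (2 powr (n * (- info_UY + \<delta>)) * (\<Prod>i<n. ?b (ts ! i)) < (\<Prod>i<n. ?a (ts ! i)))"
        unfolding eq using l by (simp cong: prod.cong_simp)
    qed
    also have "\<dots> \<le> ?C / (n * \<delta>\<^sup>2)" by (rule bound[OF n])
    also have "\<dots> = ?C / \<delta>\<^sup>2 / n" by simp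
    finally show "bad_decoding n (2 powr (n * (info_UY - \<delta>)))
      \<le> ?C / \<delta>\<^sup>2 / n" .
  qed
qed

text \<open>\<open>one_shot_code\<close> for n-fold product laws, where every sum over words factors
  into letters. The factor 2 of the one-shot bound cancels against the 1/2 in
  \<open>tv_dist\<close>.\<close>

lemma n_letter_code:
  assumes n: "n > 0" and KL: "K > 0" "L > 0" and tau: "\<tau> \<ge> 0" and gam: "\<gamma> > 0"
  shows "\<exists>enc dec. (\<forall>xs. set_pmf (enc xs) \<subseteq> {1..K}) \<and>
    tv_dist (code_n pXY enc dec n) (target_n pXY pZ n) \<le>
      sqrt (\<tau> / (real K * real L))
      + 2 * bad_covering n \<tau>
      + (bad_decoding n \<gamma>
         + (real L - 1) / \<gamma>)"
proof -
  let ?X = "nlists n (UNIV :: 'x set)" and ?Y = "nlists n (UNIV :: 'y set)" and ?Z = "nlists n (UNIV :: 'z set)"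
  let ?A = "nlists n A"
  define Qn where "Qn = iid_pmf n Q"
  define Vn where "Vn us = prod_list_pmf (map V us)" for us
  define Wn where "Wn xs = prod_list_pmf (map W xs)" for xs
  define Bn where "Bn us ys = prod_list_pmf (map2 B us ys)" for us ys
  let ?T = "\<lambda>us xs ys zs. pmf (Vn us) xs * pmf (Wn xs) ys * pmf (Bn us ys) zs" and ?v = "\<lambda>us ys. (\<Sum>xs\<in>?X. pmf (Vn us) xs * pmf (Wn xs) ys)"
  let ?TP = "\<lambda>us xs ys zs. (\<Prod>i<n. T (us ! i) (xs ! i) (ys ! i) (zs ! i))" and ?pP = "\<lambda>xs ys zs. (\<Prod>i<n. p (xs ! i) (ys ! i) (zs ! i))"
  let ?QT = "\<lambda>us xs ys zs. (\<Prod>i<n. pmf Q (us ! i) * T (us ! i) (xs ! i) (ys ! i) (zs ! i))"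
  have fin: "finite ?A" "finite ?X" "finite ?Y" "finite ?Z"
    using finA by (auto intro!: finite_nlists)
  have lenA: "length us = n" if "us \<in> ?A" for us using that by (simp add: nlists_def)
  have Q: "set_pmf Qn \<subseteq> ?A"
    using set_prod_list_pmf[of "replicate n Q"] by (auto simp: Qn_def iid_pmf_eq nlists_iff_nth A_def)
  have V: "set_pmf (Vn us) \<subseteq> ?X" if "us \<in> ?A" for us
    using set_prod_list_pmf[of "map V us"] lenA[OF that] by (auto simp: Vn_def in_nlists_UNIV)
  have W: "set_pmf (Wn xs) \<subseteq> ?Y" if "xs \<in> ?X" for xs
    using set_prod_list_pmf[of "map W xs"] that by (auto simp: Wn_def in_nlists_UNIV)
  have B: "set_pmf (Bn us ys) \<subseteq> ?Z" if "us \<in> ?A" "ys \<in> ?Y" for us ys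
    using set_prod_list_pmf[of "map2 B us ys"] that lenA[OF that(1)] by (auto simp: Bn_def in_nlists_UNIV)
  have Qn: "pmf Qn us = (\<Prod>i<n. pmf Q (us ! i))" if "us \<in> ?A" for us
    using lenA[OF that] by (simp add: Qn_def pmf_iid_pmf)
  have Vn: "pmf (Vn us) xs = (\<Prod>i<n. pmf (V (us ! i)) (xs ! i))" if "us \<in> ?A" "xs \<in> ?X" for us xs
    using lenA[OF that(1)] that by (simp add: Vn_def pmf_prod_list_pmf in_nlists_UNIV)
  have Wn: "pmf (Wn xs) ys = (\<Prod>i<n. pmf (W (xs ! i)) (ys ! i))" if "xs \<in> ?X" "ys \<in> ?Y" for xs ys
    using that by (simp add: Wn_def pmf_prod_list_pmf in_nlists_UNIV)
  have Bn: "pmf (Bn us ys) zs = (\<Prod>i<n. pmf (B (us ! i) (ys ! i)) (zs ! i))" if "us \<in> ?A" "ys \<in> ?Y" "zs \<in> ?Z" for us ys zs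
    using lenA[OF that(1)] that by (simp add: Bn_def pmf_prod_list_pmf in_nlists_UNIV)
  have Tn: "?T us xs ys zs = ?TP us xs ys zs"
    if "us \<in> ?A" "xs \<in> ?X" "ys \<in> ?Y" "zs \<in> ?Z" for us xs ys zs
    using that by (simp add: Vn Wn Bn T_def prod.distrib)
  have pn: "(\<Sum>us\<in>?A. pmf Qn us * ?T us xs ys zs) = ?pP xs ys zs"
    if "xs \<in> ?X" "ys \<in> ?Y" "zs \<in> ?Z" for xs ys zs
  proof -
    have "(\<Sum>us\<in>?A. pmf Qn us * ?T us xs ys zs)
      = (\<Sum>us\<in>?A. \<Prod>i<n. pmf Q (us ! i) * T (us ! i) (xs ! i) (ys ! i) (zs ! i))"
      using that by (intro sum.cong refl) (simp add: Tn Qn prod.distrib)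
    also have "\<dots> = ?pP xs ys zs"
      unfolding p_def by (rule sum_prod_nlists[OF finA])
    finally show ?thesis .
  qed
  have vn: "?v us ys = (\<Prod>i<n. v (us ! i) (ys ! i))"
    if "us \<in> ?A" "ys \<in> ?Y" for us ys
  proof -
    have "?v us ys = (\<Sum>xs\<in>?X. \<Prod>i<n. pmf (V (us ! i)) (xs ! i) * pmf (W (xs ! i)) (ys ! i))"
      using that by (intro sum.cong refl) (simp add: Vn Wn prod.distrib)
    also have "\<dots> = (\<Prod>i<n. v (us ! i) (ys ! i))"
      unfolding v_def by (rule sum_prod_nlists) simp
    finally show ?thesis .
  qed
  have pYn: "(\<Sum>us\<in>?A. pmf Qn us * ?v us ys) = (\<Prod>i<n. pY (ys ! i))"
    if "ys \<in> ?Y" for ys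
  proof -
    have "(\<Sum>us\<in>?A. pmf Qn us * ?v us ys)
      = (\<Sum>us\<in>?A. \<Prod>i<n. pmf Q (us ! i) * v (us ! i) (ys ! i))"
      using that by (intro sum.cong refl) (simp add: vn Qn prod.distrib)
    also have "\<dots> = (\<Prod>i<n. pY (ys ! i))"
      unfolding pY_def by (rule sum_prod_nlists[OF finA])
    finally show ?thesis .
  qed
  have src: "(\<Sum>us\<in>?A. pmf Qn us * pmf (Vn us) xs) * pmf (Wn xs) ys = pmf (source_n pXY n) (xs, ys)"
    if "xs \<in> ?X" "ys \<in> ?Y" for xs ys
  proof -
    have "(\<Sum>us\<in>?A. pmf Qn us * pmf (Vn us) xs) * pmf (Wn xs) ys
      = (\<Sum>us\<in>?A. \<Prod>i<n. pmf Q (us ! i) * pmf (V (us ! i)) (xs ! i) * pmf (W (xs ! i)) (ys ! i))"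
      unfolding sum_distrib_right using that by (intro sum.cong refl) (simp add: Vn Wn Qn prod.distrib)
    also have "\<dots> = (\<Prod>i<n. pmf pXY (xs ! i, ys ! i))"
      unfolding sum_QV[symmetric] by (rule sum_prod_nlists[OF finA])
    finally show ?thesis using that by (simp add: pmf_source_n in_nlists_UNIV)
  qed
  have tgt: "?pP xs ys zs = pmf (target_n pXY pZ n) (xs, ys, zs)"
    if "xs \<in> ?X" "ys \<in> ?Y" "zs \<in> ?Z" for xs ys zs
    using that by (simp add: p_eq pmf_target_n in_nlists_UNIV)
  obtain enc dec where enc: "\<forall>xs. set_pmf (enc xs) \<subseteq> {1..K}" and dec: "\<forall>m\<in>{1..K}. \<forall>ys\<in>?Y. set_pmf (dec m ys) \<subseteq> ?Z"
    and bound: "(\<Sum>xs\<in>?X. \<Sum>ys\<in>?Y. \<Sum>zs\<in>?Z. \<bar>(\<Sum>us\<in>?A. pmf Qn us * pmf (Vn us) xs) * pmf (Wn xs) ys *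
         (\<Sum>m\<in>{1..K}. pmf (enc xs) m * pmf (dec m ys) zs) - (\<Sum>us\<in>?A. pmf Qn us * ?T us xs ys zs)\<bar>)
     \<le> 2 * (sqrt (\<tau> / (real K * real L))
          + 2 * (\<Sum>us\<in>?A. pmf Qn us * (\<Sum>xs\<in>?X. \<Sum>ys\<in>?Y. \<Sum>zs\<in>?Z. ?T us xs ys zs
             * of_bool (\<tau> * (\<Sum>us\<in>?A. pmf Qn us * ?T us xs ys zs) < ?T us xs ys zs))))
     + 2 * ((\<Sum>us\<in>?A. pmf Qn us * (\<Sum>ys\<in>?Y. ?v us ys *
           of_bool (?v us ys < \<gamma> * (\<Sum>us\<in>?A. pmf Qn us * ?v us ys))))
        + (real L - 1) / \<gamma>)"
    using one_shot_code[where V = Vn and W = Wn and B = Bn, OF fin Q V W B KL tau gam] by blast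
  have e1: "(\<Sum>us\<in>?A. pmf Qn us * (\<Sum>xs\<in>?X. \<Sum>ys\<in>?Y. \<Sum>zs\<in>?Z. ?T us xs ys zs
             * of_bool (\<tau> * (\<Sum>us\<in>?A. pmf Qn us * ?T us xs ys zs) < ?T us xs ys zs)))
      = (\<Sum>us\<in>?A. \<Sum>xs\<in>?X. \<Sum>ys\<in>?Y. \<Sum>zs\<in>?Z.
          ?QT us xs ys zs *
          of_bool (\<tau> * ?pP xs ys zs < ?TP us xs ys zs))"
    unfolding sum_distrib_left
  proof (intro sum.cong refl)
    fix us xs ys zs assume "us \<in> ?A" "xs \<in> ?X" "ys \<in> ?Y" "zs \<in> ?Z"
    note m = this
    show "pmf Qn us * (?T us xs ys zs
             * of_bool ((\<Sum>us\<in>?A. \<tau> * (pmf Qn us * ?T us xs ys zs)) < ?T us xs ys zs))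
       = ?QT us xs ys zs *
          of_bool (\<tau> * ?pP xs ys zs < ?TP us xs ys zs)"
      unfolding sum_distrib_left[symmetric] pn[OF m(2-4)] Tn[OF m] Qn[OF m(1)] prod.distrib by (simp only: mult.assoc)
  qed
  have e2: "(\<Sum>us\<in>?A. pmf Qn us * (\<Sum>ys\<in>?Y. ?v us ys *
           of_bool (?v us ys < \<gamma> * (\<Sum>us\<in>?A. pmf Qn us * ?v us ys))))
     = (\<Sum>us\<in>?A. \<Sum>ys\<in>?Y.
          (\<Prod>i<n. pmf Q (us ! i) * v (us ! i) (ys ! i)) *
          of_bool ((\<Prod>i<n. v (us ! i) (ys ! i)) < \<gamma> * (\<Prod>i<n. pY (ys ! i))))"
  proof (rule sum.cong[OF refl])
    fix us assume us: "us \<in> ?A"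
    show "pmf Qn us * (\<Sum>ys\<in>?Y. ?v us ys *
           of_bool (?v us ys < \<gamma> * (\<Sum>us\<in>?A. pmf Qn us * ?v us ys)))
      = (\<Sum>ys\<in>?Y.
          (\<Prod>i<n. pmf Q (us ! i) * v (us ! i) (ys ! i)) *
          of_bool ((\<Prod>i<n. v (us ! i) (ys ! i)) < \<gamma> * (\<Prod>i<n. pY (ys ! i))))"
      unfolding sum_distrib_left[of "pmf Qn us"]
    proof (rule sum.cong[OF refl])
      fix ys assume ys: "ys \<in> ?Y"
      show "pmf Qn us * (?v us ys *
           of_bool (?v us ys < \<gamma> * (\<Sum>us\<in>?A. pmf Qn us * ?v us ys)))
        = (\<Prod>i<n. pmf Q (us ! i) * v (us ! i) (ys ! i)) *
          of_bool ((\<Prod>i<n. v (us ! i) (ys ! i)) < \<gamma> * (\<Prod>i<n. pY (ys ! i)))"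
        unfolding pYn[OF ys] vn[OF us ys] Qn[OF us] prod.distrib by (simp only: mult.assoc)
    qed
  qed
  have code: "pmf (code_n pXY enc dec n) (xs, ys, zs) = (\<Sum>us\<in>?A. pmf Qn us * pmf (Vn us) xs) * pmf (Wn xs) ys *
         (\<Sum>m\<in>{1..K}. pmf (enc xs) m * pmf (dec m ys) zs)" if "xs \<in> ?X" "ys \<in> ?Y" for xs ys zs
    unfolding pmf_code_n src[OF that] using enc by (subst pmf_bind_sum[of "{1..K}"]) auto
  let ?S = "?X \<times> ?Y \<times> ?Z"
  have "set_pmf (code_n pXY enc dec n) \<subseteq> ?S"
  proof
    fix t assume "t \<in> set_pmf (code_n pXY enc dec n)"
    then obtain xs ys m zs where t: "t = (xs, ys, zs)" "(xs, ys) \<in> set_pmf (source_n pXY n)"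
      "m \<in> set_pmf (enc xs)" "zs \<in> set_pmf (dec m ys)"
      unfolding code_n_def by auto
    then show "t \<in> ?S" using source_n_length[OF t(2)] enc dec
      by (fastforce simp: in_nlists_UNIV)
  qed
  moreover have "set_pmf (target_n pXY pZ n) \<subseteq> ?S"
  proof
    fix t assume "t \<in> set_pmf (target_n pXY pZ n)"
    then show "t \<in> ?S"
      by (cases t) (auto simp: set_pmf_iff pmf_target_n in_nlists_UNIV split: if_splits)
  qed
  ultimately have "2 * tv_dist (code_n pXY enc dec n) (target_n pXY pZ n)
     = (\<Sum>t\<in>?S. \<bar>pmf (code_n pXY enc dec n) t - pmf (target_n pXY pZ n) t\<bar>)"
    using fin by (subst tv_dist_eq[of ?S]) auto
  also have "\<dots> = (\<Sum>xs\<in>?X. \<Sum>ys\<in>?Y. \<Sum>zs\<in>?Z. \<bar>pmf (code_n pXY enc dec n) (xs, ys, zs) - pmf (target_n pXY pZ n) (xs, ys, zs)\<bar>)"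
    by (simp add: sum.cartesian_product case_prod_unfold)
  also have "\<dots> = (\<Sum>xs\<in>?X. \<Sum>ys\<in>?Y. \<Sum>zs\<in>?Z. \<bar>(\<Sum>us\<in>?A. pmf Qn us * pmf (Vn us) xs) * pmf (Wn xs) ys *
         (\<Sum>m\<in>{1..K}. pmf (enc xs) m * pmf (dec m ys) zs) - (\<Sum>us\<in>?A. pmf Qn us * ?T us xs ys zs)\<bar>)"
    by (intro sum.cong refl arg_cong[where f = abs]) (simp only: code pn tgt)
  also note bound[unfolded e1 e2]
  finally show ?thesis
    unfolding distrib_left[symmetric] mult_le_cancel_left_pos[OF zero_less_numeral] bad_covering_def bad_decoding_def
    using enc by blast
qed

section \<open>Comparison of I(U;XYZ) with I(U;Y), and the choice of rates\<close>

lemma sum_xz_T: "(\<Sum>x\<in>UNIV. \<Sum>z\<in>UNIV. T u x y z) = v u y"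
  unfolding T_def v_def by (simp add: sum_pmf_UNIV flip: sum_distrib_left)

lemma sum_xz_p: "(\<Sum>x\<in>UNIV. \<Sum>z\<in>UNIV. p x y z) = pY y"
proof -
  have "(\<Sum>x\<in>UNIV. \<Sum>z\<in>UNIV. p x y z) = (\<Sum>u\<in>A. \<Sum>x\<in>UNIV. \<Sum>z\<in>UNIV. pmf Q u * T u x y z)"
    unfolding p_def by (subst sum.swap[of _ A UNIV], subst sum.swap[of _ A UNIV]) (rule refl)
  then show ?thesis by (simp add: pY_def sum_xz_T flip: sum_distrib_left)
qed

lemma v_pos: "0 < T u x y z \<Longrightarrow> 0 < v u y"
proof -
  assume t: "0 < T u x y z"
  have "T u x y z \<le> (\<Sum>z\<in>UNIV. T u x y z)"
    by (rule member_le_sum) (auto simp: T_nonneg)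
  also have "\<dots> \<le> (\<Sum>x\<in>UNIV. \<Sum>z\<in>UNIV. T u x y z)"
    by (rule member_le_sum[where f = "\<lambda>x. \<Sum>z\<in>UNIV. T u x y z"]) (auto simp: T_nonneg sum_nonneg)
  finally show ?thesis using t by (simp add: sum_xz_T)
qed

lemma sum_UXYZ:
  fixes F :: "'u \<Rightarrow> 'x \<Rightarrow> 'y \<Rightarrow> 'z \<Rightarrow> real"
  shows "(\<Sum>t\<in>A \<times> UNIV \<times> UNIV \<times> UNIV. case t of (u, x, y, z) \<Rightarrow> F u x y z)
    = (\<Sum>u\<in>A. \<Sum>y\<in>UNIV. \<Sum>x\<in>UNIV. \<Sum>z\<in>UNIV. F u x y z)"
  by (subst sum.swap[of _ "UNIV :: 'x set"]) (simp add: sum.cartesian_product case_prod_unfold)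

lemma info_UY_eq: "info_UY = (\<Sum>t\<in>A \<times> UNIV \<times> UNIV \<times> UNIV. case t of (u, x, y, z) \<Rightarrow>
    pmf Q u * T u x y z * log 2 (v u y / pY y))"
proof -
  have "info_UY = (\<Sum>u\<in>A. \<Sum>y\<in>UNIV. pmf Q u * v u y * log 2 (v u y / pY y))"
    by (simp add: info_UY_def sum.cartesian_product case_prod_unfold)
  also have "\<dots> = (\<Sum>u\<in>A. \<Sum>y\<in>UNIV. \<Sum>x\<in>UNIV. \<Sum>z\<in>UNIV. pmf Q u * T u x y z * log 2 (v u y / pY y))"
    by (simp add: sum_xz_T flip: sum_distrib_left sum_distrib_right)
  finally show ?thesis unfolding sum_UXYZ .
qed

text \<open>The difference is I(XZ;U|Y). Gibbs' inequality is applied to the joint law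
  \<open>P\<close> and to \<open>P'\<close>, under which U and (X,Z) are independent given Y. The
  result makes the rates below nonnegative, as \<open>achievable\<close> demands.\<close>

lemma info_nonneg: "info_UY \<le> info_UXYZ"
proof -
  let ?A = "A \<times> (UNIV :: 'x set) \<times> (UNIV :: 'y set) \<times> (UNIV :: 'z set)"
  define P where "P = (\<lambda>(u, x, y, z). pmf Q u * T u x y z)"
  define P' where "P' = (\<lambda>(u, x, y, z). pmf Q u * v u y * p x y z / pY y)"
  have p0: "0 \<le> p x y z" for x y z by (simp add: p_eq)
  have pY0: "0 \<le> pY y" for y by (simp add: pY_def sum_nonneg v_nonneg)
  have "(\<Sum>t\<in>?A. eta (P t)) \<le> - (\<Sum>t\<in>?A. P t * log 2 (P' t))"
  proof (rule Gibbs_inequality)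
    show "finite ?A" using finA by simp
    show "0 \<le> P t" for t by (auto simp: P_def T_nonneg split: prod.split)
    show "0 \<le> P' t" for t using p0 pY0 by (auto simp: P'_def v_nonneg split: prod.split)
    show "0 < P' t" if t: "t \<in> ?A" "0 < P t" for t
    proof -
      obtain u x y z where tt: "t = (u, x, y, z)" by (cases t)
      with t have u: "u \<in> A" and T: "0 < T u x y z"
        using Q_pos by (auto simp: P_def zero_less_mult_iff)
      then show ?thesis
        using Q_pos v_pos p_pos pY_pos by (simp add: P'_def tt)
    qed
    have "sum P ?A = 1"
      unfolding P_def sum_UXYZ by (simp add: sum_xz_T sum_v sum_Q flip: sum_distrib_left)
    moreover have "sum P' ?A = (\<Sum>u\<in>A. \<Sum>y\<in>UNIV. pmf Q u * v u y * (pY y / pY y))"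
      unfolding P'_def sum_UXYZ
      by (simp only: sum_divide_distrib[symmetric] sum_distrib_left[symmetric] sum_xz_p times_divide_eq_right)
    moreover have "\<dots> \<le> (\<Sum>u\<in>A. \<Sum>y\<in>UNIV. pmf Q u * v u y * 1)"
      by (intro sum_mono mult_left_mono) (auto simp: v_nonneg)
    moreover have "\<dots> = 1"
      by (simp add: sum_v sum_Q flip: sum_distrib_left)
    ultimately show "sum P' ?A \<le> sum P ?A" by simp
  qed
  then have "0 \<le> (\<Sum>t\<in>?A. P t * log 2 (P t) - P t * log 2 (P' t))"
    by (simp add: eta_def sum_negf sum_subtractf)
  also have "\<dots> = (\<Sum>t\<in>?A. case t of (u, x, y, z) \<Rightarrow> pmf Q u * T u x y z * log 2 (T u x y z / p x y z)
      - pmf Q u * T u x y z * log 2 (v u y / pY y))"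
  proof (rule sum.cong[OF refl])
    fix t assume t: "t \<in> ?A"
    obtain u x y z where tt: "t = (u, x, y, z)" by (cases t)
    with t have u: "u \<in> A" by simp
    show "P t * log 2 (P t) - P t * log 2 (P' t) = (case t of (u, x, y, z) \<Rightarrow> pmf Q u * T u x y z * log 2 (T u x y z / p x y z)
      - pmf Q u * T u x y z * log 2 (v u y / pY y))"
    proof (cases "T u x y z = 0")
      case False
      then have T: "0 < T u x y z" using T_nonneg[of u x y z] by linarith
      note pos = T Q_pos[OF u] p_pos[OF u T] v_pos[OF T] pY_pos[OF u v_pos[OF T]]
      show ?thesis using pos by (simp add: tt P_def P'_def log_mult log_divide algebra_simps)
    qed (simp add: tt P_def)
  qed
  also have "\<dots> = info_UXYZ - (\<Sum>t\<in>?A. case t of (u, x, y, z) \<Rightarrow> pmf Q u * T u x y z * log 2 (v u y / pY y))"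
    by (simp add: info_UXYZ_def case_prod_unfold sum_subtractf)
  finally show ?thesis by (simp add: info_UY_eq)
qed

lemma achievable_rate:
  assumes R: "info_UXYZ - info_UY < R"
  shows "achievable pXY pZ R"
proof -
  have R0: "0 \<le> R" using info_nonneg R by linarith
  \<comment> \<open>A quarter of the slack: the total rate of (m,l) becomes I(U;XYZ) + 2\<delta>
    against the covering threshold I(U;XYZ) + \<delta>, and the rate of l becomes I(U;Y) - 2\<delta>
    against the decoding threshold I(U;Y) - \<delta>.\<close>
  define \<delta> where "\<delta> = (R - (info_UXYZ - info_UY)) / 4"
  have d: "\<delta> > 0" using R by (simp add: \<delta>_def)
  obtain C1 where C1: "\<And>n::nat. n > 0 \<Longrightarrow> bad_covering n (2 powr (n * (info_UXYZ + \<delta>)))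
    \<le> C1 / n"
    using n_letter_bad_covering[OF d] by blast
  obtain C2 where C2: "\<And>n::nat. n > 0 \<Longrightarrow> bad_decoding n (2 powr (n * (info_UY - \<delta>)))
    \<le> C2 / n"
    using n_letter_bad_decoding[OF d] by blast
  define bound where "bound n = sqrt (2 * 2 powr (- (real n * \<delta>))) + 2 * (C1 / real n) + (C2 / real n + 2 powr (- (real n * \<delta>)))" for n :: nat
  have ex: "\<exists>enc dec. (\<forall>xs. set_pmf (enc xs) \<subseteq> {1..num_msgs n R}) \<and>
      (n > 0 \<longrightarrow> tv_dist (code_n pXY enc dec n) (target_n pXY pZ n) \<le> bound n)" for n
  proof (cases "n > 0")
    case False
    show ?thesis
      using code_rate_bounds(2)[OF R0, of n] False by (intro exI[of _ "\<lambda>_. return_pmf 1"]) simp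
  next
    case True
    let ?K = "num_msgs n R"
    define l where "l = 2 powr (n * (info_UY - 2 * \<delta>))"
    define L where "L = nat \<lceil>l\<rceil>"
    let ?\<tau> = "2 powr (n * (info_UXYZ + \<delta>))" and ?\<gamma> = "2 powr (n * (info_UY - \<delta>))"
    have l0: "l > 0" by (simp add: l_def)
    have L: "L > 0" "l \<le> real L" "real L \<le> l + 1" using l0 unfolding L_def by linarith+
    have K: "2 powr (n * R) / 2 \<le> real ?K" "?K > 0" using code_rate_bounds[OF R0] by auto
    obtain enc dec where enc: "\<forall>xs. set_pmf (enc xs) \<subseteq> {1..?K}" and tv:
      "tv_dist (code_n pXY enc dec n) (target_n pXY pZ n) \<le>
      sqrt (?\<tau> / (real ?K * real L))
      + 2 * bad_covering n ?\<tau>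
      + (bad_decoding n ?\<gamma>
         + (real L - 1) / ?\<gamma>)"
      using n_letter_code[OF True K(2) L(1), of ?\<tau> ?\<gamma>] by auto
    have "2 powr (n * R) / 2 * l \<le> real ?K * real L"
      using K L l0 by (intro mult_mono) auto
    moreover have "2 powr (n * R) / 2 * l = 2 powr (n * (info_UXYZ + 2 * \<delta>)) / 2"
      by (simp add: l_def powr_add[symmetric] \<delta>_def field_simps)
    moreover have "?\<tau> = 2 * 2 powr (- (real n * \<delta>)) * (2 powr (n * (info_UXYZ + 2 * \<delta>)) / 2)"
      by (simp add: powr_add[symmetric] algebra_simps)
    moreover have "0 < real ?K * real L" using K L by simp
    ultimately have "?\<tau> / (real ?K * real L) \<le> 2 * 2 powr (- (real n * \<delta>))"
      by (simp only: pos_divide_le_eq mult_left_mono powr_ge_zero mult_nonneg_nonneg zero_le_numeral)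
    then have s: "sqrt (?\<tau> / (real ?K * real L)) \<le> sqrt (2 * 2 powr (- (real n * \<delta>)))"
      by (rule real_sqrt_le_mono)
    \<comment> \<open>Rounding \<open>l\<close> up to \<open>L\<close> is absorbed by the -1 of the
      union bound.\<close>
    have "(real L - 1) / ?\<gamma> \<le> l / ?\<gamma>"
      using L by (intro divide_right_mono) auto
    also have "\<dots> = 2 powr (- (real n * \<delta>))"
      by (simp add: l_def powr_diff[symmetric] algebra_simps)
    finally have g: "(real L - 1) / ?\<gamma> \<le> 2 powr (- (real n * \<delta>))" .
    have "tv_dist (code_n pXY enc dec n) (target_n pXY pZ n) \<le> bound n"
      unfolding bound_def by (rule order.trans[OF tv]) (intro add_mono s g C1 C2 True mult_left_mono, simp)
    then show ?thesis using enc by blast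
  qed
  then obtain enc dec where enc: "\<And>n xs. set_pmf (enc n xs) \<subseteq> {1..num_msgs n R}"
    and tv: "\<And>n. n > 0 \<Longrightarrow> tv_dist (code_n pXY (enc n) (dec n) n) (target_n pXY pZ n) \<le> bound n"
    by metis
  have "bound \<longlonglongrightarrow> 0"
    unfolding bound_def using d by real_asymp
  have "\<exists>N. \<forall>n\<ge>N. tv_dist (code_n pXY (enc n) (dec n) n) (target_n pXY pZ n) \<le> \<epsilon>" if e: "\<epsilon> > 0" for \<epsilon>
  proof -
    obtain N where N: "\<And>n. n \<ge> N \<Longrightarrow> bound n < \<epsilon>"
      using order_tendstoD(2)[OF \<open>bound \<longlonglongrightarrow> 0\<close> e] by (auto simp: eventually_sequentially)
    have "tv_dist (code_n pXY (enc n) (dec n) n) (target_n pXY pZ n) \<le> \<epsilon>" if "n \<ge> Suc N" for n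
      using tv[of n] N[of n] that by simp
    then show ?thesis by blast
  qed
  then show ?thesis
    unfolding achievable_def using R0 enc by blast
qed

end

lemma achievable_bdd_below: "bdd_below {R. achievable pXY pZ R}"
  by (rule bdd_belowI[of _ 0]) (auto simp: achievable_def)

lemma (in factored_channel) R_NS_le: "R_NS pXY pZ \<le> info_UXYZ - info_UY"
proof (rule field_le_epsilon)
  fix e :: real assume "e > 0"
  then show "R_NS pXY pZ \<le> info_UXYZ - info_UY + e"
    unfolding R_NS_def by (intro cInf_lower achievable_bdd_below CollectI achievable_rate) simp
qed

section \<open>Auxiliary variables and the Markov conditions\<close>

text \<open>Marginal entropies become sums over the support of the joint law, so that an identity
  between several entropies can be checked term by term.\<close>

lemma entropy2_map:
  assumes S: "finite S" "set_pmf J \<subseteq> S"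
  shows "entropy2 (map_pmf f J) = - (\<Sum>t\<in>S. pmf J t * log 2 (pmf (map_pmf f J) (f t)))"
proof -
  let ?M = "pmf (map_pmf f J)"
  have "entropy2 (map_pmf f J) = (\<Sum>b\<in>f ` S. eta (?M b))"
    using S by (intro entropy2_eq) auto
  also have "\<dots> = - (\<Sum>b\<in>f ` S. \<Sum>t\<in>S. pmf J t * of_bool (f t = b) * log 2 (?M b))"
    by (simp add: eta_def sum_negf pmf_map_sum[OF S] sum_distrib_right)
  also have "(\<Sum>b\<in>f ` S. \<Sum>t\<in>S. pmf J t * of_bool (f t = b) * log 2 (?M b))
    = (\<Sum>t\<in>S. \<Sum>b\<in>f ` S. pmf J t * of_bool (f t = b) * log 2 (?M b))"
    by (rule sum.swap)
  also have "\<dots> = (\<Sum>t\<in>S. pmf J t * log 2 (?M (f t)))"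
  proof (rule sum.cong[OF refl])
    fix t assume t: "t \<in> S"
    have "(\<Sum>b\<in>f ` S. pmf J t * of_bool (f t = b) * log 2 (?M b)) = (\<Sum>b\<in>f ` S. if b = f t then pmf J t * log 2 (?M b) else 0)"
      by (intro sum.cong) auto
    then show "(\<Sum>b\<in>f ` S. pmf J t * of_bool (f t = b) * log 2 (?M b)) = pmf J t * log 2 (?M (f t))"
      using S t by simp
  qed
  finally show ?thesis .
qed

lemma entropy2_map_inj:
  assumes "finite (set_pmf p)" "inj f"
  shows "entropy2 (map_pmf f p) = entropy2 p"
proof -
  have "entropy2 (map_pmf f p) = - (\<Sum>t\<in>set_pmf p. pmf p t * log 2 (pmf p t))"
    unfolding entropy2_map[OF assms(1) order.refl] pmf_map_inj'[OF assms(2)] ..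
  then show ?thesis by (simp add: entropy2_def)
qed

lemma pmf_joint_UXYZ:
  "pmf (joint_UXYZ p pZ pU) (u, x, y, z) = pmf p (x, y) * pmf (pZ x y) z * pmf (pU x y z) u"
proof -
  let ?p = "bind_pmf p (\<lambda>(x, y). bind_pmf (pZ x y) (\<lambda>z. return_pmf (x, y, z)))"
  let ?k = "\<lambda>x (y, z). pU x y z"
  have inj: "inj (\<lambda>((x, y, z), u). (u, x, y, z))" by (auto simp: inj_on_def)
  have "joint_UXYZ p pZ pU = map_pmf (\<lambda>((x, y, z), u). (u, x, y, z))
      (bind_pmf ?p (\<lambda>(x, y, z). map_pmf (\<lambda>u. ((x, y, z), u)) (pU x y z)))"
    by (simp add: joint_UXYZ_def map_pmf_def bind_assoc_pmf bind_return_pmf case_prod_unfold)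
  moreover have "(\<lambda>((x, y, z), u). (u, x, y, z)) ((x, y, z), u) = (u, x, y, z)" by simp
  ultimately have "pmf (joint_UXYZ p pZ pU) (u, x, y, z)
     = pmf (bind_pmf ?p (\<lambda>(x, y, z). map_pmf (\<lambda>u. ((x, y, z), u)) (pU x y z))) ((x, y, z), u)"
    using pmf_map_inj'[OF inj, of _ "((x, y, z), u)"] by simp
  also have "\<dots> = pmf (bind_pmf ?p (\<lambda>w. bind_pmf (?k (fst w) (snd w)) (\<lambda>u. return_pmf (w, u)))) ((x, y, z), u)"
    by (simp add: map_pmf_def case_prod_unfold)
  also have "\<dots> = pmf ?p (x, y, z) * pmf (pU x y z) u"
  proof -
    have "pmf (bind_pmf (?k (fst w) (snd w)) (\<lambda>u. return_pmf (w, u))) ((x, y, z), u)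
      = (if w = (x, y, z) then pmf (pU x y z) u else 0)" for w
    proof (cases "w = (x, y, z)")
      case True
      have "pmf (map_pmf (\<lambda>u. ((x, y, z), u)) (pU x y z)) ((x, y, z), u) = pmf (pU x y z) u"
        by (rule pmf_map_inj') (auto simp: inj_on_def)
      then show ?thesis using True by (simp add: map_pmf_def)
    next
      case False
      then show ?thesis by (auto simp: pmf_eq_0_set_pmf)
    qed
    then show ?thesis
      unfolding pmf_bind[of ?p] by (subst integral_measure_pmf[of "{(x, y, z)}"]) (auto split: if_splits)
  qed
  finally show ?thesis by (simp add: pmf_bind_pair)
qed

lemma set_joint_UXYZ: "set_pmf (joint_UXYZ p pZ pU) \<subseteq> (\<Union>x y z. set_pmf (pU x y z)) \<times> UNIV"
  by (auto simp: joint_UXYZ_def) blast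

lemma finite_joint_UXYZ:
  fixes p :: "('x::finite \<times> 'y::finite) pmf" and pZ :: "'x \<Rightarrow> 'y \<Rightarrow> 'z::finite pmf"
  assumes "finite (\<Union>x y z. set_pmf (pU x y z))"
  shows "finite (set_pmf (joint_UXYZ p pZ pU))"
  by (rule finite_subset[OF set_joint_UXYZ]) (use assms in simp)

lemma info_eq_entropies:
  fixes p :: "('x::finite \<times> 'y::finite) pmf" and pZ :: "'x \<Rightarrow> 'y \<Rightarrow> 'z::finite pmf"
  assumes fin: "finite (\<Union>x y z. set_pmf (pU x y z))"
  defines "J \<equiv> joint_UXYZ p pZ pU"
  shows "info_XZ_U_given_Y p pZ pU =
     entropy2 (map_pmf snd J) + entropy2 (map_pmf (\<lambda>(u, x, y, z). (u, y)) J)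
     - entropy2 (map_pmf (\<lambda>(u, x, y, z). y) J) - entropy2 J"
proof -
  have f: "finite (set_pmf J)" unfolding J_def by (rule finite_joint_UXYZ[OF fin])
  have i1: "inj (\<lambda>(x, y, z). ((x, z), y))" and i2: "inj (\<lambda>(u, x, y, z). ((x, z), u, y))"
    by (auto simp: inj_on_def)
  have "map_pmf (\<lambda>(a, b, c). (a, c)) (map_pmf (\<lambda>(u, x, y, z). ((x, z), u, y)) J) = map_pmf (\<lambda>(x, y, z). ((x, z), y)) (map_pmf snd J)"
    by (simp add: pmf.map_comp comp_def case_prod_unfold)
  moreover have "entropy2 (map_pmf (\<lambda>(x, y, z). ((x, z), y)) (map_pmf snd J)) = entropy2 (map_pmf snd J)"
    using f by (intro entropy2_map_inj i1) simp
  moreover have "entropy2 (map_pmf (\<lambda>(u, x, y, z). ((x, z), u, y)) J) = entropy2 J"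
    by (rule entropy2_map_inj[OF f i2])
  ultimately show ?thesis
    unfolding info_XZ_U_given_Y_def cond_mutual_info_def J_def[symmetric]
    by (simp add: pmf.map_comp comp_def case_prod_unfold)
qed

lemma map_joint_UXYZ: "map_pmf (\<lambda>(u, x, y, z). (x, y)) (joint_UXYZ p pZ pU) = p"
proof -
  have "map_pmf (\<lambda>(u, x, y, z). (x, y)) (joint_UXYZ p pZ pU) = bind_pmf p (\<lambda>(x, y). return_pmf (x, y))"
    by (simp add: joint_UXYZ_def map_bind_pmf case_prod_unfold bind_pmf_const)
  then show ?thesis by (simp add: bind_return_pmf')
qed

lemma pmf_map_reindex:
  assumes "finite C" "inj_on g C" "f -` {b} = g ` C"
  shows "pmf (map_pmf f p) b = (\<Sum>c\<in>C. pmf p (g c))"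
  using assms by (simp add: pmf_map measure_measure_pmf_finite sum.reindex)

lemma marginal_UY:
  fixes J :: "('u \<times> 'x::finite \<times> 'y \<times> 'z::finite) pmf"
  shows "pmf (map_pmf (\<lambda>(u, x, y, z). (u, y)) J) (u, y) = (\<Sum>x\<in>UNIV. \<Sum>z\<in>UNIV. pmf J (u, x, y, z))"
proof -
  have "pmf (map_pmf (\<lambda>(u, x, y, z). (u, y)) J) (u, y) = (\<Sum>t\<in>UNIV. pmf J (u, fst t, y, snd t))"
    by (rule pmf_map_reindex) (auto simp: inj_on_def prod_eq_iff image_iff)
  then show ?thesis by (simp add: sum.cartesian_product case_prod_unfold)
qed

lemma markov_chain_UYX_iff:
  fixes J :: "('u \<times> 'x::finite \<times> 'y::finite \<times> 'z::finite) pmf"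
  assumes J: "map_pmf (\<lambda>(u, x, y, z). (x, y)) J = p"
  shows "markov_chain (map_pmf (\<lambda>(u, x, y, z). (u, y, x)) J) \<longleftrightarrow>
    (\<forall>u x y. (\<Sum>z\<in>UNIV. pmf J (u, x, y, z)) * (\<Sum>y\<in>UNIV. pmf p (x, y))
       = (\<Sum>y\<in>UNIV. \<Sum>z\<in>UNIV. pmf J (u, x, y, z)) * pmf p (x, y))"
proof -
  have 1: "pmf (map_pmf (\<lambda>(u, x, y, z). (u, y, x)) J) (u, y, x) = (\<Sum>z\<in>UNIV. pmf J (u, x, y, z))" for u x y
    by (rule pmf_map_reindex) (auto simp: inj_on_def)
  have "pmf (map_pmf (\<lambda>(u, x, y, z). (u, x)) J) (u, x) = (\<Sum>t\<in>UNIV. pmf J (u, x, t))" for u x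
    by (rule pmf_map_reindex) (auto simp: inj_on_def)
  also have "(\<Sum>t\<in>UNIV. pmf J (u, x, t)) = (\<Sum>y\<in>UNIV. \<Sum>z\<in>UNIV. pmf J (u, x, y, z))" for u x
    by (simp add: sum.cartesian_product)
  finally have 2: "pmf (map_pmf (\<lambda>(u, x, y, z). (u, x)) J) (u, x) = (\<Sum>y\<in>UNIV. \<Sum>z\<in>UNIV. pmf J (u, x, y, z))" for u x .
  have "map_pmf (\<lambda>(u, x, y, z). (y, x)) J = map_pmf (\<lambda>(x, y). (y, x)) p"
    by (simp add: J[symmetric] pmf.map_comp comp_def case_prod_unfold)
  moreover have "pmf (map_pmf (\<lambda>(x, y). (y, x)) p) (y, x) = (\<Sum>c\<in>{(x, y)}. pmf p c)" for x y
    by (rule pmf_map_reindex) auto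
  ultimately have 3: "pmf (map_pmf (\<lambda>(u, x, y, z). (y, x)) J) (y, x) = pmf p (x, y)" for x y
    by simp
  have "map_pmf (\<lambda>(u, x, y, z). x) J = map_pmf fst p"
    by (simp add: J[symmetric] pmf.map_comp comp_def case_prod_unfold)
  moreover have "pmf (map_pmf fst p) x = (\<Sum>y\<in>UNIV. pmf p (x, y))" for x
    by (rule pmf_map_reindex) (auto simp: inj_on_def)
  ultimately have 4: "pmf (map_pmf (\<lambda>(u, x, y, z). x) J) x = (\<Sum>y\<in>UNIV. pmf p (x, y))" for x
    by simp
  have c: "map_pmf (\<lambda>(a, b, c). c) (map_pmf (\<lambda>(u, x, y, z). (u, y, x)) J) = map_pmf (\<lambda>(u, x, y, z). x) J"
    "map_pmf (\<lambda>(a, b, c). (a, c)) (map_pmf (\<lambda>(u, x, y, z). (u, y, x)) J) = map_pmf (\<lambda>(u, x, y, z). (u, x)) J"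
    "map_pmf (\<lambda>(a, b, c). (b, c)) (map_pmf (\<lambda>(u, x, y, z). (u, y, x)) J) = map_pmf (\<lambda>(u, x, y, z). (y, x)) J"
    by (simp_all add: pmf.map_comp comp_def case_prod_unfold)
  show ?thesis
    unfolding markov_chain_def c 1 2 3 4 by blast
qed

lemma markov_chain_ZXUY_iff:
  fixes J :: "('u \<times> 'x::finite \<times> 'y::finite \<times> 'z::finite) pmf"
  shows "markov_chain (map_pmf (\<lambda>(u, x, y, z). (z, x, (u, y))) J) \<longleftrightarrow>
    (\<forall>u x y z. pmf J (u, x, y, z) * (\<Sum>x\<in>UNIV. \<Sum>z\<in>UNIV. pmf J (u, x, y, z))
       = (\<Sum>x\<in>UNIV. pmf J (u, x, y, z)) * (\<Sum>z\<in>UNIV. pmf J (u, x, y, z)))"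
proof -
  have "pmf (map_pmf (\<lambda>(u, x, y, z). (z, x, u, y)) J) (z, x, u, y) = (\<Sum>c\<in>{(u, x, y, z)}. pmf J c)" for u x y z
    by (rule pmf_map_reindex) auto
  then have 1: "pmf (map_pmf (\<lambda>(u, x, y, z). (z, x, u, y)) J) (z, x, u, y) = pmf J (u, x, y, z)" for u x y z
    by simp
  have 2: "pmf (map_pmf (\<lambda>(u, x, y, z). (z, u, y)) J) (z, u, y) = (\<Sum>x\<in>UNIV. pmf J (u, x, y, z))" for u y z
    by (rule pmf_map_reindex) (auto simp: inj_on_def)
  have 3: "pmf (map_pmf (\<lambda>(u, x, y, z). (x, u, y)) J) (x, u, y) = (\<Sum>z\<in>UNIV. pmf J (u, x, y, z))" for u x y
    by (rule pmf_map_reindex) (auto simp: inj_on_def)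
  have c: "map_pmf (\<lambda>(a, b, c). c) (map_pmf (\<lambda>(u, x, y, z). (z, x, u, y)) J) = map_pmf (\<lambda>(u, x, y, z). (u, y)) J"
    "map_pmf (\<lambda>(a, b, c). (a, c)) (map_pmf (\<lambda>(u, x, y, z). (z, x, u, y)) J) = map_pmf (\<lambda>(u, x, y, z). (z, u, y)) J"
    "map_pmf (\<lambda>(a, b, c). (b, c)) (map_pmf (\<lambda>(u, x, y, z). (z, x, u, y)) J) = map_pmf (\<lambda>(u, x, y, z). (x, u, y)) J"
    by (simp_all add: pmf.map_comp comp_def case_prod_unfold)
  have "(\<forall>a b c. P a b c) \<longleftrightarrow> (\<forall>u x y z. P z x (u, y))" for P :: "'z \<Rightarrow> 'x \<Rightarrow> 'u \<times> 'y \<Rightarrow> bool"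
    by auto
  then show ?thesis
    unfolding markov_chain_def c by (simp only: 1 marginal_UY 2 3)
qed

text \<open>The chain rule I(U;XYZ) - I(U;Y) = I(XZ;U|Y), verified term by term under the joint law:
  the logarithm of \<open>Q\<close> cancels between the laws of (U,X,Y,Z) and (U,Y).\<close>

lemma (in factored_channel) info_diff_eq:
  fixes J :: "('u \<times> 'x \<times> 'y \<times> 'z) pmf"
  assumes J: "\<And>u x y z. u \<in> A \<Longrightarrow> pmf J (u, x, y, z) = pmf Q u * T u x y z" and JA: "set_pmf J \<subseteq> A \<times> UNIV"
  shows "info_UXYZ - info_UY = entropy2 (map_pmf snd J) + entropy2 (map_pmf (\<lambda>(u, x, y, z). (u, y)) J)
     - entropy2 (map_pmf (\<lambda>(u, x, y, z). y) J) - entropy2 J"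
proof -
  let ?A = "A \<times> (UNIV :: ('x \<times> 'y \<times> 'z) set)"
  have fin: "finite ?A" using finA by simp
  have Mp: "pmf (map_pmf snd J) (x, y, z) = p x y z" for x y z
  proof -
    have "pmf (map_pmf snd J) (x, y, z) = (\<Sum>t\<in>?A. pmf J t * of_bool (snd t = (x, y, z)))"
      by (rule pmf_map_sum[OF fin JA])
    also have "\<dots> = (\<Sum>u\<in>A. \<Sum>w\<in>UNIV. pmf J (u, w) * of_bool (w = (x, y, z)))"
      by (simp only: sum.cartesian_product case_prod_unfold prod.collapse)
    also have "\<dots> = (\<Sum>u\<in>A. \<Sum>w\<in>UNIV. if w = (x, y, z) then pmf J (u, w) else 0)"
      by (intro sum.cong refl) simp
    also have "\<dots> = (\<Sum>u\<in>A. pmf J (u, x, y, z))"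
      by (simp only: sum.delta[OF finite] UNIV_I if_True)
    finally show ?thesis by (simp add: p_def J)
  qed
  have Mv: "pmf (map_pmf (\<lambda>(u, x, y, z). (u, y)) J) (u, y) = pmf Q u * v u y" if "u \<in> A" for u y
    using that by (simp add: marginal_UY J sum_xz_T[symmetric] sum_distrib_left)
  have "map_pmf (\<lambda>(u, x, y, z). y) J = map_pmf (\<lambda>(x, y, z). y) (map_pmf snd J)"
    by (simp add: pmf.map_comp comp_def case_prod_unfold)
  moreover have "pmf (map_pmf (\<lambda>(x, y, z). y) (map_pmf snd J)) y = (\<Sum>t\<in>UNIV. pmf (map_pmf snd J) (fst t, y, snd t))" for y
    by (rule pmf_map_reindex) (auto simp: inj_on_def prod_eq_iff image_iff)
  ultimately have MY: "pmf (map_pmf (\<lambda>(u, x, y, z). y) J) y = pY y" for y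
    by (simp add: Mp sum_xz_p[symmetric] sum.cartesian_product case_prod_unfold)
  have pt: "(case t of (u, x, y, z) \<Rightarrow> pmf Q u * T u x y z * log 2 (T u x y z / p x y z)
        - pmf Q u * T u x y z * log 2 (v u y / pY y))
    = pmf J t * log 2 (pmf J t) - pmf J t * log 2 (pmf (map_pmf snd J) (snd t))
      - pmf J t * log 2 (pmf (map_pmf (\<lambda>(u, x, y, z). (u, y)) J) ((\<lambda>(u, x, y, z). (u, y)) t))
      + pmf J t * log 2 (pmf (map_pmf (\<lambda>(u, x, y, z). y) J) ((\<lambda>(u, x, y, z). y) t))" if t: "t \<in> ?A" for t
  proof -
    obtain u x y z where tt: "t = (u, x, y, z)" by (cases t)
    with t have u: "u \<in> A" by simp
    show ?thesis
    proof (cases "T u x y z = 0")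
      case False
      then have T: "0 < T u x y z" using T_nonneg[of u x y z] by linarith
      note pos = T Q_pos[OF u] p_pos[OF u T] v_pos[OF T] pY_pos[OF u v_pos[OF T]]
      show ?thesis using pos u by (simp add: tt J Mp Mv MY log_mult log_divide algebra_simps)
    qed (simp add: tt J u)
  qed
  have "info_UXYZ - info_UY = (\<Sum>t\<in>?A. case t of (u, x, y, z) \<Rightarrow> pmf Q u * T u x y z * log 2 (T u x y z / p x y z)
        - pmf Q u * T u x y z * log 2 (v u y / pY y))"
    by (simp add: info_UXYZ_def info_UY_eq case_prod_unfold sum_subtractf)
  also have "\<dots> = (\<Sum>t\<in>?A. pmf J t * log 2 (pmf J t) - pmf J t * log 2 (pmf (map_pmf snd J) (snd t))
      - pmf J t * log 2 (pmf (map_pmf (\<lambda>(u, x, y, z). (u, y)) J) ((\<lambda>(u, x, y, z). (u, y)) t))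
      + pmf J t * log 2 (pmf (map_pmf (\<lambda>(u, x, y, z). y) J) ((\<lambda>(u, x, y, z). y) t)))"
    by (rule sum.cong[OF refl pt])
  finally show ?thesis
    unfolding entropy2_map[OF fin JA] entropy2_eq[OF fin JA] eta_def
    by (simp only: sum.distrib sum_subtractf sum_negf)
qed

text \<open>\<open>V\<close>, \<open>W\<close> and \<open>B\<close> are the conditional laws of X
  given U, of Y given X and of Z given (U,Y). In product form, the first Markov condition gives
  P(u,x,y) = Q V W and the second one supplies the factor B. The conditional laws are arbitrary
  where they condition on an event of probability 0, so vanishing terms need an argument of their
  own.\<close>

lemma feasible_U_factored:
  fixes pXY :: "('x::finite \<times> 'y::finite) pmf" and pZ :: "'x \<Rightarrow> 'y \<Rightarrow> 'z::finite pmf"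
  assumes feas: "feasible_U pXY pZ pU"
  shows "\<exists>Q V W B. factored_channel pXY pZ Q V W B \<and>
    (\<forall>u\<in>set_pmf Q. \<forall>x y z. pmf (joint_UXYZ pXY pZ pU) (u, x, y, z) = pmf Q u * (pmf (V u) x * pmf (W x) y * pmf (B u y) z)) \<and>
    set_pmf (joint_UXYZ pXY pZ pU) \<subseteq> set_pmf Q \<times> UNIV"
proof -
  define J where "J = joint_UXYZ pXY pZ pU"
  have fin: "finite (set_pmf J)"
    unfolding J_def using feas by (intro finite_joint_UXYZ) (simp add: feasible_U_def)
  define Q where "Q = map_pmf fst J"
  have JA: "set_pmf J \<subseteq> set_pmf Q \<times> UNIV" by (auto simp: Q_def intro: rev_image_eqI)
  define a where "a u x = (\<Sum>y\<in>UNIV. \<Sum>z\<in>UNIV. pmf J (u, x, y, z))" for u x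
  define px where "px x = (\<Sum>y\<in>UNIV. pmf pXY (x, y))" for x
  define juy where "juy u y = (\<Sum>x\<in>UNIV. \<Sum>z\<in>UNIV. pmf J (u, x, y, z))" for u y
  define juxy where "juxy u x y = (\<Sum>z\<in>UNIV. pmf J (u, x, y, z))" for u x y
  define juyz where "juyz u y z = (\<Sum>x\<in>UNIV. pmf J (u, x, y, z))" for u y z
  have nn: "0 \<le> a u x" "0 \<le> px x" "0 \<le> juy u y" "0 \<le> juxy u x y" "0 \<le> juyz u y z" for u x y z
    by (auto simp: a_def px_def juy_def juxy_def juyz_def intro!: sum_nonneg)
  have M1: "juxy u x y * px x = a u x * pmf pXY (x, y)" for u x y
    using feas markov_chain_UYX_iff[OF map_joint_UXYZ, of pXY pZ pU]
    unfolding feasible_U_def J_def a_def px_def juxy_def by blast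
  have M2: "pmf J (u, x, y, z) * juy u y = juyz u y z * juxy u x y" for u x y z
    using feas markov_chain_ZXUY_iff[of "joint_UXYZ pXY pZ pU"]
    unfolding feasible_U_def J_def juy_def juxy_def juyz_def by blast
  have "pmf Q u = (\<Sum>w\<in>UNIV. pmf J (u, w))" for u
    unfolding Q_def by (rule pmf_map_reindex) (auto simp: inj_on_def)
  then have Qu: "pmf Q u = (\<Sum>x\<in>UNIV. a u x)" for u
    by (simp add: a_def sum.cartesian_product)
  have "\<exists>V. pmf Q u > 0 \<longrightarrow> (\<forall>x\<in>UNIV. pmf V x = a u x / pmf Q u)" for u
    using ex_pmf_of_fun[of UNIV "\<lambda>x. a u x / pmf Q u"] nn
    by (cases "pmf Q u > 0") (auto simp: sum_divide_distrib[symmetric] Qu[symmetric] simp del: UNIV_I)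
  then obtain V where V: "\<And>u x. pmf Q u > 0 \<Longrightarrow> pmf (V u) x = a u x / pmf Q u"
    by (metis UNIV_I)
  have "\<exists>W. px x > 0 \<longrightarrow> (\<forall>y\<in>UNIV. pmf W y = pmf pXY (x, y) / px x)" for x
    using ex_pmf_of_fun[of UNIV "\<lambda>y. pmf pXY (x, y) / px x"] nn
    by (cases "px x > 0") (auto simp: sum_divide_distrib[symmetric] px_def[symmetric] simp del: UNIV_I)
  then obtain W where W: "\<And>x y. px x > 0 \<Longrightarrow> pmf (W x) y = pmf pXY (x, y) / px x"
    by (metis UNIV_I)
  have sz: "(\<Sum>z\<in>UNIV. juyz u y z) = juy u y" for u y
    unfolding juyz_def juy_def by (rule sum.swap)
  have "\<exists>B. juy u y > 0 \<longrightarrow> (\<forall>z\<in>UNIV. pmf B z = juyz u y z / juy u y)" for u y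
    using ex_pmf_of_fun[of UNIV "\<lambda>z. juyz u y z / juy u y"] nn
    by (cases "juy u y > 0") (auto simp: sum_divide_distrib[symmetric] sz simp del: UNIV_I)
  then obtain B where B: "\<And>u y z. juy u y > 0 \<Longrightarrow> pmf (B u y) z = juyz u y z / juy u y"
    by (metis UNIV_I)
  have fac: "pmf J (u, x, y, z) = pmf Q u * (pmf (V u) x * pmf (W x) y * pmf (B u y) z)" if u: "u \<in> set_pmf Q" for u x y z
  proof -
    have Q0: "pmf Q u > 0" using u by (rule pmf_positive)
    have J_le: "pmf J (u, x, y, z) \<le> juxy u x y"
      unfolding juxy_def by (rule member_le_sum) auto
    have xy_le: "juxy u x y \<le> juy u y"
      unfolding juxy_def juy_def by (rule member_le_sum[where f = "\<lambda>x. \<Sum>z\<in>UNIV. pmf J (u, x, y, z)"]) (auto simp: sum_nonneg)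
    have xy_le_a: "juxy u x y \<le> a u x"
      unfolding juxy_def a_def by (rule member_le_sum[where f = "\<lambda>y. \<Sum>z\<in>UNIV. pmf J (u, x, y, z)"]) (auto simp: sum_nonneg)
    have a_le: "a u x \<le> px x"
    proof -
      have "a u x = pmf (map_pmf (\<lambda>(u, x, y, z). (u, x)) J) (u, x)"
        unfolding a_def by (subst pmf_map_reindex[of UNIV "\<lambda>t. (u, x, t)"]) (auto simp: inj_on_def sum.cartesian_product)
      also have "\<dots> \<le> pmf (map_pmf snd (map_pmf (\<lambda>(u, x, y, z). (u, x)) J)) x"
        by (simp add: pmf_map[of snd]) (auto simp: pmf.rep_eq intro!: measure_pmf.finite_measure_mono)
      also have "map_pmf snd (map_pmf (\<lambda>(u, x, y, z). (u, x)) J) = map_pmf fst (map_pmf (\<lambda>(u, x, y, z). (x, y)) J)"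
        by (simp add: pmf.map_comp comp_def case_prod_unfold)
      also have "\<dots> = map_pmf fst pXY" by (simp add: J_def map_joint_UXYZ)
      also have "pmf (map_pmf fst pXY) x = px x"
        unfolding px_def by (rule pmf_map_reindex) (auto simp: inj_on_def)
      finally show ?thesis .
    qed
    show ?thesis
    proof (cases "pmf J (u, x, y, z) = 0")
      case False
      then have "0 < pmf J (u, x, y, z)" by (simp add: less_le)
      then have pos: "0 < juxy u x y" "0 < juy u y" "0 < a u x" "0 < px x"
        using J_le xy_le xy_le_a a_le by linarith+
      have "pmf Q u * (pmf (V u) x * pmf (W x) y * pmf (B u y) z) = (a u x * pmf pXY (x, y) / px x) * (juyz u y z / juy u y)"
        using Q0 pos by (simp add: V W B)
      also have "\<dots> = juxy u x y * juyz u y z / juy u y"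
        unfolding M1[symmetric] using pos by simp
      also have "\<dots> = pmf J (u, x, y, z)"
        using M2[of u x y z] pos by (simp add: field_simps)
      finally show ?thesis by simp
    next
      case True
      \<comment> \<open>If the joint probability is 0, the second Markov condition makes one of the
        factors on its right vanish, and the first condition carries this over to the numerators of
        V W B.\<close>
      have "a u x * pmf pXY (x, y) * juyz u y z = 0"
      proof -
        have "juyz u y z * juxy u x y = 0" using M2[of u x y z] True by simp
        then have "juyz u y z = 0 \<or> juxy u x y = 0" by simp
        then show ?thesis using M1[of u x y] by auto
      qed
      then have "pmf (V u) x * pmf (W x) y * pmf (B u y) z = 0"
      proof (elim mult_eq_0_iff[THEN iffD1, elim_format] disjE)
        assume "a u x = 0" then show ?thesis using V[OF Q0] by simp
      next
        assume 0: "pmf pXY (x, y) = 0"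
        show ?thesis
        proof (cases "px x > 0")
          case False
          then have "a u x = 0" using a_le nn(1)[of u x] by linarith
          then show ?thesis using V[OF Q0] by simp
        qed (simp add: W 0)
      next
        assume 0: "juyz u y z = 0"
        show ?thesis
        proof (cases "juy u y > 0")
          case False
          then have "juxy u x y = 0" using xy_le nn(4)[of u x y] by linarith
          then have "a u x * pmf pXY (x, y) = 0" using M1[of u x y] by simp
          then have "a u x = 0 \<or> pmf pXY (x, y) = 0" by simp
          moreover have "pmf pXY (x, y) = 0 \<Longrightarrow> a u x \<noteq> 0 \<Longrightarrow> pmf (W x) y = 0"
            using a_le nn(1)[of u x] by (subst W) auto
          ultimately show ?thesis using V[OF Q0] by auto
        qed (simp add: B 0)
      qed
      then show ?thesis using True by simp
    qed
  qed
  have "factored_channel pXY pZ Q V W B"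
  proof
    show "finite (set_pmf Q)" using fin by (simp add: Q_def)
    then have finQ: "finite (set_pmf Q \<times> (UNIV :: ('x \<times> 'y \<times> 'z) set))" by simp
    show "pmf pXY (x, y) * pmf (pZ x y) z = (\<Sum>u\<in>set_pmf Q. pmf Q u * (pmf (V u) x * pmf (W x) y * pmf (B u y) z))" for x y z
    proof -
      have "(\<Sum>u\<in>set_pmf Q. pmf Q u * (pmf (V u) x * pmf (W x) y * pmf (B u y) z)) = (\<Sum>u\<in>set_pmf Q. pmf J (u, x, y, z))"
        by (intro sum.cong refl) (simp add: fac)
      also have "\<dots> = pmf pXY (x, y) * pmf (pZ x y) z * (\<Sum>u\<in>set_pmf Q. pmf (pU x y z) u)"
        by (simp add: J_def pmf_joint_UXYZ sum_distrib_left)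
      also have "\<dots> = pmf pXY (x, y) * pmf (pZ x y) z"
      proof (cases "pmf pXY (x, y) * pmf (pZ x y) z = 0")
        case False
        have "set_pmf (pU x y z) \<subseteq> set_pmf Q"
        proof
          fix u assume "u \<in> set_pmf (pU x y z)"
          then have "pmf J (u, x, y, z) \<noteq> 0" using False by (simp add: J_def pmf_joint_UXYZ set_pmf_iff)
          then show "u \<in> set_pmf Q" using JA by (auto simp: set_pmf_iff[of _ J])
        qed
        then have "(\<Sum>u\<in>set_pmf Q. pmf (pU x y z) u) = 1"
          using fin by (intro sum_pmf_eq_1) (auto simp: Q_def)
        then show ?thesis by simp
      qed simp
      finally show ?thesis by simp
    qed
  qed
  then show ?thesis
    using fac JA unfolding J_def by blast
qed

lemma R_NS_le_info:
  fixes pXY :: "('x::finite \<times> 'y::finite) pmf" and pZ :: "'x \<Rightarrow> 'y \<Rightarrow> 'z::finite pmf"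
  assumes feas: "feasible_U pXY pZ pU"
  shows "R_NS pXY pZ \<le> info_XZ_U_given_Y pXY pZ pU" "\<exists>R. achievable pXY pZ R"
proof -
  obtain Q V W B where fc: "factored_channel pXY pZ Q V W B"
    and J: "\<And>u x y z. u \<in> set_pmf Q \<Longrightarrow> pmf (joint_UXYZ pXY pZ pU) (u, x, y, z) = pmf Q u * (pmf (V u) x * pmf (W x) y * pmf (B u y) z)"
    and JA: "set_pmf (joint_UXYZ pXY pZ pU) \<subseteq> set_pmf Q \<times> UNIV"
    using feasible_U_factored[OF feas] by blast
  interpret factored_channel pXY pZ Q V W B by (rule fc)
  have "info_UXYZ - info_UY = info_XZ_U_given_Y pXY pZ pU"
    using info_eq_entropies[of pU pXY pZ] feas info_diff_eq[of "joint_UXYZ pXY pZ pU"] J JA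
    by (simp add: A_def T_def feasible_U_def)
  then show "R_NS pXY pZ \<le> info_XZ_U_given_Y pXY pZ pU"
    using R_NS_le by simp
  show "\<exists>R. achievable pXY pZ R"
    by (rule exI[of _ "info_UXYZ - info_UY + 1"], rule achievable_rate) simp
qed

section \<open>The compact convex set of laws and entropies\<close>

definition prob_simplex :: "(real ^ 'n::finite) set" where
  "prob_simplex = {a. (\<forall>i. 0 \<le> a $ i) \<and> (\<Sum>i\<in>UNIV. a $ i) = 1}"

lemma closed_prob_simplex: "closed prob_simplex"
proof -
  have "prob_simplex = (\<Inter>i. {a. 0 \<le> a $ i}) \<inter> {a :: real ^ 'n. (\<Sum>i\<in>UNIV. a $ i) = 1}"
    by (auto simp: prob_simplex_def)
  also have "closed \<dots>"
    by (intro closed_Int closed_INT ballI closed_Collect_le closed_Collect_eq continuous_intros)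
  finally show ?thesis .
qed

lemma prob_simplex_norm_le: "a \<in> prob_simplex \<Longrightarrow> norm a \<le> 1"
  using norm_le_l1_cart[of a] by (auto simp: prob_simplex_def)

lemma compact_prob_simplex: "compact prob_simplex"
  unfolding compact_eq_bounded_closed
  using closed_prob_simplex prob_simplex_norm_le by (auto simp: bounded_iff)

lemma compact_prob_simplex_rows: "compact {B :: real ^ 'n ^ 'm. \<forall>y. B $ y \<in> prob_simplex}"
  unfolding compact_eq_bounded_closed
proof
  have "norm B \<le> real CARD('m)" if "\<forall>y. B $ y \<in> prob_simplex" for B :: "real ^ 'n ^ 'm"
  proof -
    have "norm B \<le> (\<Sum>y\<in>UNIV. norm (B $ y))"
      unfolding norm_vec_def by (rule L2_set_le_sum) simp
    also have "\<dots> \<le> (\<Sum>y\<in>(UNIV :: 'm set). 1)"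
      using that by (intro sum_mono prob_simplex_norm_le) auto
    finally show ?thesis by simp
  qed
  then show "bounded {B :: real ^ 'n ^ 'm. \<forall>y. B $ y \<in> prob_simplex}"
    by (auto simp: bounded_iff)
  have "{B :: real ^ 'n ^ 'm. \<forall>y. B $ y \<in> prob_simplex} = (\<Inter>y. (\<lambda>B. B $ y) -` prob_simplex)"
    by auto
  also have "closed \<dots>"
    by (intro closed_INT ballI closed_vimage closed_prob_simplex continuous_intros)
  finally show "closed {B :: real ^ 'n ^ 'm. \<forall>y. B $ y \<in> prob_simplex}" .
qed

text \<open>
  These are the possible laws of (X,Y,Z) given a value of U: the first Markov condition forces the
  channel from X to Y to be W, the second one makes Z depend on Y alone.
\<close>
definition chain_law :: "('x::finite \<Rightarrow> 'y::finite pmf) \<Rightarrow> real ^ 'x \<Rightarrow> real ^ 'z::finite ^ 'y \<Rightarrow> real ^ ('x \<times> 'y \<times> 'z)" where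
  "chain_law W a B = (\<chi> t. a $ fst t * pmf (W (fst t)) (fst (snd t)) * B $ fst (snd t) $ snd (snd t))"

text \<open>For a joint law of (X,Y,Z) this is the conditional entropy H(XZ|Y).\<close>
definition cond_ent :: "real ^ ('x::finite \<times> 'y::finite \<times> 'z::finite) \<Rightarrow> real" where
  "cond_ent q = (\<Sum>t\<in>UNIV. eta (q $ t)) - (\<Sum>y\<in>UNIV. eta (\<Sum>x\<in>UNIV. \<Sum>z\<in>UNIV. q $ (x, y, z)))"

text \<open>Mixing such points with weights P(U=u) gives the law of (X,Y,Z) in the first component
  and H(XZ|Y,U) in the second. Hence the fibre of the convex hull above the target lists the values
  of H(XZ|Y,U) for feasible U, and minimising I(XZ;U|Y) means maximising the second
  component.\<close>

definition chain_points :: "('x::finite \<Rightarrow> 'y::finite pmf) \<Rightarrow> ((real ^ ('x \<times> 'y \<times> 'z::finite)) \<times> real) set" where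
  "chain_points W = (\<lambda>(a, B). (chain_law W a B, cond_ent (chain_law W a B))) `
     (prob_simplex \<times> {B. \<forall>y. B $ y \<in> prob_simplex})"

lemma chain_law_nonneg:
  "a \<in> prob_simplex \<Longrightarrow> (\<And>y. B $ y \<in> prob_simplex) \<Longrightarrow> 0 \<le> chain_law W a B $ t"
  by (simp add: chain_law_def prob_simplex_def)

text \<open>Laws on the boundary of the simplex are included, so continuity of \<open>eta\<close> at
  0 is essential.\<close>

lemma compact_chain_points: "compact (chain_points W)"
  unfolding chain_points_def
proof (rule compact_continuous_image)
  let ?D = "prob_simplex \<times> {B :: real ^ 'c ^ 'b. \<forall>y. B $ y \<in> prob_simplex}"
  let ?l = "\<lambda>ab :: (real ^ 'a) \<times> (real ^ 'c ^ 'b). chain_law W (fst ab) (snd ab)"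
  have cl: "continuous_on ?D ?l"
    unfolding chain_law_def by (intro continuous_on_vec_lambda continuous_intros)
  have nn: "0 \<le> ?l ab $ t" if "ab \<in> ?D" for ab t
    using that by (auto intro!: chain_law_nonneg)
  have ce: "continuous_on ?D (\<lambda>ab. eta (f ab))" if "continuous_on ?D f" "\<And>ab. ab \<in> ?D \<Longrightarrow> 0 \<le> f ab" for f :: "_ \<Rightarrow> real"
    using that by (intro continuous_on_compose2[OF continuous_on_eta]) auto
  have "continuous_on ?D (\<lambda>ab. cond_ent (?l ab))"
    unfolding cond_ent_def by (intro continuous_intros ce cl nn sum_nonneg)
  then show "continuous_on ?D (\<lambda>(a, B). (chain_law W a B, cond_ent (chain_law W a B)))"
    using cl by (simp add: case_prod_unfold continuous_on_Pair)
  show "compact ?D"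
    by (intro compact_Times compact_prob_simplex compact_prob_simplex_rows)
qed

lemma compact_hull_chain_points: "compact (convex hull (chain_points W))"
  by (rule compact_convex_hull[OF compact_chain_points])

lemma sum_triple: "(\<Sum>t\<in>UNIV. F t) = (\<Sum>y\<in>UNIV. \<Sum>x\<in>UNIV. \<Sum>z\<in>UNIV. F (x, y, z))"
  for F :: "'x::finite \<times> 'y::finite \<times> 'z::finite \<Rightarrow> 'b::comm_monoid_add"
  by (subst sum.swap) (simp add: sum.cartesian_product)

text \<open>Homogeneity of degree 1: in both sums the term with \<open>eta c\<close> is the total
  mass times \<open>eta c\<close>, and the two cancel. Thus the subprobabilities P(U=u, .) can stand
  in for conditional laws.\<close>

lemma scale_cond_ent:
  assumes "\<And>t. 0 \<le> q $ t" "0 \<le> c"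
  shows "c * cond_ent q = (\<Sum>t\<in>UNIV. eta (c * q $ t)) - (\<Sum>y\<in>UNIV. eta (c * (\<Sum>x\<in>UNIV. \<Sum>z\<in>UNIV. q $ (x, y, z))))"
proof -
  have "(\<Sum>t\<in>UNIV. eta (c * q $ t)) = c * (\<Sum>t\<in>UNIV. eta (q $ t)) + (\<Sum>t\<in>UNIV. q $ t) * eta c"
    using assms by (simp add: eta_mult sum.distrib sum_distrib_left sum_distrib_right)
  moreover have "(\<Sum>y\<in>UNIV. eta (c * (\<Sum>x\<in>UNIV. \<Sum>z\<in>UNIV. q $ (x, y, z))))
    = c * (\<Sum>y\<in>UNIV. eta (\<Sum>x\<in>UNIV. \<Sum>z\<in>UNIV. q $ (x, y, z))) + (\<Sum>y\<in>UNIV. \<Sum>x\<in>UNIV. \<Sum>z\<in>UNIV. q $ (x, y, z)) * eta c"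
    using assms by (simp only: eta_mult sum_nonneg sum.distrib sum_distrib_left[symmetric] sum_distrib_right[symmetric])
  ultimately show ?thesis
    by (simp add: cond_ent_def sum_triple[of "\<lambda>t. q $ t"] right_diff_distrib)
qed

definition target_vec :: "('x::finite \<times> 'y::finite) pmf \<Rightarrow> ('x \<Rightarrow> 'y \<Rightarrow> 'z::finite pmf) \<Rightarrow> real ^ ('x \<times> 'y \<times> 'z)" where
  "target_vec p pZ = (\<chi> t. pmf p (fst t, fst (snd t)) * pmf (pZ (fst t) (fst (snd t))) (snd (snd t)))"

lemma target_vec_nth: "target_vec p pZ $ (x, y, z) = pmf p (x, y) * pmf (pZ x y) z"
  by (simp add: target_vec_def)

text \<open>The choice U = X: each point has a point mass for X and the channel \<open>pZ x\<close>.
  It shows that the fibre above the target is not empty.\<close>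

lemma target_in_hull:
  fixes pXY :: "('x::finite \<times> 'y::finite) pmf" and pZ :: "'x \<Rightarrow> 'y \<Rightarrow> 'z::finite pmf"
  assumes W: "\<And>x y. pmf pXY (x, y) = pmf (map_pmf fst pXY) x * pmf (W x) y"
  shows "\<exists>h. (target_vec pXY pZ, h) \<in> convex hull (chain_points W)"
proof -
  let ?px = "pmf (map_pmf fst pXY)"
  define q where "q x = chain_law W (axis x 1) (\<chi> y z. pmf (pZ x y) z)" for x
  have "(q x, cond_ent (q x)) \<in> chain_points W" for x
    unfolding chain_points_def q_def
    by (rule image_eqI[where x = "(axis x 1, \<chi> y z. pmf (pZ x y) z)"])
      (auto simp: prob_simplex_def axis_def sum_pmf_UNIV sum_pmf_eq_1)
  then have "(\<Sum>x\<in>UNIV. ?px x *\<^sub>R (q x, cond_ent (q x))) \<in> convex hull (chain_points W)"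
    by (intro convex_sum hull_inc convex_convex_hull) (auto simp: sum_pmf_eq_1)
  moreover have "(\<Sum>x\<in>UNIV. ?px x *\<^sub>R (q x, cond_ent (q x))) = (target_vec pXY pZ, \<Sum>x\<in>UNIV. ?px x * cond_ent (q x))"
  proof -
    have "(\<Sum>x\<in>UNIV. ?px x *\<^sub>R q x) $ (x', y, z) = target_vec pXY pZ $ (x', y, z)" for x' y z
    proof -
      have "(\<Sum>x\<in>UNIV. ?px x *\<^sub>R q x) $ (x', y, z) = (\<Sum>x\<in>UNIV. if x = x' then ?px x * pmf (W x) y * pmf (pZ x y) z else 0)"
        by (simp only: sum_component vector_scaleR_component, intro sum.cong refl) (auto simp: q_def chain_law_def axis_def)
      then show ?thesis by (simp add: target_vec_nth W)
    qed
    then show ?thesis by (auto simp: scaleR_Pair sum_prod vec_eq_iff)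
  qed
  ultimately show ?thesis by auto
qed

text \<open>The weights of the convex combination are the law of U, each point supplies the
  conditional law of (X,Y,Z), and \<open>pU\<close> is the posterior of U. Caratheodory's number of
  points is one more than the dimension, hence the 2 in the alphabet size.\<close>

lemma hull_point_feasible:
  fixes pXY :: "('x::finite \<times> 'y::finite) pmf" and pZ :: "'x \<Rightarrow> 'y \<Rightarrow> 'z::finite pmf"
  assumes W: "\<And>x y. pmf pXY (x, y) = pmf (map_pmf fst pXY) x * pmf (W x) y"
    and h: "(target_vec pXY pZ, h) \<in> convex hull (chain_points W)"
  shows "\<exists>pU. feasible_U pXY pZ pU \<and> (\<forall>x y z. set_pmf (pU x y z) \<subseteq> {0..<CARD('x) * CARD('y) * CARD('z) + 2}) \<and>
     info_XZ_U_given_Y pXY pZ pU = cond_ent (target_vec pXY pZ) - h"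
proof -
  let ?p = "target_vec pXY pZ"
  have dim: "DIM((real ^ ('x \<times> 'y \<times> 'z)) \<times> real) + 1 = CARD('x) * CARD('y) * CARD('z) + 2"
    by simp
  from h[unfolded caratheodory[of "chain_points W"]]
  obtain F where F: "finite F" "F \<subseteq> chain_points W" "card F \<le> CARD('x) * CARD('y) * CARD('z) + 2" "(?p, h) \<in> convex hull F"
    unfolding dim by auto
  from F(4) obtain w0 where w0: "\<And>s. s \<in> F \<Longrightarrow> 0 \<le> w0 s" "sum w0 F = 1" "(\<Sum>s\<in>F. w0 s *\<^sub>R s) = (?p, h)"
    unfolding convex_hull_finite[OF F(1)] by auto
  define N where "N = card F"
  obtain e where e: "bij_betw e {0..<N} F"
    using ex_bij_betw_nat_finite[OF F(1)] unfolding N_def by blast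
  define w where "w u = w0 (e u)" for u
  have eF: "e u \<in> F" if "u < N" for u using bij_betwE[OF e] that by auto
  have reidx: "(\<Sum>u<N. G (e u)) = sum G F" for G :: "_ \<Rightarrow> 'c::comm_monoid_add"
    using sum.reindex_bij_betw[OF e, of G] by (simp add: atLeast0LessThan)
  have w: "\<And>u. u < N \<Longrightarrow> 0 \<le> w u" using w0 eF by (simp add: w_def)
  have "\<exists>a B. a \<in> prob_simplex \<and> (\<forall>y. B $ y \<in> prob_simplex) \<and> e u = (chain_law W a B, cond_ent (chain_law W a B))" if "u < N" for u
  proof -
    have "e u \<in> chain_points W" using F(2) eF[OF that] by auto
    then show ?thesis unfolding chain_points_def by auto
  qed
  then obtain a B where aB: "\<And>u. u < N \<Longrightarrow> a u \<in> prob_simplex" "\<And>u y. u < N \<Longrightarrow> B u $ y \<in> prob_simplex"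
    "\<And>u. u < N \<Longrightarrow> e u = (chain_law W (a u) (B u), cond_ent (chain_law W (a u) (B u)))"
    by metis
  define l where "l u = chain_law W (a u) (B u)" for u
  have l_nth: "l u $ (x, y, z) = a u $ x * pmf (W x) y * B u $ y $ z" for u x y z
    by (simp add: l_def chain_law_def)
  have l0: "0 \<le> l u $ t" if "u < N" for u t
    unfolding l_def using aB that by (intro chain_law_nonneg) auto
  have "(\<Sum>u<N. w u *\<^sub>R e u) = (?p, h)"
    unfolding w_def reidx[of "\<lambda>s. w0 s *\<^sub>R s"] by (rule w0)
  then have "(\<Sum>u<N. w u *\<^sub>R (l u, cond_ent (l u))) = (?p, h)"
    using aB(3) by (simp add: l_def)
  then have pv: "(\<Sum>u<N. w u *\<^sub>R l u) = ?p" and hv: "(\<Sum>u<N. w u * cond_ent (l u)) = h"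
    by (auto simp: scaleR_Pair sum_prod)
  have pt: "(\<Sum>u<N. w u * l u $ t) = ?p $ t" for t
    unfolding pv[symmetric] by simp
  have zero: "w u * l u $ t = 0" if "?p $ t = 0" "u < N" for u t
  proof -
    have "(\<Sum>u<N. w u * l u $ t) = 0" using pt[of t] that by simp
    then have "\<forall>u\<in>{..<N}. w u * l u $ t = 0"
      using w l0 by (subst (asm) sum_nonneg_eq_0_iff) auto
    then show ?thesis using that by simp
  qed
  have N0: "N > 0" using w0(2) F(1) unfolding N_def by (auto simp: card_gt_0_iff)
  \<comment> \<open>The posterior of U by Bayes' rule. At triples of target probability 0 all
    products on the right vanish, and the value 0 is a legal default as
    \<open>N > 0\<close>.\<close>
  have ex: "\<exists>P. set_pmf P \<subseteq> {..<N} \<and> (\<forall>u<N. ?p $ (x, y, z) * pmf P u = w u * l u $ (x, y, z))" for x y z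
  proof (cases "?p $ (x, y, z) = 0")
    case True
    then show ?thesis using zero N0 by (intro exI[of _ "return_pmf 0"]) auto
  next
    case False
    have "0 \<le> ?p $ (x, y, z)" by (simp add: target_vec_nth)
    then have "\<exists>P. set_pmf P \<subseteq> {..<N} \<and> (\<forall>u\<in>{..<N}. pmf P u = w u * l u $ (x, y, z) / ?p $ (x, y, z))"
      using w l0 False by (intro ex_pmf_of_fun) (auto simp: sum_divide_distrib[symmetric] pt)
    then show ?thesis using False by auto
  qed
  then obtain pU where pU: "\<And>x y z. set_pmf (pU x y z) \<subseteq> {..<N}"
    "\<And>x y z u. u < N \<Longrightarrow> ?p $ (x, y, z) * pmf (pU x y z) u = w u * l u $ (x, y, z)"
    by metis
  define J where "J = joint_UXYZ pXY pZ pU"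
  \<comment> \<open>The weights are extended by 0, because in the Markov conditions U ranges over
    all natural numbers.\<close>
  define c where "c u = (if u < N then w u else 0)" for u
  have J: "pmf J (u, x, y, z) = c u * l u $ (x, y, z)" for u x y z
  proof (cases "u < N")
    case True
    then show ?thesis using pU(2)[OF True, of x y z] by (simp add: J_def pmf_joint_UXYZ target_vec_nth c_def)
  next
    case False
    then have "u \<notin> set_pmf (pU x y z)" using pU(1)[of x y z] by auto
    then show ?thesis using False by (simp add: J_def pmf_joint_UXYZ c_def set_pmf_iff)
  qed
  have fin: "finite (\<Union>x y z. set_pmf (pU x y z))"
    by (rule finite_subset[of _ "{..<N}"]) (use pU in auto)
  have suma: "(\<Sum>x\<in>UNIV. a u $ x) = 1" and sumB: "(\<Sum>z\<in>UNIV. B u $ y $ z) = 1" if "u < N" for u y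
    using aB(1,2)[OF that] by (auto simp: prob_simplex_def)
  have Wsum: "(\<Sum>y\<in>UNIV. pmf (W x) y) = 1" for x by (rule sum_pmf_eq_1) auto
  have cB: "c u * (\<Sum>z\<in>UNIV. B u $ y $ z) = c u" for u y
    using sumB[of u y] by (auto simp: c_def)
  have Jz: "(\<Sum>z\<in>UNIV. pmf J (u, x, y, z)) = c u * a u $ x * pmf (W x) y" for u x y
  proof -
    have "(\<Sum>z\<in>UNIV. pmf J (u, x, y, z)) = (c u * (\<Sum>z\<in>UNIV. B u $ y $ z)) * (a u $ x * pmf (W x) y)"
      by (simp add: J l_nth sum_distrib_left sum_distrib_right ac_simps)
    then show ?thesis by (simp add: cB)
  qed
  have Jmap: "map_pmf (\<lambda>(u, x, y, z). (x, y)) J = pXY" by (simp add: J_def map_joint_UXYZ)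
  have "feasible_U pXY pZ pU"
    unfolding feasible_U_def J_def[symmetric] markov_chain_UYX_iff[OF Jmap] markov_chain_ZXUY_iff
  proof (intro conjI allI)
    show "finite (\<Union>x y z. set_pmf (pU x y z))" by (rule fin)
    fix u x y
    have "(\<Sum>y\<in>UNIV. \<Sum>z\<in>UNIV. pmf J (u, x, y, z)) = c u * a u $ x"
      unfolding Jz by (simp add: Wsum flip: sum_distrib_left)
    moreover have "(\<Sum>y\<in>UNIV. pmf pXY (x, y)) = pmf (map_pmf fst pXY) x"
      unfolding W by (simp add: Wsum flip: sum_distrib_left)
    ultimately show "(\<Sum>z\<in>UNIV. pmf J (u, x, y, z)) * (\<Sum>y\<in>UNIV. pmf pXY (x, y)) = (\<Sum>y\<in>UNIV. \<Sum>z\<in>UNIV. pmf J (u, x, y, z)) * pmf pXY (x, y)"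
      unfolding Jz W[of x y] by simp
  next
    fix u x y z
    define k where "k = (\<Sum>x\<in>UNIV. a u $ x * pmf (W x) y)"
    have e1: "(\<Sum>x\<in>UNIV. \<Sum>z\<in>UNIV. pmf J (u, x, y, z)) = c u * k"
      unfolding Jz k_def by (simp add: sum_distrib_left mult.assoc)
    have e2: "(\<Sum>x\<in>UNIV. pmf J (u, x, y, z)) = c u * k * B u $ y $ z"
      by (simp add: J l_nth k_def sum_distrib_left sum_distrib_right mult.assoc)
    show "pmf J (u, x, y, z) * (\<Sum>x\<in>UNIV. \<Sum>z\<in>UNIV. pmf J (u, x, y, z)) = (\<Sum>x\<in>UNIV. pmf J (u, x, y, z)) * (\<Sum>z\<in>UNIV. pmf J (u, x, y, z))"
      unfolding e1 unfolding e2 Jz unfolding J l_nth by simp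
  qed
  moreover have "set_pmf (pU x y z) \<subseteq> {0..<CARD('x) * CARD('y) * CARD('z) + 2}" for x y z
    using pU(1)[of x y z] F(3) unfolding N_def by fastforce
  moreover have "info_XZ_U_given_Y pXY pZ pU = cond_ent ?p - h"
  proof -
    let ?A = "{..<N} \<times> (UNIV :: ('x \<times> 'y \<times> 'z) set)"
    have JA: "set_pmf J \<subseteq> ?A" unfolding J_def using set_joint_UXYZ[of pXY pZ pU] pU(1) by fastforce
    have fA: "finite ?A" by simp
    have "(\<Sum>t\<in>UNIV. eta (pmf (map_pmf snd J) t)) = (\<Sum>t\<in>UNIV. eta (?p $ t))"
    proof (rule sum.cong[OF refl], rule arg_cong[where f = eta])
      fix t :: "'x \<times> 'y \<times> 'z"
      have "pmf (map_pmf snd J) t = (\<Sum>u<N. \<Sum>s\<in>UNIV. if s = t then pmf J (u, s) else 0)"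
        unfolding pmf_map_sum[OF fA JA] sum.cartesian_product by (intro sum.cong) auto
      also have "\<dots> = (\<Sum>u<N. w u * l u $ t)"
        by (cases t) (simp add: J c_def)
      finally show "pmf (map_pmf snd J) t = ?p $ t" by (simp add: pt)
    qed
    then have H1: "entropy2 (map_pmf snd J) = (\<Sum>t\<in>UNIV. eta (?p $ t))"
      by (simp add: entropy2_eq[of UNIV])
    have MY: "pmf (map_pmf (\<lambda>(u, x, y, z). y) J) y = (\<Sum>x\<in>UNIV. \<Sum>z\<in>UNIV. ?p $ (x, y, z))" for y
    proof -
      have "map_pmf (\<lambda>(u, x, y, z). y) J = map_pmf snd (map_pmf (\<lambda>(u, x, y, z). (x, y)) J)"
        by (simp add: pmf.map_comp comp_def case_prod_unfold)
      also have "\<dots> = map_pmf snd pXY" by (simp add: J_def map_joint_UXYZ)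
      also have "pmf \<dots> y = (\<Sum>x\<in>UNIV. pmf pXY (x, y))"
        by (rule pmf_map_reindex) (auto simp: inj_on_def)
      finally show ?thesis by (simp add: target_vec_nth sum_pmf_eq_1 flip: sum_distrib_left)
    qed
    have H2: "entropy2 (map_pmf (\<lambda>(u, x, y, z). y) J) = (\<Sum>y\<in>UNIV. eta (\<Sum>x\<in>UNIV. \<Sum>z\<in>UNIV. ?p $ (x, y, z)))"
      by (simp add: entropy2_eq[of UNIV] MY)
    have H3: "entropy2 J = (\<Sum>u<N. \<Sum>t\<in>UNIV. eta (w u * l u $ t))"
    proof -
      have "entropy2 J = (\<Sum>u<N. \<Sum>t\<in>UNIV. eta (pmf J (u, t)))"
        unfolding entropy2_eq[OF fA JA] by (simp add: sum.cartesian_product case_prod_unfold)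
      also have "\<dots> = (\<Sum>u<N. \<Sum>t\<in>UNIV. eta (w u * l u $ t))"
        by (intro sum.cong refl arg_cong[where f = eta]) (auto simp: J c_def)
      finally show ?thesis .
    qed
    have MUY: "pmf (map_pmf (\<lambda>(u, x, y, z). (u, y)) J) (u, y) = w u * (\<Sum>x\<in>UNIV. \<Sum>z\<in>UNIV. l u $ (x, y, z))" if "u < N" for u y
      using that by (simp add: marginal_UY J c_def sum_distrib_left)
    have H4: "entropy2 (map_pmf (\<lambda>(u, x, y, z). (u, y)) J) = (\<Sum>u<N. \<Sum>y\<in>UNIV. eta (w u * (\<Sum>x\<in>UNIV. \<Sum>z\<in>UNIV. l u $ (x, y, z))))"
    proof -
      have "set_pmf (map_pmf (\<lambda>(u, x, y, z). (u, y)) J) \<subseteq> {..<N} \<times> UNIV" using JA by auto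
      then have "entropy2 (map_pmf (\<lambda>(u, x, y, z). (u, y)) J) = (\<Sum>u<N. \<Sum>y\<in>UNIV. eta (pmf (map_pmf (\<lambda>(u, x, y, z). (u, y)) J) (u, y)))"
        by (subst entropy2_eq[of "{..<N} \<times> UNIV"]) (simp_all add: sum.cartesian_product case_prod_unfold)
      then show ?thesis by (simp add: MUY)
    qed
    have "h = (\<Sum>u<N. (\<Sum>t\<in>UNIV. eta (w u * l u $ t)) - (\<Sum>y\<in>UNIV. eta (w u * (\<Sum>x\<in>UNIV. \<Sum>z\<in>UNIV. l u $ (x, y, z)))))"
      unfolding hv[symmetric] using w l0 by (intro sum.cong refl scale_cond_ent) auto
    then show ?thesis
      unfolding info_eq_entropies[OF fin] J_def[symmetric] H1 H2 H3 H4 cond_ent_def by (simp add: sum_subtractf)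
  qed
  ultimately show ?thesis by blast
qed

section \<open>Converse\<close>

lemma eta_sum_le:
  fixes f :: "'a \<Rightarrow> real"
  assumes "finite A" "\<And>a. a \<in> A \<Longrightarrow> 0 \<le> f a"
  shows "eta (sum f A) \<le> (\<Sum>a\<in>A. eta (f a))"
  using assms
proof (induction A rule: finite_induct)
  case (insert a A)
  then have "eta (f a + sum f A) \<le> eta (f a) + eta (sum f A)"
    by (intro eta_add_le sum_nonneg) auto
  with insert show ?case by simp
qed simp

text \<open>Exchanging the letter at position q with the spare letter is an involution. After the
  exchange the spare letter is free, whence the factor \<open>CARD('y)\<close>.\<close>

lemma sum_nlists_update:
  fixes G :: "'y::finite \<Rightarrow> 'y list \<Rightarrow> real"
  assumes q: "q < n"
  shows "(\<Sum>ys\<in>nlists n UNIV. \<Sum>y\<in>UNIV. G y (ys[q := y])) = real CARD('y) * (\<Sum>ys\<in>nlists n UNIV. G (ys ! q) ys)"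
proof -
  let ?S = "nlists n (UNIV :: 'y set) \<times> (UNIV :: 'y set)"
  let ?f = "\<lambda>(ys, y). (ys[q := y], ys ! q)"
  have "(\<Sum>ys\<in>nlists n UNIV. \<Sum>y\<in>UNIV. G y (ys[q := y])) = (\<Sum>s\<in>?S. G (snd s) ((fst s)[q := snd s]))"
    by (simp add: sum.cartesian_product case_prod_unfold)
  also have "\<dots> = (\<Sum>s\<in>?S. G (fst s ! q) (fst s))"
    by (rule sum.reindex_bij_witness[where i = ?f and j = ?f]) (auto simp: in_nlists_UNIV q)
  also have "\<dots> = (\<Sum>ys\<in>nlists n UNIV. \<Sum>y\<in>(UNIV :: 'y set). G (ys ! q) ys)"
    by (simp only: sum.cartesian_product case_prod_unfold)
  also have "\<dots> = real CARD('y) * (\<Sum>ys\<in>nlists n UNIV. G (ys ! q) ys)"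
    by (simp add: sum_distrib_left)
  finally show ?thesis .
qed

lemma sum_by_value:
  fixes f :: "'a \<Rightarrow> real" and g :: "'b::finite \<Rightarrow> real"
  shows "(\<Sum>x\<in>UNIV. (\<Sum>a\<in>L. of_bool (h a = x) * f a) * g x) = (\<Sum>a\<in>L. f a * g (h a))"
proof -
  have "(\<Sum>x\<in>UNIV. (\<Sum>a\<in>L. of_bool (h a = x) * f a) * g x) = (\<Sum>x\<in>UNIV. \<Sum>a\<in>L. of_bool (h a = x) * f a * g x)"
    by (simp only: sum_distrib_right)
  also have "\<dots> = (\<Sum>a\<in>L. \<Sum>x\<in>UNIV. of_bool (h a = x) * f a * g x)"
    by (rule sum.swap)
  also have "\<dots> = (\<Sum>a\<in>L. \<Sum>x\<in>UNIV. if h a = x then f a * g x else 0)"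
    by (intro sum.cong refl) simp
  finally show ?thesis by simp
qed

lemma sum_nlists_zip3:
  "(\<Sum>xs\<in>nlists n B. \<Sum>ys\<in>nlists n C. \<Sum>zs\<in>nlists n D. F xs ys zs)
   = (\<Sum>ts\<in>nlists n (B \<times> C \<times> D). F (map fst ts) (map (\<lambda>t. fst (snd t)) ts) (map (\<lambda>t. snd (snd t)) ts))"
proof -
  have 1: "(\<Sum>ys\<in>nlists n C. \<Sum>zs\<in>nlists n D. F xs ys zs)
      = (\<Sum>ws\<in>nlists n (C \<times> D). F xs (map fst ws) (map snd ws))" for xs
    by (rule sum_nlists_zip[where F = "F xs", symmetric])
  show ?thesis
    unfolding 1
    using sum_nlists_zip[where F = "\<lambda>xs ws. F xs (map fst ws) (map snd ws)", of n B "C \<times> D", symmetric]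
    by (simp add: comp_def)
qed

lemma sum_nlists_marginal:
  fixes p g :: "'a::finite \<Rightarrow> real"
  assumes p: "sum p UNIV = 1" and q: "q < n"
  shows "(\<Sum>ts\<in>nlists n UNIV. (\<Prod>i<n. p (ts ! i)) * g (ts ! q)) = (\<Sum>a\<in>UNIV. p a * g a)"
proof -
  have "(\<Sum>ts\<in>nlists n UNIV. (\<Prod>i<n. p (ts ! i)) * g (ts ! q))
    = (\<Sum>ts\<in>nlists n UNIV. \<Prod>i<n. p (ts ! i) * (if i = q then g (ts ! i) else 1))"
    using q by (simp add: prod.distrib)
  also have "\<dots> = (\<Prod>i<n. \<Sum>a\<in>UNIV. p a * (if i = q then g a else 1))"
    by (rule sum_prod_nlists) simp
  also have "\<dots> = (\<Prod>i<n. if i = q then \<Sum>a\<in>UNIV. p a * g a else 1)"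
    using p by (intro prod.cong) auto
  finally show ?thesis using q by simp
qed

text \<open>The entropy of an i.i.d. word. A word of probability 0 contributes 0 on both sides;
  otherwise the logarithm of the product is a sum.\<close>

lemma sum_eta_nlists:
  fixes p :: "'a::finite \<Rightarrow> real"
  assumes p: "sum p UNIV = 1" "\<And>a. 0 \<le> p a"
  shows "(\<Sum>ts\<in>nlists n UNIV. eta (\<Prod>i<n. p (ts ! i))) = real n * (\<Sum>a\<in>UNIV. eta (p a))"
proof -
  have "eta (\<Prod>i<n. p (ts ! i)) = - ((\<Prod>i<n. p (ts ! i)) * (\<Sum>i<n. log 2 (p (ts ! i))))" for ts
  proof (cases "(\<Prod>i<n. p (ts ! i)) = 0")
    case False
    then have "p (ts ! i) \<noteq> 0" if "i < n" for i using that by (auto simp: prod_zero_iff)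
    then have "ln (\<Prod>i<n. p (ts ! i)) = (\<Sum>i<n. ln (p (ts ! i)))" by (intro ln_prod) auto
    then show ?thesis by (simp add: eta_def log_def sum_divide_distrib)
  qed (simp only: mult_zero_left eta_0 minus_zero)
  then have "(\<Sum>ts\<in>nlists n UNIV. eta (\<Prod>i<n. p (ts ! i)))
    = - (\<Sum>ts\<in>nlists n UNIV. (\<Prod>i<n. p (ts ! i)) * (\<Sum>i<n. log 2 (p (ts ! i))))"
    by (simp add: sum_negf)
  also have "\<dots> = - (real n * (\<Sum>a\<in>UNIV. p a * log 2 (p a)))"
    by (subst sum_nlists_additive) (use p in auto)
  finally show ?thesis by (simp add: eta_def sum_negf)
qed

section \<open>A block code, its single-letter laws and its auxiliary variable\<close>

locale block_code =
  fixes pXY :: "('x::finite \<times> 'y::finite) pmf" and W :: "'x \<Rightarrow> 'y pmf"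
    and n K :: nat and enc :: "'x list \<Rightarrow> nat pmf" and dec :: "nat \<Rightarrow> 'y list \<Rightarrow> 'z::finite list pmf"
  assumes n: "n > 0" and K: "K > 0"
    and W: "\<And>x y. pmf pXY (x, y) = pmf (map_pmf fst pXY) x * pmf (W x) y"
    and enc: "\<And>xs. set_pmf (enc xs) \<subseteq> {1..K}"
    and dec: "\<And>m ys. set_pmf (dec m ys) \<subseteq> nlists n UNIV"
begin

abbreviation "LX \<equiv> nlists n (UNIV :: 'x set)"
abbreviation "LY \<equiv> nlists n (UNIV :: 'y set)"
abbreviation "LZ \<equiv> nlists n (UNIV :: 'z set)"

text \<open>
  In r the factor W(y_q|x_q) is left out, hence Aq does not depend on ys ! q. The value
  Pq q m ys x z is the probability of M = m, Y^n = ys, X_q = x, Z_q = z, and Pm m ys that of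
  M = m, Y^n = ys.
\<close>
definition "pn xs ys = (\<Prod>i<n. pmf pXY (xs ! i, ys ! i))"
definition "r q xs ys = pmf (map_pmf fst pXY) (xs ! q) * (\<Prod>i\<in>{..<n} - {q}. pmf pXY (xs ! i, ys ! i))"
definition "P xs m ys zs = pn xs ys * pmf (enc xs) m * pmf (dec m ys) zs"
definition "Pc xs ys zs = (\<Sum>m\<in>{1..K}. P xs m ys zs)"
definition "Aq q m ys x = (\<Sum>xs\<in>LX. of_bool (xs ! q = x) * (r q xs ys * pmf (enc xs) m))"
definition "Bq q m ys z = (\<Sum>zs\<in>LZ. of_bool (zs ! q = z) * pmf (dec m ys) zs)"
definition "Pq q m ys x z = Aq q m ys x * pmf (W x) (ys ! q) * Bq q m ys z"
definition "Pm m ys = (\<Sum>xs\<in>LX. pn xs ys * pmf (enc xs) m)"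
definition "pY y = (\<Sum>x\<in>UNIV. pmf pXY (x, y))"

lemma finL: "finite LX" "finite LY" "finite LZ"
  by (simp_all add: finite_nlists)

lemma sum_dec: "(\<Sum>zs\<in>LZ. pmf (dec m ys) zs) = 1"
  by (rule sum_pmf_eq_1[OF finL(3) dec])

lemma sum_enc: "(\<Sum>m\<in>{1..K}. pmf (enc xs) m) = 1"
  by (rule sum_pmf_eq_1[OF _ enc]) simp

lemma sum_W: "(\<Sum>y\<in>UNIV. pmf (W x) y) = 1"
  by (rule sum_pmf_eq_1) auto

lemma pn_eq: "q < n \<Longrightarrow> pn xs ys = r q xs ys * pmf (W (xs ! q)) (ys ! q)"
  unfolding pn_def r_def by (subst prod.remove[of _ q]) (auto simp: W)

lemma r_update: "r q xs (ys[q := y]) = r q xs ys"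
  unfolding r_def by (intro arg_cong2[where f = "(*)"] refl prod.cong) auto

lemma Aq_update: "Aq q m (ys[q := y]) x = Aq q m ys x"
  by (simp add: Aq_def r_update)

lemma nonneg: "0 \<le> pn xs ys" "0 \<le> r q xs ys" "0 \<le> P xs m ys zs" "0 \<le> Pc xs ys zs" "0 \<le> Aq q m ys x"
  "0 \<le> Bq q m ys z" "0 \<le> Pq q m ys x z" "0 \<le> Pm m ys" "0 \<le> pY y"
proof -
  show 1: "0 \<le> pn xs ys" and 2: "0 \<le> r q xs ys" for xs ys q
    by (auto simp: pn_def r_def intro!: prod_nonneg mult_nonneg_nonneg)
  show 3: "0 \<le> P xs m ys zs" for xs m ys zs by (simp add: P_def 1)
  show "0 \<le> Pc xs ys zs" by (simp add: Pc_def 3 sum_nonneg)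
  show 4: "0 \<le> Aq q m ys x" and 5: "0 \<le> Bq q m ys z" for q m ys x z
    by (auto simp: Aq_def Bq_def 2 intro!: sum_nonneg)
  show "0 \<le> Pq q m ys x z" by (simp add: Pq_def 4 5)
  show "0 \<le> Pm m ys" by (auto simp: Pm_def 1 intro!: sum_nonneg)
  show "0 \<le> pY y" by (simp add: pY_def sum_nonneg)
qed

lemma sum_Bq: "(\<Sum>z\<in>UNIV. Bq q m ys z) = 1"
  using sum_by_value[of "\<lambda>zs. zs ! q" "pmf (dec m ys)" LZ "\<lambda>_. 1"] by (simp add: Bq_def sum_dec)

text \<open>\<open>enc\<close> sees only the x-word and \<open>dec\<close> only m and the y-word, so
  for fixed m and ys the sum over words splits at position q into \<open>Aq\<close>,
  \<open>W\<close> and \<open>Bq\<close>. The test function \<open>g\<close> will be a constant, an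
  indicator or a logarithm.\<close>

lemma sum_Pq:
  assumes q: "q < n"
  shows "(\<Sum>x\<in>UNIV. \<Sum>z\<in>UNIV. Pq q m ys x z * g x z) = (\<Sum>xs\<in>LX. \<Sum>zs\<in>LZ. P xs m ys zs * g (xs ! q) (zs ! q))"
proof -
  have "(\<Sum>x\<in>UNIV. \<Sum>z\<in>UNIV. Pq q m ys x z * g x z) = (\<Sum>x\<in>UNIV. Aq q m ys x * (pmf (W x) (ys ! q) * (\<Sum>z\<in>UNIV. Bq q m ys z * g x z)))"
    by (simp add: Pq_def sum_distrib_left mult.assoc)
  also have "\<dots> = (\<Sum>x\<in>UNIV. Aq q m ys x * (pmf (W x) (ys ! q) * (\<Sum>zs\<in>LZ. pmf (dec m ys) zs * g x (zs ! q))))"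
    unfolding Bq_def sum_by_value ..
  also have "\<dots> = (\<Sum>xs\<in>LX. (r q xs ys * pmf (enc xs) m) * (pmf (W (xs ! q)) (ys ! q) * (\<Sum>zs\<in>LZ. pmf (dec m ys) zs * g (xs ! q) (zs ! q))))"
    unfolding Aq_def by (rule sum_by_value)
  also have "\<dots> = (\<Sum>xs\<in>LX. \<Sum>zs\<in>LZ. P xs m ys zs * g (xs ! q) (zs ! q))"
    unfolding sum_distrib_left by (intro sum.cong refl) (simp add: P_def pn_eq[OF q])
  finally show ?thesis .
qed

lemma sum_P: "(\<Sum>xs\<in>LX. \<Sum>zs\<in>LZ. P xs m ys zs) = Pm m ys"
  by (simp add: P_def Pm_def sum_dec flip: sum_distrib_left)

lemma sum_Pq_eq_Pm: "q < n \<Longrightarrow> (\<Sum>x\<in>UNIV. \<Sum>z\<in>UNIV. Pq q m ys x z) = Pm m ys"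
  using sum_Pq[of q m ys "\<lambda>_ _. 1"] by (simp add: sum_P)

text \<open>Both sides are the probability of M = m together with all letters of \<open>ys\<close>
  except the one at q. It is the weight of this value of the auxiliary variable.\<close>

lemma sum_Pm_update:
  assumes q: "q < n" "length ys = n"
  shows "(\<Sum>y\<in>UNIV. Pm m (ys[q := y])) = (\<Sum>x\<in>UNIV. Aq q m ys x)"
proof -
  have "Pm m (ys[q := y]) = (\<Sum>x\<in>UNIV. Aq q m ys x * pmf (W x) y)" for y
    using q unfolding sum_Pq_eq_Pm[OF q(1), symmetric] Pq_def Aq_update by (simp add: sum_Bq flip: sum_distrib_left)
  then have "(\<Sum>y\<in>UNIV. Pm m (ys[q := y])) = (\<Sum>x\<in>UNIV. \<Sum>y\<in>UNIV. Aq q m ys x * pmf (W x) y)"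
    by (simp only:) (rule sum.swap)
  then show ?thesis by (simp add: sum_W flip: sum_distrib_left)
qed

lemma sum_Pm: "(\<Sum>m\<in>{1..K}. Pm m ys) = (\<Prod>i<n. pY (ys ! i))"
proof -
  have "(\<Sum>m\<in>{1..K}. Pm m ys) = (\<Sum>xs\<in>LX. pn xs ys)"
    unfolding Pm_def by (subst sum.swap) (simp add: sum_enc del: One_nat_def flip: sum_distrib_left)
  also have "\<dots> = (\<Prod>i<n. pY (ys ! i))"
    unfolding pn_def pY_def by (rule sum_prod_nlists) simp
  finally show ?thesis .
qed

lemma sum_pY: "(\<Sum>y\<in>UNIV. pY y) = 1"
proof -
  have "(\<Sum>y\<in>UNIV. pY y) = (\<Sum>t\<in>UNIV. pmf pXY t)"
    unfolding pY_def by (subst sum.swap) (simp add: sum.cartesian_product)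
  then show ?thesis by (simp add: sum_pmf_eq_1)
qed

lemma sum_Pm_total: "(\<Sum>m\<in>{1..K}. \<Sum>ys\<in>LY. Pm m ys) = 1"
proof -
  have "(\<Sum>m\<in>{1..K}. \<Sum>ys\<in>LY. Pm m ys) = (\<Sum>ys\<in>LY. \<Prod>i<n. pY (ys ! i))"
    by (subst sum.swap) (simp add: sum_Pm del: One_nat_def)
  also have "\<dots> = (\<Prod>i<n. \<Sum>y\<in>UNIV. pY y)" by (rule sum_prod_nlists) simp
  finally show ?thesis by (simp add: sum_pY)
qed

text \<open>The sum over q of the conditional entropies H(X_q Z_q | M, Y^n).\<close>
definition "cond_ent_MY = (\<Sum>q<n. \<Sum>m\<in>{1..K}. \<Sum>ys\<in>LY. (\<Sum>x\<in>UNIV. \<Sum>z\<in>UNIV. eta (Pq q m ys x z)) - eta (Pm m ys))"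

text \<open>Gibbs' inequality for (M,X^n,Y^n,Z^n) against one reference measure \<open>R\<close>:
  Y^n as in the source, M uniform and independent of it, and the pairs (X_q,Z_q) independent given
  (M,Y^n) with their true conditional laws. This combines H(M|Y^n) \<le> log K with subadditivity of
  H(X^n Z^n|M,Y^n). Dropping M on the left only lowers the entropy.\<close>

lemma entropy_code_le:
  "(\<Sum>xs\<in>LX. \<Sum>ys\<in>LY. \<Sum>zs\<in>LZ. eta (Pc xs ys zs)) \<le> log 2 K + n * (\<Sum>y\<in>UNIV. eta (pY y)) + cond_ent_MY"
proof -
  let ?O = "{1..K} \<times> LY \<times> LX \<times> LZ"
  let ?Pt = "\<lambda>t. case t of (m, ys, xs, zs) \<Rightarrow> P xs m ys zs"
  let ?pYn = "\<lambda>ys. \<Prod>i<n. pY (ys ! i)" and ?Pz = "\<lambda>q m ys xs zs. Pq q m ys (xs ! q) (zs ! q)"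
  let ?g = "\<lambda>q m ys xs zs. P xs m ys zs * log 2 (Pq q m ys (xs ! q) (zs ! q)) - P xs m ys zs * log 2 (Pm m ys)"
  let ?e = "\<lambda>q m ys. eta (Pm m ys) - (\<Sum>x\<in>UNIV. \<Sum>z\<in>UNIV. eta (Pq q m ys x z))"
  have sumO: "(\<Sum>t\<in>?O. case t of (m, ys, xs, zs) \<Rightarrow> F m ys xs zs) = (\<Sum>m\<in>{1..K}. \<Sum>ys\<in>LY. \<Sum>xs\<in>LX. \<Sum>zs\<in>LZ. F m ys xs zs)"
    for F :: "nat \<Rightarrow> 'y list \<Rightarrow> 'x list \<Rightarrow> 'z list \<Rightarrow> real"
    by (simp add: sum.cartesian_product)
  define R where "R m ys xs zs = ?pYn ys / K * (\<Prod>q<n. ?Pz q m ys xs zs / Pm m ys)" for m ys xs zs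
  have pos: "0 < ?pYn ys" "0 < Pm m ys" "\<And>q. q < n \<Longrightarrow> 0 < ?Pz q m ys xs zs"
    if O: "m \<in> {1..K}" "ys \<in> LY" "xs \<in> LX" "zs \<in> LZ" and P: "0 < P xs m ys zs" for m ys xs zs
  proof -
    have "P xs m ys zs \<le> (\<Sum>zs\<in>LZ. P xs m ys zs)"
      by (rule member_le_sum[OF O(4)]) (auto simp: nonneg finL)
    also have "\<dots> \<le> (\<Sum>xs\<in>LX. \<Sum>zs\<in>LZ. P xs m ys zs)"
      by (rule member_le_sum[OF O(3)]) (auto simp: nonneg finL intro: sum_nonneg)
    finally show Pm0: "0 < Pm m ys" using P unfolding sum_P by linarith
    have "Pm m ys \<le> (\<Sum>m\<in>{1..K}. Pm m ys)"
      by (rule member_le_sum[OF O(1)]) (auto simp: nonneg)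
    then show "0 < ?pYn ys" using Pm0 unfolding sum_Pm by linarith
    fix q assume q: "q < n"
    \<comment> \<open>The constraint is trivially true here. It isolates the letters at q, so that
      enlarging the sums ends at the single value \<open>Pq\<close>.\<close>
    have "P xs m ys zs = P xs m ys zs * of_bool (xs ! q = xs ! q \<and> zs ! q = zs ! q)" by simp
    also have "\<dots> \<le> (\<Sum>zs'\<in>LZ. P xs m ys zs' * of_bool (xs ! q = xs ! q \<and> zs' ! q = zs ! q))"
      by (rule member_le_sum[OF O(4), where f = "\<lambda>zs'. P xs m ys zs' * of_bool (xs ! q = xs ! q \<and> zs' ! q = zs ! q)"]) (auto simp: nonneg finL)
    also have "\<dots> \<le> (\<Sum>xs'\<in>LX. \<Sum>zs'\<in>LZ. P xs' m ys zs' * of_bool (xs' ! q = xs ! q \<and> zs' ! q = zs ! q))"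
      by (rule member_le_sum[OF O(3), where f = "\<lambda>xs'. \<Sum>zs'\<in>LZ. P xs' m ys zs' * of_bool (xs' ! q = xs ! q \<and> zs' ! q = zs ! q)"]) (auto simp: nonneg finL intro: sum_nonneg)
    also have "\<dots> = (\<Sum>x\<in>UNIV. \<Sum>z\<in>UNIV. Pq q m ys x z * of_bool (x = xs ! q \<and> z = zs ! q))"
      by (rule sum_Pq[OF q, symmetric])
    also have "\<dots> = (\<Sum>x\<in>UNIV. if x = xs ! q then (\<Sum>z\<in>UNIV. if z = zs ! q then Pq q m ys x z else 0) else 0)"
      by (intro sum.cong refl) auto
    also have "\<dots> = ?Pz q m ys xs zs" by simp
    finally show "0 < ?Pz q m ys xs zs" using P by linarith
  qed
  have R0: "0 \<le> R m ys xs zs" for m ys xs zs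
    unfolding R_def by (intro mult_nonneg_nonneg divide_nonneg_nonneg prod_nonneg) (auto simp: nonneg)
  have "(\<Sum>t\<in>?O. eta (?Pt t))
     \<le> - (\<Sum>t\<in>?O. ?Pt t * log 2 (case t of (m, ys, xs, zs) \<Rightarrow> R m ys xs zs))"
  proof (rule Gibbs_inequality)
    show "finite ?O" using finL by simp
    show "0 \<le> ?Pt t" for t by (cases t) (simp add: nonneg)
    show "0 \<le> (case t of (m, ys, xs, zs) \<Rightarrow> R m ys xs zs)" for t by (cases t) (simp add: R0)
    show "0 < (case t of (m, ys, xs, zs) \<Rightarrow> R m ys xs zs)" if t: "t \<in> ?O" "0 < ?Pt t" for t
    proof -
      obtain m ys xs zs where tt: "t = (m, ys, xs, zs)" by (cases t)
      have O: "m \<in> {1..K}" "ys \<in> LY" "xs \<in> LX" "zs \<in> LZ" using t by (auto simp: tt)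
      have "0 < P xs m ys zs" using t by (simp add: tt)
      note p = pos[OF O this]
      show ?thesis unfolding tt R_def using p K by (auto intro!: mult_pos_pos divide_pos_pos prod_pos)
    qed
    have "(\<Sum>t\<in>?O. case t of (m, ys, xs, zs) \<Rightarrow> R m ys xs zs)
      = (\<Sum>m\<in>{1..K}. \<Sum>ys\<in>LY. ?pYn ys / K * (\<Sum>xs\<in>LX. \<Sum>zs\<in>LZ. \<Prod>q<n. ?Pz q m ys xs zs / Pm m ys))"
      unfolding sumO R_def by (simp add: sum_distrib_left)
    also have "\<dots> \<le> (\<Sum>m\<in>{1..K}. \<Sum>ys\<in>LY. ?pYn ys / K * 1)"
    proof (intro sum_mono mult_left_mono)
      fix m ys
      have "(\<Sum>xs\<in>LX. \<Sum>zs\<in>LZ. \<Prod>q<n. ?Pz q m ys xs zs / Pm m ys)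
        = (\<Sum>ts\<in>nlists n (UNIV \<times> UNIV). \<Prod>q<n. Pq q m ys (map fst ts ! q) (map snd ts ! q) / Pm m ys)"
        by (rule sum_nlists_zip[symmetric])
      also have "\<dots> = (\<Sum>ts\<in>nlists n (UNIV \<times> UNIV). \<Prod>q<n. Pq q m ys (fst (ts ! q)) (snd (ts ! q)) / Pm m ys)"
        by (intro sum.cong prod.cong refl) (auto simp: in_nlists_UNIV)
      also have "\<dots> = (\<Prod>q<n. \<Sum>t\<in>UNIV \<times> UNIV. Pq q m ys (fst t) (snd t) / Pm m ys)"
        by (rule sum_prod_nlists) simp
      \<comment> \<open>The quotient is 0 if \<open>Pm m ys\<close> is 0, so in general only the
        bound by 1 holds.\<close>
      also have "\<dots> = (\<Prod>q<n. Pm m ys / Pm m ys)"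
        by (intro prod.cong refl) (simp add: sum_Pq_eq_Pm[symmetric] sum.cartesian_product case_prod_unfold sum_divide_distrib[symmetric])
      also have "\<dots> \<le> 1" by (intro prod_le_1) auto
      finally show "(\<Sum>xs\<in>LX. \<Sum>zs\<in>LZ. \<Prod>q<n. ?Pz q m ys xs zs / Pm m ys) \<le> 1" .
      show "0 \<le> ?pYn ys / real K" by (intro divide_nonneg_nonneg prod_nonneg) (auto simp: nonneg)
    qed
    also have "\<dots> = (\<Sum>ys\<in>LY. ?pYn ys)"
      using K by (simp add: sum_divide_distrib[symmetric])
    also have "\<dots> = (\<Sum>m\<in>{1..K}. \<Sum>ys\<in>LY. Pm m ys)"
      by (subst sum.swap) (simp add: sum_Pm del: One_nat_def)
    also have "\<dots> = (\<Sum>t\<in>?O. ?Pt t)"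
      unfolding sumO sum_P ..
    finally show "(\<Sum>t\<in>?O. case t of (m, ys, xs, zs) \<Rightarrow> R m ys xs zs) \<le> (\<Sum>t\<in>?O. ?Pt t)" .
  qed
  also have "(\<Sum>t\<in>?O. ?Pt t * log 2 (case t of (m, ys, xs, zs) \<Rightarrow> R m ys xs zs))
    = (\<Sum>m\<in>{1..K}. \<Sum>ys\<in>LY. \<Sum>xs\<in>LX. \<Sum>zs\<in>LZ. P xs m ys zs * log 2 (R m ys xs zs))"
    unfolding sumO[symmetric] by (simp add: case_prod_unfold)
  also have "\<dots> = (\<Sum>m\<in>{1..K}. \<Sum>ys\<in>LY. \<Sum>xs\<in>LX. \<Sum>zs\<in>LZ. P xs m ys zs * (log 2 (?pYn ys) - log 2 K)
       + (\<Sum>q<n. ?g q m ys xs zs))"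
  proof (intro sum.cong refl)
    fix m ys xs zs assume O: "m \<in> {1..K}" "ys \<in> LY" "xs \<in> LX" "zs \<in> LZ"
    show "P xs m ys zs * log 2 (R m ys xs zs) = P xs m ys zs * (log 2 (?pYn ys) - log 2 K)
       + (\<Sum>q<n. ?g q m ys xs zs)"
    proof (cases "P xs m ys zs = 0")
      case False
      then have "0 < P xs m ys zs" using nonneg(3)[of xs m ys zs] by linarith
      note p = pos[OF O this]
      have prods: "0 < (\<Prod>q<n. ?Pz q m ys xs zs / Pm m ys)" using p by (intro prod_pos) auto
      have "ln (\<Prod>q<n. ?Pz q m ys xs zs / Pm m ys) = (\<Sum>q<n. ln (?Pz q m ys xs zs / Pm m ys))"
      proof (rule ln_prod)
        fix q assume "q \<in> {..<n}"
        then show "?Pz q m ys xs zs / Pm m ys \<noteq> 0" using p(2) p(3)[of q] by simp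
      qed simp
      then have "log 2 (\<Prod>q<n. ?Pz q m ys xs zs / Pm m ys) = (\<Sum>q<n. log 2 (?Pz q m ys xs zs / Pm m ys))"
        by (simp only: log_def sum_divide_distrib)
      also have "\<dots> = (\<Sum>q<n. log 2 (?Pz q m ys xs zs) - log 2 (Pm m ys))"
        using p by (intro sum.cong refl log_divide_pos) auto
      finally have lp: "log 2 (\<Prod>q<n. ?Pz q m ys xs zs / Pm m ys) = \<dots>" .
      have "log 2 (a / real K * b) = log 2 a - log 2 (real K) + log 2 b" if "0 < a" "0 < b" for a b
        using that K by (simp add: log_mult log_divide)
      from this[OF p(1) prods]
      have "log 2 (R m ys xs zs) = log 2 (?pYn ys) - log 2 K + (\<Sum>q<n. log 2 (?Pz q m ys xs zs) - log 2 (Pm m ys))"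
        unfolding R_def lp .
      then show ?thesis by (simp only: distrib_left sum_distrib_left right_diff_distrib)
    qed simp
  qed
  also have "\<dots> = (\<Sum>m\<in>{1..K}. \<Sum>ys\<in>LY. Pm m ys * (log 2 (?pYn ys) - log 2 K)
       + (\<Sum>q<n. ?e q m ys))"
  proof (intro sum.cong refl)
    fix m ys
    have "(\<Sum>xs\<in>LX. \<Sum>zs\<in>LZ. P xs m ys zs * (log 2 (?pYn ys) - log 2 K)
       + (\<Sum>q<n. ?g q m ys xs zs))
      = (\<Sum>xs\<in>LX. \<Sum>zs\<in>LZ. P xs m ys zs) * (log 2 (?pYn ys) - log 2 K)
        + (\<Sum>q<n. \<Sum>xs\<in>LX. \<Sum>zs\<in>LZ. ?g q m ys xs zs)"
      unfolding sum.distrib sum_distrib_right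
      by (subst sum.swap[of _ "{..<n}" LZ], subst sum.swap[of _ "{..<n}" LX]) (rule refl)
    also have "(\<Sum>q<n. \<Sum>xs\<in>LX. \<Sum>zs\<in>LZ. ?g q m ys xs zs)
      = (\<Sum>q<n. ?e q m ys)"
    proof (rule sum.cong[OF refl])
      fix q assume "q \<in> {..<n}"
      then have q: "q < n" by simp
      have "(\<Sum>xs\<in>LX. \<Sum>zs\<in>LZ. ?g q m ys xs zs)
        = (\<Sum>x\<in>UNIV. \<Sum>z\<in>UNIV. Pq q m ys x z * log 2 (Pq q m ys x z)) - Pm m ys * log 2 (Pm m ys)"
        unfolding sum_subtractf sum_distrib_right[symmetric] sum_P
        by (simp only: sum_Pq[OF q, of m ys "\<lambda>x z. log 2 (Pq q m ys x z)"])
      then show "(\<Sum>xs\<in>LX. \<Sum>zs\<in>LZ. ?g q m ys xs zs)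
        = ?e q m ys"
        by (simp add: eta_def sum_negf)
    qed
    finally show "(\<Sum>xs\<in>LX. \<Sum>zs\<in>LZ. P xs m ys zs * (log 2 (?pYn ys) - log 2 K)
       + (\<Sum>q<n. ?g q m ys xs zs))
      = Pm m ys * (log 2 (?pYn ys) - log 2 K) + (\<Sum>q<n. ?e q m ys)"
      unfolding sum_P .
  qed
  also have "\<dots> = (\<Sum>m\<in>{1..K}. \<Sum>ys\<in>LY. Pm m ys * log 2 (?pYn ys)) - (\<Sum>m\<in>{1..K}. \<Sum>ys\<in>LY. Pm m ys) * log 2 K
       + (\<Sum>m\<in>{1..K}. \<Sum>ys\<in>LY. \<Sum>q<n. ?e q m ys)"
    by (simp only: sum.distrib right_diff_distrib sum_subtractf sum_distrib_right)
  also have "(\<Sum>m\<in>{1..K}. \<Sum>ys\<in>LY. \<Sum>q<n. ?e q m ys) = - cond_ent_MY"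
  proof -
    have "cond_ent_MY = (\<Sum>m\<in>{1..K}. \<Sum>ys\<in>LY. \<Sum>q<n. (\<Sum>x\<in>UNIV. \<Sum>z\<in>UNIV. eta (Pq q m ys x z)) - eta (Pm m ys))"
      unfolding cond_ent_MY_def
      by (subst sum.swap, rule sum.cong[OF refl], rule sum.swap)
    then show ?thesis by (simp add: sum_subtractf)
  qed
  also have "(\<Sum>m\<in>{1..K}. \<Sum>ys\<in>LY. Pm m ys * log 2 (?pYn ys)) = - (n * (\<Sum>y\<in>UNIV. eta (pY y)))"
  proof -
    have "(\<Sum>m\<in>{1..K}. \<Sum>ys\<in>LY. Pm m ys * log 2 (?pYn ys)) = (\<Sum>ys\<in>LY. ?pYn ys * log 2 (?pYn ys))"
      by (subst sum.swap) (simp add: sum_Pm del: One_nat_def flip: sum_distrib_right)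
    also have "\<dots> = - (\<Sum>ys\<in>LY. eta (?pYn ys))" by (simp add: eta_def sum_negf)
    also have "\<dots> = - (n * (\<Sum>y\<in>UNIV. eta (pY y)))"
      by (subst sum_eta_nlists) (auto simp: sum_pY nonneg)
    finally show ?thesis .
  qed
  also have "(\<Sum>m\<in>{1..K}. \<Sum>ys\<in>LY. Pm m ys) = 1" by (rule sum_Pm_total)
  finally have gibbs: "(\<Sum>t\<in>?O. eta (?Pt t))
     \<le> log 2 K + n * (\<Sum>y\<in>UNIV. eta (pY y)) + cond_ent_MY"
    by simp
  have "(\<Sum>xs\<in>LX. \<Sum>ys\<in>LY. \<Sum>zs\<in>LZ. eta (Pc xs ys zs)) \<le> (\<Sum>xs\<in>LX. \<Sum>ys\<in>LY. \<Sum>zs\<in>LZ. \<Sum>m\<in>{1..K}. eta (P xs m ys zs))"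
    unfolding Pc_def by (intro sum_mono eta_sum_le) (auto simp: nonneg)
  also have "\<dots> = (\<Sum>m\<in>{1..K}. \<Sum>ys\<in>LY. \<Sum>xs\<in>LX. \<Sum>zs\<in>LZ. eta (P xs m ys zs))"
    by (subst sum.swap[of _ LY LX], subst sum.swap[of _ "{1..K}" LZ], subst sum.swap[of _ "{1..K}" LX], subst sum.swap[of _ "{1..K}" LY]) (rule refl)
  also have "\<dots> = (\<Sum>t\<in>?O. eta (?Pt t))"
    unfolding sumO[symmetric] by (simp add: case_prod_unfold)
  finally show ?thesis using gibbs by linarith
qed

text \<open>Supplies a point for values of the auxiliary variable with probability 0, where no
  conditional law is determined.\<close>

lemma chain_points_nonempty: "(chain_points W :: ((real ^ ('x \<times> 'y \<times> 'z)) \<times> real) set) \<noteq> {}"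
proof -
  obtain h where "(target_vec pXY (\<lambda>_ _. return_pmf (undefined :: 'z)), h) \<in> convex hull (chain_points W)"
    using target_in_hull[OF W, of "\<lambda>_ _. return_pmf (undefined :: 'z)"] by blast
  then show ?thesis using convex_hull_eq_empty[of "chain_points W"] by (metis empty_iff)
qed

text \<open>Fix q, m and the letters of \<open>ys\<close> other than the one at q. The source is
  memoryless and m comes from the x-word alone, so Y_q is still produced from X_q by
  \<open>W\<close>. Bob sees only m and the y-word, so Z_q depends on Y_q alone. Multiplying by the
  probability of the fixed data covers the case where it is 0.\<close>

lemma scaled_chain_point:
  assumes q: "q < n" and ys: "ys \<in> LY"
  shows "\<exists>s\<in>chain_points W. (\<Sum>x\<in>UNIV. Aq q m ys x) *\<^sub>R s =
     ((\<chi> t. Pq q m (ys[q := fst (snd t)]) (fst t) (snd (snd t))),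
      \<Sum>y\<in>UNIV. (\<Sum>x\<in>UNIV. \<Sum>z\<in>UNIV. eta (Pq q m (ys[q := y]) x z)) - eta (Pm m (ys[q := y])))"
proof -
  define w where "w = (\<Sum>x\<in>UNIV. Aq q m ys x)"
  have len: "length ys = n" using ys by (simp add: in_nlists_UNIV)
  have Pq: "Pq q m (ys[q := y]) x z = Aq q m ys x * pmf (W x) y * Bq q m (ys[q := y]) z" for x y z
    using q len by (simp add: Pq_def Aq_update)
  have Pm: "Pm m (ys[q := y]) = (\<Sum>x\<in>UNIV. \<Sum>z\<in>UNIV. Pq q m (ys[q := y]) x z)" for y
    by (rule sum_Pq_eq_Pm[OF q, symmetric])
  show ?thesis
  proof (cases "w = 0")
    case True
    then have "Aq q m ys x = 0" for x
      unfolding w_def by (subst (asm) sum_nonneg_eq_0_iff) (auto simp: nonneg)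
    then have "Pq q m (ys[q := y]) x z = 0" for x y z by (simp add: Pq)
    moreover obtain s :: "(real ^ ('x \<times> 'y \<times> 'z)) \<times> real" where "s \<in> chain_points W"
      using chain_points_nonempty by blast
    ultimately show ?thesis
      unfolding w_def[symmetric] True Pm by (intro bexI[of _ s]) (auto simp: zero_prod_def vec_eq_iff)
  next
    case False
    then have w: "0 < w" using nonneg(5) by (simp add: w_def less_le sum_nonneg)
    define a where "a = (\<chi> x. Aq q m ys x / w)"
    define B where "B = (\<chi> y z. Bq q m (ys[q := y]) z)"
    define l where "l = chain_law W a B"
    have a: "a \<in> prob_simplex"
      using w by (auto simp: prob_simplex_def a_def nonneg sum_divide_distrib[symmetric] w_def[symmetric])
    have B: "B $ y \<in> prob_simplex" for y
      by (auto simp: prob_simplex_def B_def nonneg sum_Bq)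
    have wl: "w * l $ (x, y, z) = Pq q m (ys[q := y]) x z" for x y z
      using w by (simp add: l_def chain_law_def a_def B_def Pq)
    have l0: "0 \<le> l $ t" for t unfolding l_def by (rule chain_law_nonneg[OF a B])
    have "w * cond_ent l = (\<Sum>t\<in>UNIV. eta (w * l $ t)) - (\<Sum>y\<in>UNIV. eta (w * (\<Sum>x\<in>UNIV. \<Sum>z\<in>UNIV. l $ (x, y, z))))"
      using w by (intro scale_cond_ent l0) simp
    also have "\<dots> = (\<Sum>y\<in>UNIV. (\<Sum>x\<in>UNIV. \<Sum>z\<in>UNIV. eta (Pq q m (ys[q := y]) x z)) - eta (Pm m (ys[q := y])))"
      unfolding sum_triple sum_distrib_left wl Pm sum_subtractf ..
    finally have ce: "w * cond_ent l = \<dots>" .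
    have "w *\<^sub>R l = (\<chi> t. Pq q m (ys[q := fst (snd t)]) (fst t) (snd (snd t)))"
      using wl by (simp add: vec_eq_iff)
    moreover have "(l, cond_ent l) \<in> chain_points W"
      unfolding chain_points_def l_def using a B by (intro image_eqI[of _ _ "(a, B)"]) auto
    ultimately show ?thesis
      unfolding w_def[symmetric] using ce by (intro bexI[of _ "(l, cond_ent l)"]) auto
  qed
qed

text \<open>
  The auxiliary variable is indexed by (q, m, ys) with ys ranging over all words, although only the
  letters other than ys ! q matter. Every value is therefore counted CARD('y) times.
\<close>
lemma code_hull_point:
  "\<exists>v. (v, cond_ent_MY / n) \<in> convex hull (chain_points W) \<and>
    (\<forall>x y z. v $ (x, y, z) = (\<Sum>q<n. \<Sum>xs\<in>LX. \<Sum>ys\<in>LY. \<Sum>zs\<in>LZ.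
        Pc xs ys zs * of_bool (xs ! q = x \<and> ys ! q = y \<and> zs ! q = z)) / n)"
proof -
  let ?U = "{..<n} \<times> {1..K} \<times> LY"
  let ?Y = "real CARD('y)"
  let ?I = "\<lambda>q x y z xs ys zs. of_bool (xs ! q = x \<and> ys ! q = y \<and> zs ! q = z)"
  define w where "w = (\<lambda>(q, m, ys). \<Sum>x\<in>UNIV. Aq q m ys x)"
  define F where "F = (\<lambda>(q, m, ys). (((\<chi> t. Pq q m (ys[q := fst (snd t)]) (fst t) (snd (snd t))) :: real ^ ('x \<times> 'y \<times> 'z)),
      \<Sum>y\<in>UNIV. (\<Sum>x\<in>UNIV. \<Sum>z\<in>UNIV. eta (Pq q m (ys[q := y]) x z)) - eta (Pm m (ys[q := y]))))"
  have "\<forall>u\<in>?U. \<exists>s. s \<in> chain_points W \<and> w u *\<^sub>R s = F u"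
    using scaled_chain_point by (fastforce simp: w_def F_def)
  then obtain s where s: "\<And>u. u \<in> ?U \<Longrightarrow> s u \<in> chain_points W" "\<And>u. u \<in> ?U \<Longrightarrow> w u *\<^sub>R s u = F u"
    by metis
  have sumU: "(\<Sum>u\<in>?U. case u of (q, m, ys) \<Rightarrow> G q m ys) = (\<Sum>q<n. \<Sum>m\<in>{1..K}. \<Sum>ys\<in>LY. G q m ys)" for G :: "nat \<Rightarrow> nat \<Rightarrow> 'y list \<Rightarrow> real"
    by (simp add: sum.cartesian_product)
  have upd: "(\<Sum>q<n. \<Sum>m\<in>{1..K}. \<Sum>ys\<in>LY. \<Sum>y\<in>UNIV. G q m y (ys[q := y])) = ?Y * (\<Sum>q<n. \<Sum>m\<in>{1..K}. \<Sum>ys\<in>LY. G q m (ys ! q) ys)"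
    for G :: "nat \<Rightarrow> nat \<Rightarrow> 'y \<Rightarrow> 'y list \<Rightarrow> real"
    unfolding sum_distrib_left[of ?Y "\<lambda>q. \<Sum>m\<in>{1..K}. \<Sum>ys\<in>LY. G q m (ys ! q) ys"]
      sum_distrib_left[of ?Y "\<lambda>m. \<Sum>ys\<in>LY. G q m (ys ! q) ys" for q]
    by (intro sum.cong refl sum_nlists_update) auto
  have total: "sum w ?U = n * ?Y"
  proof -
    have "sum w ?U = (\<Sum>q<n. \<Sum>m\<in>{1..K}. \<Sum>ys\<in>LY. \<Sum>y\<in>UNIV. Pm m (ys[q := y]))"
      unfolding w_def sumU by (intro sum.cong refl sum_Pm_update[symmetric]) (auto simp: in_nlists_UNIV)
    also have "\<dots> = ?Y * (\<Sum>q<n. \<Sum>m\<in>{1..K}. \<Sum>ys\<in>LY. Pm m ys)"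
      by (rule upd)
    also have "\<dots> = ?Y * (\<Sum>q<n. 1)" unfolding sum_Pm_total ..
    finally show ?thesis by simp
  qed
  have Y0: "?Y > 0" by simp
  have "(\<Sum>u\<in>?U. (w u / (n * ?Y)) *\<^sub>R s u) \<in> convex hull (chain_points W)"
  proof (rule convex_sum)
    show "(\<Sum>u\<in>?U. w u / (n * ?Y)) = 1"
      unfolding sum_divide_distrib[symmetric] total using n by simp
    show "0 \<le> w u / (n * ?Y)" for u
      by (auto simp: w_def nonneg split: prod.split intro!: divide_nonneg_nonneg sum_nonneg)
  qed (use finL s in \<open>auto intro: hull_inc\<close>)
  moreover have "(\<Sum>u\<in>?U. (w u / (n * ?Y)) *\<^sub>R s u) = (1 / (n * ?Y)) *\<^sub>R (\<Sum>u\<in>?U. F u)"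
    unfolding scaleR_right.sum by (intro sum.cong refl) (simp add: s(2)[symmetric])
  ultimately have mem: "(1 / (n * ?Y)) *\<^sub>R (\<Sum>u\<in>?U. F u) \<in> convex hull (chain_points W)" by simp
  define v where "v = fst ((1 / (n * ?Y)) *\<^sub>R (\<Sum>u\<in>?U. F u))"
  have "snd ((1 / (n * ?Y)) *\<^sub>R (\<Sum>u\<in>?U. F u)) = (1 / (n * ?Y)) * (\<Sum>u\<in>?U. snd (F u))"
    by (simp add: snd_sum)
  also have "(\<Sum>u\<in>?U. snd (F u)) = (\<Sum>q<n. \<Sum>m\<in>{1..K}. \<Sum>ys\<in>LY. \<Sum>y\<in>UNIV.
      (\<Sum>x\<in>UNIV. \<Sum>z\<in>UNIV. eta (Pq q m (ys[q := y]) x z)) - eta (Pm m (ys[q := y])))"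
    unfolding sumU[symmetric] by (simp add: F_def case_prod_unfold)
  also have "\<dots> = ?Y * cond_ent_MY"
    unfolding cond_ent_MY_def by (rule upd)
  also have "(1 / (n * ?Y)) * (?Y * cond_ent_MY) = cond_ent_MY / n" by simp
  finally have sndv: "snd ((1 / (n * ?Y)) *\<^sub>R (\<Sum>u\<in>?U. F u)) = cond_ent_MY / n" .
  have "v $ (x, y, z) = (\<Sum>q<n. \<Sum>xs\<in>LX. \<Sum>ys\<in>LY. \<Sum>zs\<in>LZ.
        Pc xs ys zs * ?I q x y z xs ys zs) / n" for x y z
  proof -
    have "v $ (x, y, z) = (1 / (n * ?Y)) * (\<Sum>u\<in>?U. fst (F u) $ (x, y, z))"
      by (simp add: v_def fst_sum)
    also have "(\<Sum>u\<in>?U. fst (F u) $ (x, y, z)) = (\<Sum>q<n. \<Sum>m\<in>{1..K}. \<Sum>ys\<in>LY. Pq q m (ys[q := y]) x z)"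
      unfolding sumU[symmetric] by (simp add: F_def case_prod_unfold)
    \<comment> \<open>The indicator lets the letter y be summed over, which is the shape required by
      \<open>upd\<close>.\<close>
    also have "\<dots> = (\<Sum>q<n. \<Sum>m\<in>{1..K}. \<Sum>ys\<in>LY. \<Sum>y'\<in>UNIV. of_bool (y' = y) * Pq q m (ys[q := y']) x z)"
    proof (intro sum.cong refl)
      fix q m ys
      have "(\<Sum>y'\<in>UNIV. of_bool (y' = y) * Pq q m (ys[q := y']) x z) = (\<Sum>y'\<in>UNIV. if y' = y then Pq q m (ys[q := y']) x z else 0)"
        by (intro sum.cong) auto
      then show "Pq q m (ys[q := y]) x z = (\<Sum>y'\<in>UNIV. of_bool (y' = y) * Pq q m (ys[q := y']) x z)" by simp
    qed
    also have "\<dots> = ?Y * (\<Sum>q<n. \<Sum>m\<in>{1..K}. \<Sum>ys\<in>LY. of_bool (ys ! q = y) * Pq q m ys x z)"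
      by (rule upd)
    also have "(\<Sum>q<n. \<Sum>m\<in>{1..K}. \<Sum>ys\<in>LY. of_bool (ys ! q = y) * Pq q m ys x z)
      = (\<Sum>q<n. \<Sum>xs\<in>LX. \<Sum>ys\<in>LY. \<Sum>zs\<in>LZ. Pc xs ys zs * ?I q x y z xs ys zs)"
    proof (rule sum.cong[OF refl])
      fix q assume "q \<in> {..<n}"
      then have q: "q < n" by simp
      have eq: "of_bool (ys ! q = y) * Pq q m ys x z
          = (\<Sum>xs\<in>LX. \<Sum>zs\<in>LZ. P xs m ys zs * ?I q x y z xs ys zs)" for m ys
      proof -
        have "of_bool (ys ! q = y) * Pq q m ys x z = (\<Sum>x'\<in>UNIV. if x' = x then \<Sum>z'\<in>UNIV. if z' = z then of_bool (ys ! q = y) * Pq q m ys x' z' else 0 else 0)"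
          by simp
        also have "\<dots> = (\<Sum>x'\<in>UNIV. \<Sum>z'\<in>UNIV. Pq q m ys x' z' * of_bool (x' = x \<and> ys ! q = y \<and> z' = z))"
          by (intro sum.cong refl) auto
        also have "\<dots> = (\<Sum>xs\<in>LX. \<Sum>zs\<in>LZ. P xs m ys zs * ?I q x y z xs ys zs)"
          by (rule sum_Pq[OF q])
        finally show ?thesis .
      qed
      have "(\<Sum>m\<in>{1..K}. \<Sum>ys\<in>LY. of_bool (ys ! q = y) * Pq q m ys x z)
        = (\<Sum>m\<in>{1..K}. \<Sum>xs\<in>LX. \<Sum>ys\<in>LY. \<Sum>zs\<in>LZ. P xs m ys zs * ?I q x y z xs ys zs)"
        unfolding eq by (intro sum.cong refl sum.swap)
      also have "\<dots> = (\<Sum>xs\<in>LX. \<Sum>ys\<in>LY. \<Sum>zs\<in>LZ. \<Sum>m\<in>{1..K}. P xs m ys zs * ?I q x y z xs ys zs)"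
        by (subst sum.swap[of _ LX "{1..K}"], subst sum.swap[of _ LY "{1..K}"], subst sum.swap[of _ LZ "{1..K}"]) (rule refl)
      finally show "(\<Sum>m\<in>{1..K}. \<Sum>ys\<in>LY. of_bool (ys ! q = y) * Pq q m ys x z)
        = (\<Sum>xs\<in>LX. \<Sum>ys\<in>LY. \<Sum>zs\<in>LZ. Pc xs ys zs * ?I q x y z xs ys zs)"
        unfolding Pc_def sum_distrib_right .
    qed
    finally show ?thesis using Y0 by simp
  qed
  moreover have "(v, cond_ent_MY / n) \<in> convex hull (chain_points W)"
    using mem unfolding v_def sndv[symmetric] by (simp only: prod.collapse)
  ultimately show ?thesis by blast
qed

text \<open>The i.i.d. target has n times the single-letter entropy, and the entropy of the code is
  below it by at most the continuity loss; dividing \<open>entropy_code_le\<close> by n then bounds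
  \<open>cond_ent_MY / n\<close>, which is \<open>h\<close>. The law \<open>v\<close> is the average
  over q of the single-letter marginals of the code, each within \<delta> of \<open>t\<close> in
  every coordinate.\<close>

lemma converse_bound:
  fixes pZ :: "'x \<Rightarrow> 'y \<Rightarrow> 'z pmf"
  defines "t \<equiv> target_vec pXY pZ"
  assumes d: "(\<Sum>xs\<in>LX. \<Sum>ys\<in>LY. \<Sum>zs\<in>LZ. \<bar>Pc xs ys zs - (\<Prod>i<n. t $ (xs ! i, ys ! i, zs ! i))\<bar>) \<le> \<delta>"
  shows "\<exists>v h. (v, h) \<in> convex hull (chain_points W) \<and> (\<forall>i. \<bar>v $ i - t $ i\<bar> \<le> \<delta>) \<and>
    cond_ent t - log 2 K / n - \<delta> * log 2 CARD('x \<times> 'y \<times> 'z) - (1 + \<delta>) / (n * ln 2) \<le> h"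
proof -
  let ?tn = "\<lambda>xs ys zs. \<Prod>i<n. t $ (xs ! i, ys ! i, zs ! i)"
  let ?I = "\<lambda>q x y z xs ys zs. of_bool (xs ! q = x \<and> ys ! q = y \<and> zs ! q = z)"
  have t0: "0 \<le> t $ a" for a by (cases a) (simp add: t_def target_vec_nth)
  have tz: "(\<Sum>z\<in>UNIV. t $ (x, y, z)) = pmf pXY (x, y)" for x y
    by (simp add: t_def target_vec_nth sum_pmf_eq_1 flip: sum_distrib_left)
  have t1: "(\<Sum>a\<in>UNIV. t $ a) = 1"
    unfolding sum_triple tz using sum_pY by (simp add: pY_def)
  \<comment> \<open>\<open>G\<close> has to ignore indices from n on, where \<open>!\<close> on the
    three words and on the zipped word may differ.\<close>
  have zip: "(\<Sum>xs\<in>LX. \<Sum>ys\<in>LY. \<Sum>zs\<in>LZ. G (\<lambda>i. (xs ! i, ys ! i, zs ! i))) = (\<Sum>ts\<in>nlists n UNIV. G (\<lambda>i. (ts :: ('x \<times> 'y \<times> 'z) list) ! i))"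
    if G: "\<And>f g. (\<And>i. i < n \<Longrightarrow> f i = g i) \<Longrightarrow> G f = G g" for G :: "(nat \<Rightarrow> 'x \<times> 'y \<times> 'z) \<Rightarrow> real"
    unfolding sum_nlists_zip3 UNIV_Times_UNIV by (intro sum.cong refl G) (simp add: in_nlists_UNIV)
  obtain v where v: "(v, cond_ent_MY / n) \<in> convex hull (chain_points W)"
    and vn: "\<And>x y z. v $ (x, y, z) = (\<Sum>q<n. \<Sum>xs\<in>LX. \<Sum>ys\<in>LY. \<Sum>zs\<in>LZ.
        Pc xs ys zs * ?I q x y z xs ys zs) / n"
    using code_hull_point by blast
  have "\<bar>v $ a - t $ a\<bar> \<le> \<delta>" for a
  proof -
    obtain x y z where a: "a = (x, y, z)" by (cases a)
    have tq: "t $ (x, y, z) = (\<Sum>xs\<in>LX. \<Sum>ys\<in>LY. \<Sum>zs\<in>LZ. ?tn xs ys zs * ?I q x y z xs ys zs)" if q: "q < n" for q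
    proof -
      have "(\<Sum>xs\<in>LX. \<Sum>ys\<in>LY. \<Sum>zs\<in>LZ. ?tn xs ys zs * of_bool ((xs ! q, ys ! q, zs ! q) = a))
        = (\<Sum>ts\<in>nlists n UNIV. (\<Prod>i<n. t $ (ts ! i)) * of_bool (ts ! q = a))"
        using q by (intro zip[of "\<lambda>f. (\<Prod>i<n. t $ f i) * of_bool (f q = a)"]) (auto intro!: arg_cong2[where f = "(*)"] prod.cong)
      also have "\<dots> = (\<Sum>b\<in>UNIV. t $ b * of_bool (b = a))"
        by (rule sum_nlists_marginal[OF t1 q])
      also have "\<dots> = (\<Sum>b\<in>UNIV. if b = a then t $ b else 0)" by (intro sum.cong) auto
      finally show ?thesis by (simp add: a)
    qed
    have "n * \<bar>v $ a - t $ a\<bar> = \<bar>n * v $ a - n * t $ a\<bar>"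
      by (simp add: abs_mult right_diff_distrib[symmetric])
    also have "n * v $ a = (\<Sum>q<n. \<Sum>xs\<in>LX. \<Sum>ys\<in>LY. \<Sum>zs\<in>LZ. Pc xs ys zs * ?I q x y z xs ys zs)"
      using n by (simp add: a vn)
    also have "n * t $ a = (\<Sum>q<n. t $ (x, y, z))" by (simp add: a)
    also have "\<dots> = (\<Sum>q<n. \<Sum>xs\<in>LX. \<Sum>ys\<in>LY. \<Sum>zs\<in>LZ. ?tn xs ys zs * ?I q x y z xs ys zs)"
      by (intro sum.cong refl tq) simp
    also have "\<bar>(\<Sum>q<n. \<Sum>xs\<in>LX. \<Sum>ys\<in>LY. \<Sum>zs\<in>LZ. Pc xs ys zs * ?I q x y z xs ys zs) - \<dots>\<bar>
       = \<bar>\<Sum>q<n. \<Sum>xs\<in>LX. \<Sum>ys\<in>LY. \<Sum>zs\<in>LZ. (Pc xs ys zs - ?tn xs ys zs) * ?I q x y z xs ys zs\<bar>"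
      by (simp only: sum_subtractf left_diff_distrib)
    also have "\<dots> \<le> (\<Sum>q<n. \<Sum>xs\<in>LX. \<Sum>ys\<in>LY. \<Sum>zs\<in>LZ. \<bar>(Pc xs ys zs - ?tn xs ys zs) * ?I q x y z xs ys zs\<bar>)"
      by (intro order.trans[OF sum_abs] sum_mono order.refl)
    also have "\<dots> \<le> (\<Sum>q<n. \<Sum>xs\<in>LX. \<Sum>ys\<in>LY. \<Sum>zs\<in>LZ. \<bar>Pc xs ys zs - ?tn xs ys zs\<bar>)"
      by (intro sum_mono) (simp add: of_bool_def)
    also have "\<dots> \<le> (\<Sum>q<n. \<delta>)" by (intro sum_mono d)
    finally show ?thesis using n by simp
  qed
  moreover have "cond_ent t - log 2 K / n - \<delta> * log 2 CARD('x \<times> 'y \<times> 'z) - (1 + \<delta>) / (n * ln 2) \<le> cond_ent_MY / n"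
  proof -
    let ?S = "LX \<times> LY \<times> LZ"
    let ?P = "\<lambda>s. Pc (fst s) (fst (snd s)) (snd (snd s))" and ?T = "\<lambda>s. ?tn (fst s) (fst (snd s)) (snd (snd s))"
    have sumS: "(\<Sum>s\<in>?S. G (fst s) (fst (snd s)) (snd (snd s))) = (\<Sum>xs\<in>LX. \<Sum>ys\<in>LY. \<Sum>zs\<in>LZ. G xs ys zs)" for G :: "_ \<Rightarrow> _ \<Rightarrow> _ \<Rightarrow> real"
      by (simp only: sum.cartesian_product case_prod_unfold)
    have finS: "finite ?S" using finL by simp
    have "(\<Sum>s\<in>?S. ?P s) = (\<Sum>xs\<in>LX. \<Sum>ys\<in>LY. \<Sum>zs\<in>LZ. Pc xs ys zs)"
      by (rule sumS)
    also have "\<dots> = (\<Sum>xs\<in>LX. \<Sum>ys\<in>LY. \<Sum>zs\<in>LZ. \<Sum>m\<in>{1..K}. P xs m ys zs)"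
      unfolding Pc_def ..
    also have "\<dots> = (\<Sum>m\<in>{1..K}. \<Sum>ys\<in>LY. \<Sum>xs\<in>LX. \<Sum>zs\<in>LZ. P xs m ys zs)"
      by (subst sum.swap[of _ LY LX], subst sum.swap[of _ "{1..K}" LZ], subst sum.swap[of _ "{1..K}" LX], subst sum.swap[of _ "{1..K}" LY]) (rule refl)
    also have "\<dots> = 1" unfolding sum_P by (rule sum_Pm_total)
    finally have P1: "(\<Sum>s\<in>?S. ?P s) = 1" .
    have Ple: "0 \<le> ?P s \<and> ?P s \<le> 1" if s: "s \<in> ?S" for s
      using member_le_sum[OF s, of ?P] finS P1 by (simp add: nonneg)
    have "(replicate n undefined, replicate n undefined, replicate n undefined) \<in> ?S"
      by (simp add: in_nlists_UNIV)
    then have ne: "?S \<noteq> {}" by blast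
    have cardL: "real (card ?S) = real CARD('x \<times> 'y \<times> 'z) ^ n"
    proof -
      have "card LX = CARD('x) ^ n" "card LY = CARD('y) ^ n" "card LZ = CARD('z) ^ n"
        using card_lists_length_eq[of "UNIV :: 'x set" n] card_lists_length_eq[of "UNIV :: 'y set" n] card_lists_length_eq[of "UNIV :: 'z set" n]
        by (simp_all add: nlists_def)
      then show ?thesis by (simp add: card_cartesian_product power_mult_distrib)
    qed
    have "(\<Sum>s\<in>?S. eta (?T s)) - \<delta> * log 2 (card ?S) - (1 + \<delta>) / ln 2 \<le> (\<Sum>s\<in>?S. eta (?P s))"
    proof (rule sum_eta_continuity[OF finS ne Ple])
      show "0 \<le> ?T s" for s by (intro prod_nonneg) (auto simp: t0)
      show "(\<Sum>s\<in>?S. \<bar>?P s - ?T s\<bar>) \<le> \<delta>"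
        using d unfolding sumS[symmetric] .
    qed
    also have "(\<Sum>s\<in>?S. eta (?P s)) = (\<Sum>xs\<in>LX. \<Sum>ys\<in>LY. \<Sum>zs\<in>LZ. eta (Pc xs ys zs))"
      by (rule sumS)
    also have "\<dots> \<le> log 2 K + n * (\<Sum>y\<in>UNIV. eta (pY y)) + cond_ent_MY"
      by (rule entropy_code_le)
    finally have *: "(\<Sum>s\<in>?S. eta (?T s)) - \<delta> * log 2 (card ?S) - (1 + \<delta>) / ln 2 \<le> log 2 K + n * (\<Sum>y\<in>UNIV. eta (pY y)) + cond_ent_MY" .
    have "(\<Sum>s\<in>?S. eta (?T s)) = (\<Sum>ts\<in>nlists n UNIV. eta (\<Prod>i<n. t $ (ts ! i)))"
      unfolding sumS[of "\<lambda>xs ys zs. eta (?tn xs ys zs)"] by (intro zip[of "\<lambda>f. eta (\<Prod>i<n. t $ f i)"] arg_cong[where f = eta] prod.cong) auto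
    also have "\<dots> = n * (\<Sum>a\<in>UNIV. eta (t $ a))"
      by (rule sum_eta_nlists[OF t1 t0])
    finally have HT: "(\<Sum>s\<in>?S. eta (?T s)) = n * (\<Sum>a\<in>UNIV. eta (t $ a))" .
    have lc: "log 2 (card ?S) = n * log 2 CARD('x \<times> 'y \<times> 'z)"
      unfolding cardL by (rule log_nat_power) simp
    have ce: "cond_ent t = (\<Sum>a\<in>UNIV. eta (t $ a)) - (\<Sum>y\<in>UNIV. eta (pY y))"
      by (simp add: cond_ent_def tz pY_def)
    have "n * cond_ent t - log 2 K - n * (\<delta> * log 2 CARD('x \<times> 'y \<times> 'z)) - (1 + \<delta>) / ln 2 \<le> cond_ent_MY"
    proof -
      have "N * (a - b) - k - N * (d * l) - e \<le> c" if "N * a - d * (N * l) - e \<le> k + N * b + c" for N a b c d e k l :: real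
        using that by (simp add: algebra_simps)
      from this[OF *[unfolded HT lc]] show ?thesis unfolding ce .
    qed
    then have "(n * cond_ent t - log 2 K - n * (\<delta> * log 2 CARD('x \<times> 'y \<times> 'z)) - (1 + \<delta>) / ln 2) / n \<le> cond_ent_MY / n"
      by (rule divide_right_mono) simp
    moreover have "(N * a - k - N * b - c / d) / N = a - k / N - b - c / (N * d)" if "N \<noteq> 0" for N a b c d k :: real
      using that by (simp add: diff_divide_distrib)
    ultimately show ?thesis using n by simp
  qed
  ultimately show ?thesis using v by blast
qed

end

text \<open>An infinite sum that is not summable counts as 0, so summability comes first; it follows
  by comparison with \<open>pmf p u + pmf q u\<close>.\<close>

lemma sum_abs_le_tv_dist:
  assumes "finite S"
  shows "(\<Sum>s\<in>S. \<bar>pmf p s - pmf q s\<bar>) \<le> 2 * tv_dist p q"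
proof -
  have s: "pmf r summable_on UNIV" for r :: "'a pmf"
    by (rule abs_summable_summable[OF abs_summable_equivalent[THEN iffD2, OF pmf_abs_summable]])
  have "(\<lambda>u. pmf p u + pmf q u) summable_on UNIV"
    by (intro summable_on_add s)
  then have "(\<lambda>u. \<bar>pmf p u - pmf q u\<bar>) summable_on UNIV"
  proof (rule summable_on_comparison_test)
    fix u
    show "\<bar>pmf p u - pmf q u\<bar> \<le> pmf p u + pmf q u"
      using pmf_nonneg[of p u] pmf_nonneg[of q u] by linarith
  qed simp
  then have "(\<Sum>s\<in>S. \<bar>pmf p s - pmf q s\<bar>) \<le> (\<Sum>\<^sub>\<infinity>u. \<bar>pmf p u - pmf q u\<bar>)"
    using assms by (intro finite_sum_le_infsum) auto
  then show ?thesis by (simp add: tv_dist_def)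
qed

text \<open>The excess of \<open>p'\<close> over \<open>p\<close> on \<open>S\<close> equals the
  mass that \<open>p\<close> has outside \<open>S\<close>. As \<open>q\<close> lives on
  \<open>S\<close>, this mass is at most the distance of \<open>p\<close> and \<open>q\<close> on
  \<open>S\<close>. So the unhalved distance at most doubles, which gives 4 in terms of
  \<open>tv_dist\<close>.\<close>

lemma sum_abs_le_tv_dist_dominating:
  assumes S: "finite S" "set_pmf p' \<subseteq> S" "set_pmf q \<subseteq> S" and le: "\<And>s. s \<in> S \<Longrightarrow> pmf p s \<le> pmf p' s"
  shows "(\<Sum>s\<in>S. \<bar>pmf p' s - pmf q s\<bar>) \<le> 4 * tv_dist p q"
proof -
  have "(\<Sum>s\<in>S. \<bar>pmf p' s - pmf q s\<bar>) \<le> (\<Sum>s\<in>S. (pmf p' s - pmf p s) + \<bar>pmf p s - pmf q s\<bar>)"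
  proof (rule sum_mono)
    fix s assume "s \<in> S"
    from le[OF this] show "\<bar>pmf p' s - pmf q s\<bar> \<le> (pmf p' s - pmf p s) + \<bar>pmf p s - pmf q s\<bar>" by linarith
  qed
  also have "\<dots> = (sum (pmf p') S - sum (pmf p) S) + (\<Sum>s\<in>S. \<bar>pmf p s - pmf q s\<bar>)"
    by (simp add: sum.distrib sum_subtractf)
  also have "sum (pmf p') S = sum (pmf q) S"
    using S by (simp add: sum_pmf_eq_1)
  also have "sum (pmf q) S - sum (pmf p) S = (\<Sum>s\<in>S. pmf q s - pmf p s)"
    by (simp add: sum_subtractf)
  also have "\<dots> \<le> (\<Sum>s\<in>S. \<bar>pmf p s - pmf q s\<bar>)"
    by (intro sum_mono) linarith
  finally show ?thesis using sum_abs_le_tv_dist[OF S(1), of p q] by linarith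
qed

lemma ex_conditional:
  fixes pXY :: "('x::finite \<times> 'y::finite) pmf"
  shows "\<exists>W. \<forall>x y. pmf pXY (x, y) = pmf (map_pmf fst pXY) x * pmf (W x) y"
proof -
  let ?px = "pmf (map_pmf fst pXY)"
  have px: "?px x = (\<Sum>y\<in>UNIV. pmf pXY (x, y))" for x
    by (rule pmf_map_reindex) (auto simp: inj_on_def)
  have "\<exists>w. \<forall>y. pmf pXY (x, y) = ?px x * pmf w y" for x
  proof (cases "?px x = 0")
    case True
    then have "pmf pXY (x, y) = 0" for y
      unfolding px by (subst (asm) sum_nonneg_eq_0_iff) auto
    then show ?thesis using True by auto
  next
    case False
    then have "\<exists>w. set_pmf w \<subseteq> UNIV \<and> (\<forall>y\<in>UNIV. pmf w y = pmf pXY (x, y) / ?px x)"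
      by (intro ex_pmf_of_fun) (auto simp: sum_divide_distrib[symmetric] px[symmetric])
    then obtain w where "\<forall>y. pmf w y = pmf pXY (x, y) / ?px x" by blast
    then show ?thesis using False by (intro exI[of _ w]) simp
  qed
  then show ?thesis by metis
qed

lemma code_near_target_hull:
  fixes pXY :: "('x::finite \<times> 'y::finite) pmf" and pZ :: "'x \<Rightarrow> 'y \<Rightarrow> 'z::finite pmf"
  assumes W: "\<And>x y. pmf pXY (x, y) = pmf (map_pmf fst pXY) x * pmf (W x) y"
    and enc: "\<And>xs. set_pmf (enc xs) \<subseteq> {1..K}" and n_pos: "n > 0" and K_pos: "K > 0" and K_le: "real K \<le> 2 powr (n * R)"
    and tv: "4 * tv_dist (code_n pXY enc dec n) (target_n pXY pZ n) \<le> \<delta>"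
  defines "t \<equiv> target_vec pXY pZ"
  shows "\<exists>v h. (v, h) \<in> convex hull (chain_points W) \<and> (\<forall>i. \<bar>v $ i - t $ i\<bar> \<le> \<delta>) \<and>
    cond_ent t - R - \<delta> * log 2 CARD('x \<times> 'y \<times> 'z) - (1 + \<delta>) / (n * ln 2) \<le> h"
proof -
  \<comment> \<open>The decoder may output words of any length; sending those of the wrong length to a fixed word
    at most doubles the distance to the target.\<close>
  let ?f = "\<lambda>zs. if length zs = n then zs else replicate n (undefined :: 'z)"
  define dec' where "dec' m ys = map_pmf ?f (dec m ys)" for m ys
  interpret block_code pXY W n K enc dec'
    by unfold_locales (use W enc n_pos K_pos in \<open>auto simp: dec'_def in_nlists_UNIV\<close>)
  have le: "pmf (dec m ys) zs \<le> pmf (dec' m ys) zs" if "length zs = n" for m ys zs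
    unfolding dec'_def pmf_map using that by (auto simp: pmf.rep_eq intro!: measure_pmf.finite_measure_mono)
  let ?S = "LX \<times> LY \<times> LZ"
  let ?p = "code_n pXY enc dec n" and ?p' = "code_n pXY enc dec' n" and ?q = "target_n pXY pZ n"
  have Pc: "Pc xs ys zs = pmf ?p' (xs, ys, zs)" if "xs \<in> LX" "ys \<in> LY" for xs ys zs
    using that unfolding pmf_code_n pmf_bind_sum[OF finite_atLeastAtMost enc] Pc_def P_def
    by (simp add: pmf_source_n in_nlists_UNIV pn_def sum_distrib_left mult.assoc)
  have tn: "(\<Prod>i<n. t $ (xs ! i, ys ! i, zs ! i)) = pmf ?q (xs, ys, zs)" if "xs \<in> LX" "ys \<in> LY" "zs \<in> LZ" for xs ys zs
    using that by (simp add: t_def target_vec_nth pmf_target_n in_nlists_UNIV)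
  have "(\<Sum>s\<in>?S. \<bar>pmf ?p' s - pmf ?q s\<bar>) \<le> 4 * tv_dist ?p ?q"
  proof (rule sum_abs_le_tv_dist_dominating)
    show "finite ?S" using finL by simp
    show "set_pmf ?p' \<subseteq> ?S"
    proof
      fix s assume "s \<in> set_pmf ?p'"
      then obtain xs ys m zs where t: "s = (xs, ys, zs)" "(xs, ys) \<in> set_pmf (source_n pXY n)" "zs \<in> set_pmf (dec' m ys)"
        unfolding code_n_def by auto
      then show "s \<in> ?S" using source_n_length[OF t(2)] by (auto simp: in_nlists_UNIV dec'_def)
    qed
    show "set_pmf ?q \<subseteq> ?S"
    proof
      fix s assume "s \<in> set_pmf ?q"
      then show "s \<in> ?S"
        by (cases s) (auto simp: set_pmf_iff pmf_target_n in_nlists_UNIV split: if_splits)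
    qed
    show "pmf ?p s \<le> pmf ?p' s" if "s \<in> ?S" for s
    proof -
      obtain xs ys zs where s: "s = (xs, ys, zs)" by (cases s)
      with that have "length zs = n" by (simp add: in_nlists_UNIV)
      then show ?thesis
        unfolding s pmf_code_n pmf_bind_sum[OF finite_atLeastAtMost enc]
        by (intro mult_left_mono sum_mono le) auto
    qed
  qed
  also have "(\<Sum>s\<in>?S. \<bar>pmf ?p' s - pmf ?q s\<bar>) = (\<Sum>xs\<in>LX. \<Sum>ys\<in>LY. \<Sum>zs\<in>LZ. \<bar>pmf ?p' (xs, ys, zs) - pmf ?q (xs, ys, zs)\<bar>)"
    by (simp add: sum.cartesian_product case_prod_unfold)
  also have "\<dots> = (\<Sum>xs\<in>LX. \<Sum>ys\<in>LY. \<Sum>zs\<in>LZ. \<bar>Pc xs ys zs - (\<Prod>i<n. t $ (xs ! i, ys ! i, zs ! i))\<bar>)"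
    by (intro sum.cong refl) (simp add: Pc tn)
  finally have d: "(\<Sum>xs\<in>LX. \<Sum>ys\<in>LY. \<Sum>zs\<in>LZ. \<bar>Pc xs ys zs - (\<Prod>i<n. t $ (xs ! i, ys ! i, zs ! i))\<bar>) \<le> \<delta>"
    using tv by linarith
  have "log 2 K \<le> log 2 (2 powr (n * R))" using K_pos by (intro log_mono K_le) auto
  then have "log 2 K / n \<le> R" using n_pos by (simp add: field_simps)
  with converse_bound[OF d[unfolded t_def]] show ?thesis
    unfolding t_def by (meson diff_left_mono diff_right_mono order.trans)
qed

lemma converse:
  fixes pXY :: "('x::finite \<times> 'y::finite) pmf" and pZ :: "'x \<Rightarrow> 'y \<Rightarrow> 'z::finite pmf"
  assumes W: "\<And>x y. pmf pXY (x, y) = pmf (map_pmf fst pXY) x * pmf (W x) y"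
    and R: "achievable pXY pZ R"
  shows "\<exists>h. (target_vec pXY pZ, h) \<in> convex hull (chain_points W) \<and> cond_ent (target_vec pXY pZ) - R \<le> h"
proof -
  let ?t = "target_vec pXY pZ"
  let ?H = "convex hull (chain_points W) :: ((real ^ ('x \<times> 'y \<times> 'z)) \<times> real) set"
  from R have R0: "0 \<le> R" by (simp add: achievable_def)
  from R obtain enc :: "nat \<Rightarrow> 'x list \<Rightarrow> nat pmf" and dec :: "nat \<Rightarrow> nat \<Rightarrow> 'y list \<Rightarrow> 'z list pmf"
    where enc: "\<And>n xs. set_pmf (enc n xs) \<subseteq> {1..num_msgs n R}"
      and tv: "\<And>\<epsilon>. \<epsilon> > 0 \<Longrightarrow> \<exists>N. \<forall>n\<ge>N. tv_dist (code_n pXY (enc n) (dec n) n) (target_n pXY pZ n) \<le> \<epsilon>"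
    unfolding achievable_def by blast
  define l where "l = log 2 (real CARD('x \<times> 'y \<times> 'z))"
  have "0 < CARD('x \<times> 'y \<times> 'z)" by (rule zero_less_card_finite)
  then have l0: "0 \<le> l" unfolding l_def by (subst zero_le_log_cancel_iff) linarith+
  have ex: "\<exists>s\<in>?H. (\<forall>i. \<bar>fst s $ i - ?t $ i\<bar> \<le> \<epsilon>) \<and> cond_ent ?t - R - \<epsilon> \<le> snd s" if e: "0 < \<epsilon>" "\<epsilon> \<le> 1" for \<epsilon>
  proof -
    \<comment> \<open>The coordinate error \<delta> and the continuity loss \<delta> l together use
      half of \<epsilon>; the other half pays for the term of order 1/n. The 1 added to l covers l =
      0, which occurs for one-point alphabets.\<close>
    define \<delta> where "\<delta> = \<epsilon> / (2 * (l + 1))"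
    have d: "0 < \<delta>" using e l0 by (simp add: \<delta>_def)
    have "2 * (l + 1) \<noteq> 0" using l0 by simp
    then have "\<delta> * (2 * (l + 1)) = \<epsilon>" unfolding \<delta>_def by (metis nonzero_eq_divide_eq)
    then have dl: "\<delta> * l + \<delta> = \<epsilon> / 2" by (simp add: algebra_simps)
    have dl0: "0 \<le> \<delta> * l" using d l0 by simp
    then have d1: "\<delta> \<le> \<epsilon>" "\<delta> \<le> 1" "\<delta> * l \<le> \<epsilon> / 2" using dl d e by linarith+
    obtain N where N: "\<And>n. n \<ge> N \<Longrightarrow> tv_dist (code_n pXY (enc n) (dec n) n) (target_n pXY pZ n) \<le> \<delta> / 4"
      using tv[of "\<delta> / 4"] d by auto
    \<comment> \<open>As 1 + \<delta> \<le> 2, a block length beyond this makes (1 + \<delta>)/(n ln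
      2) at most \<epsilon>/2.\<close>
    obtain M :: nat where M: "4 / (\<epsilon> * ln 2) < real M" using reals_Archimedean2 by blast
    define n where "n = max (max N M) 1"
    have n: "n > 0" "N \<le> n" "real M \<le> real n" by (auto simp: n_def)
    obtain v h where vh: "(v, h) \<in> ?H" "\<forall>i. \<bar>v $ i - ?t $ i\<bar> \<le> \<delta>"
      "cond_ent ?t - R - \<delta> * l - (1 + \<delta>) / (n * ln 2) \<le> h"
      using code_near_target_hull[where enc = "enc n" and dec = "dec n" and pZ = pZ and \<delta> = \<delta>,
        OF W enc n(1) code_rate_bounds(2)[OF R0] code_rate_bounds(3)[OF R0]] N[OF n(2)]
      unfolding l_def by (auto simp del: split_paired_All card_prod)
    have "4 / (\<epsilon> * ln 2) < real n" using M n by linarith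
    then have "4 < \<epsilon> * (n * ln 2)" using e by (simp add: field_simps)
    then have "(1 + \<delta>) / (n * ln 2) \<le> \<epsilon> / 2"
      using n d1 by (simp add: pos_divide_le_eq)
    then have "cond_ent ?t - R - \<epsilon> \<le> h" using vh(3) d1 by linarith
    moreover have "\<forall>i. \<bar>v $ i - ?t $ i\<bar> \<le> \<epsilon>" using vh(2) d1(1) by (meson order.trans)
    ultimately show ?thesis using vh(1) by (intro bexI[of _ "(v, h)"]) auto
  qed
  define \<epsilon> where "\<epsilon> k = 1 / real (Suc k)" for k
  have eps: "0 < \<epsilon> k" "\<epsilon> k \<le> 1" for k by (auto simp: \<epsilon>_def)
  have "\<forall>k. \<exists>s. s \<in> ?H \<and> (\<forall>i. \<bar>fst s $ i - ?t $ i\<bar> \<le> \<epsilon> k) \<and> cond_ent ?t - R - \<epsilon> k \<le> snd s"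
    using ex[OF eps] by blast
  then obtain s where s: "\<And>k. s k \<in> ?H" "\<And>k i. \<bar>fst (s k) $ i - ?t $ i\<bar> \<le> \<epsilon> k" "\<And>k. cond_ent ?t - R - \<epsilon> k \<le> snd (s k)"
    by metis
  \<comment> \<open>Compactness keeps the limit in the hull; since the errors
    \<open>\<epsilon> k\<close> tend to 0, the limit lies exactly above the target.\<close>
  obtain a r where a: "a \<in> ?H" "strict_mono r" "(s \<circ> r) \<longlonglongrightarrow> a"
    using compact_hull_chain_points[of W] s(1) unfolding compact_def by blast
  have e0: "(\<lambda>k. \<epsilon> (r k)) \<longlonglongrightarrow> 0"
    using LIMSEQ_subseq_LIMSEQ[OF LIMSEQ_inverse_real_of_nat a(2)] by (simp add: comp_def \<epsilon>_def inverse_eq_divide)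
  have f: "(\<lambda>k. fst (s (r k))) \<longlonglongrightarrow> fst a" and g: "(\<lambda>k. snd (s (r k))) \<longlonglongrightarrow> snd a"
    using tendsto_fst[OF a(3)] tendsto_snd[OF a(3)] by (simp_all add: comp_def)
  have "fst a $ i = ?t $ i" for i
  proof -
    have "(\<lambda>k. fst (s (r k)) $ i - ?t $ i) \<longlonglongrightarrow> 0"
      by (rule Lim_null_comparison[OF _ e0]) (simp add: s(2))
    then have "(\<lambda>k. fst (s (r k)) $ i) \<longlonglongrightarrow> ?t $ i"
      by (rule LIM_zero_cancel)
    then show ?thesis
      using LIMSEQ_unique tendsto_vec_nth[OF f] by blast
  qed
  then have "fst a = ?t" by (simp add: vec_eq_iff)
  moreover have "cond_ent ?t - R \<le> snd a"
  proof (rule LIMSEQ_le[OF _ g])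
    show "(\<lambda>k. cond_ent ?t - R - \<epsilon> (r k)) \<longlonglongrightarrow> cond_ent ?t - R"
      using tendsto_diff[OF tendsto_const e0, of "cond_ent ?t - R"] by simp
  qed (use s(3) in auto)
  ultimately show ?thesis using a(1) by (intro exI[of _ "snd a"]) (metis prod.collapse)
qed

theorem theorem2:
  fixes pXY :: "('x::finite \<times> 'y::finite) pmf"
    and pZ :: "'x \<Rightarrow> 'y \<Rightarrow> 'z::finite pmf"
  shows "(\<forall>pU. feasible_U pXY pZ pU \<longrightarrow> R_NS pXY pZ \<le> info_XZ_U_given_Y pXY pZ pU) \<and>
         (\<exists>pU. feasible_U pXY pZ pU \<and>
               (\<forall>x y z. set_pmf (pU x y z) \<subseteq> {0..<CARD('x) * CARD('y) * CARD('z) + 2}) \<and>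
               info_XZ_U_given_Y pXY pZ pU = R_NS pXY pZ)"
proof (intro conjI allI impI)
  fix pU assume "feasible_U pXY pZ pU"
  then show "R_NS pXY pZ \<le> info_XZ_U_given_Y pXY pZ pU" by (rule R_NS_le_info)
next
  obtain W where W: "\<And>x y. pmf pXY (x, y) = pmf (map_pmf fst pXY) x * pmf (W x) y"
    using ex_conditional by blast
  let ?t = "target_vec pXY pZ"
  let ?H = "convex hull (chain_points W) :: ((real ^ ('x \<times> 'y \<times> 'z)) \<times> real) set"
  have "closed {s :: (real ^ ('x \<times> 'y \<times> 'z)) \<times> real. fst s = ?t}"
    by (intro closed_Collect_eq continuous_intros)
  then have "compact (?H \<inter> {s. fst s = ?t})"
    by (intro compact_Int_closed compact_hull_chain_points)
  moreover have "?H \<inter> {s. fst s = ?t} \<noteq> {}"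
    using target_in_hull[OF W, of pZ] by force
  \<comment> \<open>The highest point above the target: its second component is the largest possible
    H(XZ|Y,U).\<close>
  ultimately obtain s where s: "s \<in> ?H \<inter> {s. fst s = ?t}" "\<And>s'. s' \<in> ?H \<inter> {s. fst s = ?t} \<Longrightarrow> snd s' \<le> snd s"
    using continuous_attains_sup[of "?H \<inter> {s. fst s = ?t}" snd] continuous_on_snd[OF continuous_on_id] by blast
  define h where "h = snd s"
  have h: "(?t, h) \<in> ?H" using s(1) unfolding h_def by (metis (mono_tags) IntD1 IntD2 mem_Collect_eq prod.collapse)
  have max: "h' \<le> h" if "(?t, h') \<in> ?H" for h' using s(2)[of "(?t, h')"] that by (auto simp: h_def)
  obtain pU where pU: "feasible_U pXY pZ pU" "\<forall>x y z. set_pmf (pU x y z) \<subseteq> {0..<CARD('x) * CARD('y) * CARD('z) + 2}"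
    "info_XZ_U_given_Y pXY pZ pU = cond_ent ?t - h"
    using hull_point_feasible[OF W h] by blast
  \<comment> \<open>For every achievable R the converse puts a point above the target at height at
    least \<open>cond_ent ?t - R\<close>. The infimum needs a nonempty set of rates, which
    achievability provides.\<close>
  have "cond_ent ?t - h \<le> R_NS pXY pZ"
    unfolding R_NS_def
  proof (rule cInf_greatest)
    show "{R. achievable pXY pZ R} \<noteq> {}" using R_NS_le_info(2)[OF pU(1)] by blast
    fix R assume "R \<in> {R. achievable pXY pZ R}"
    then obtain h' where h': "(?t, h') \<in> ?H" "cond_ent ?t - R \<le> h'" using converse[OF W, of pZ R] by auto
    with max[OF h'(1)] show "cond_ent ?t - h \<le> R" by linarith
  qed
  then have "info_XZ_U_given_Y pXY pZ pU = R_NS pXY pZ"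
    using R_NS_le_info(1)[OF pU(1)] pU(3) by linarith
  with pU show "\<exists>pU. feasible_U pXY pZ pU \<and>
               (\<forall>x y z. set_pmf (pU x y z) \<subseteq> {0..<CARD('x) * CARD('y) * CARD('z) + 2}) \<and>
               info_XZ_U_given_Y pXY pZ pU = R_NS pXY pZ" by blast
qed

end
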